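(* Let $T$ be a complete first-order theory with monster model $\mathfrak{C}$, let $A\subseteq B$, and let $p\in S(B)$ be an NIP type which does not fork over $A$. If there is an infinite Morley sequence $I\subseteq B$ generated by $p$ over $A$, then $p\restriction AI$ is NIP.
   Context: $T$ is a complete first-order theory in a language $\mathcal{L}$ and $\mathfrak{C}$ is its monster model. All sets of parameters are subsets of $\mathfrak{C}$; a global type is a type over $\mathfrak{C}$. Tuples may be infinite. $AI$ denotes $A\cup I$. For a property $t$, $\varphi^{(t)}$ is $\varphi$ if $t$ holds and $\neg\varphi$ otherwise. NIP type: a partial type $\pi(x)$ has IP if there are a formula $\varphi(x,y)\in\mathcal{L}$ and a sequence $(a_i)_{i<\omega}$ of realizations of $\pi$ such that for every $s\subseteq\omega$ the set $\{\varphi(a_i,y)^{(i\in s)} : i<\omega\}$ is consistent; $\pi$ is NIP if it does not have IP. Morley sequences: let $(X,<)$ be a linear order, $p\in S(B)$ and $A\subseteq B$. A sequence $(a_i)_{i\in X}$ is generated by $p$ over $A$ if $a_i\models p\restriction Aa_{<i}$ for all $i\in X$. A Morley sequence over $A$ is a sequence $(a_i)_{i\in X}$ which is $A$-indiscernible and such that $\mathrm{tp}(a_i/Aa_{<i})$ does not fork over $A$ for every $i\in X$. A Morley sequence generated by $p$ over $A$ is a sequence generated by $p$ over $A$ which is Morley over $A$. *)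

theory Defs
  imports Main
begin

unbundle cardinal_syntax

section \<open>First-order languages, formulas and structures\<close>

text \<open>
  The free slots of a formula are labelled by elements of an arbitrary type \<open>'c\<close>; bound variables
  are named by natural numbers and live in a separate namespace, so that relabelling free slots
  never captures. The choice of \<open>'c\<close> determines what kind of formula is meant, for instance:
  \<open>'c = 'x + nat\<close> for a formula \<open>\<phi>(x,y)\<close> with \<open>x\<close> indexed by \<open>'x\<close>, and \<open>'c = 'x + 'm\<close> for a formula
  in \<open>x\<close> with parameters from \<open>'m\<close> (\<open>Inl i\<close> is the variable \<open>x\<^sub>i\<close>, \<open>Inr m\<close> is the parameter \<open>m\<close>).
\<close>

datatype (dead 'f, free_tm: 'c) tm =
    Free 'c
  | Bnd nat
  | App 'f "('f, 'c) tm list"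
  for map: relabel_tm

datatype (dead 'f, dead 'r, free_fm: 'c) fm =
    Equal "('f, 'c) tm" "('f, 'c) tm"
  | Rel 'r "('f, 'c) tm list"
  | Neg "('f, 'r, 'c) fm"
  | Conj "('f, 'r, 'c) fm" "('f, 'r, 'c) fm"
  | Ex nat "('f, 'r, 'c) fm"
  for map: relabel_fm

text \<open>Symbols form subsets of the types \<open>'f\<close> and \<open>'r\<close>, so that either kind may be absent;
  function symbols of arity 0 are constants.\<close>

record ('f, 'r) lang =
  Funs :: "'f set"
  Rels :: "'r set"
  fun_arity :: "'f \<Rightarrow> nat"
  rel_arity :: "'r \<Rightarrow> nat"

primrec wf_tm :: "('f, 'r) lang \<Rightarrow> ('f, 'c) tm \<Rightarrow> bool" where
  "wf_tm L (Free c) \<longleftrightarrow> True"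
| "wf_tm L (Bnd n) \<longleftrightarrow> True"
| "wf_tm L (App f ts) \<longleftrightarrow>
     f \<in> Funs L \<and> length ts = fun_arity L f \<and> list_all id (map (wf_tm L) ts)"

primrec wf_fm :: "('f, 'r) lang \<Rightarrow> ('f, 'r, 'c) fm \<Rightarrow> bool" where
  "wf_fm L (Equal s t) \<longleftrightarrow> wf_tm L s \<and> wf_tm L t"
| "wf_fm L (Rel r ts) \<longleftrightarrow> r \<in> Rels L \<and> length ts = rel_arity L r \<and> list_all (wf_tm L) ts"
| "wf_fm L (Neg \<phi>) \<longleftrightarrow> wf_fm L \<phi>"
| "wf_fm L (Conj \<phi> \<psi>) \<longleftrightarrow> wf_fm L \<phi> \<and> wf_fm L \<psi>"
| "wf_fm L (Ex n \<phi>) \<longleftrightarrow> wf_fm L \<phi>"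

primrec loose_tm :: "('f, 'c) tm \<Rightarrow> nat set" where
  "loose_tm (Free c) = {}"
| "loose_tm (Bnd n) = {n}"
| "loose_tm (App f ts) = \<Union> (set (map loose_tm ts))"

primrec loose_fm :: "('f, 'r, 'c) fm \<Rightarrow> nat set" where
  "loose_fm (Equal s t) = loose_tm s \<union> loose_tm t"
| "loose_fm (Rel r ts) = (\<Union>t\<in>set ts. loose_tm t)"
| "loose_fm (Neg \<phi>) = loose_fm \<phi>"
| "loose_fm (Conj \<phi> \<psi>) = loose_fm \<phi> \<union> loose_fm \<psi>"
| "loose_fm (Ex n \<phi>) = loose_fm \<phi> - {n}"

definition is_formula :: "('f, 'r) lang \<Rightarrow> ('f, 'r, 'c) fm \<Rightarrow> bool" where
  "is_formula L \<phi> \<longleftrightarrow> wf_fm L \<phi> \<and> loose_fm \<phi> = {}"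

text \<open>The universe of a structure is the whole (nonempty) type \<open>'m\<close>.\<close>

record ('f, 'r, 'm) fo_struct =
  fun_interp :: "'f \<Rightarrow> 'm list \<Rightarrow> 'm"
  rel_interp :: "'r \<Rightarrow> 'm list \<Rightarrow> bool"

primrec eval :: "('f, 'r, 'm) fo_struct \<Rightarrow> ('c \<Rightarrow> 'm) \<Rightarrow> (nat \<Rightarrow> 'm) \<Rightarrow> ('f, 'c) tm \<Rightarrow> 'm" where
  "eval M e s (Free c) = e c"
| "eval M e s (Bnd n) = s n"
| "eval M e s (App f ts) = fun_interp M f (map (eval M e s) ts)"

primrec sat_at ::
  "('f, 'r, 'm) fo_struct \<Rightarrow> ('c \<Rightarrow> 'm) \<Rightarrow> (nat \<Rightarrow> 'm) \<Rightarrow> ('f, 'r, 'c) fm \<Rightarrow> bool" where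
  "sat_at M e s (Equal t u) \<longleftrightarrow> eval M e s t = eval M e s u"
| "sat_at M e s (Rel r ts) \<longleftrightarrow> rel_interp M r (map (eval M e s) ts)"
| "sat_at M e s (Neg \<phi>) \<longleftrightarrow> \<not> sat_at M e s \<phi>"
| "sat_at M e s (Conj \<phi> \<psi>) \<longleftrightarrow> sat_at M e s \<phi> \<and> sat_at M e s \<psi>"
| "sat_at M e s (Ex n \<phi>) \<longleftrightarrow> (\<exists>d. sat_at M e (s(n := d)) \<phi>)"

text \<open>The assignment of the bound variables is irrelevant for formulas in the sense of
  \<^const>\<open>is_formula\<close>.\<close>

definition sat :: "('f, 'r, 'm) fo_struct \<Rightarrow> ('c \<Rightarrow> 'm) \<Rightarrow> ('f, 'r, 'c) fm \<Rightarrow> bool" where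
  "sat M e \<phi> \<longleftrightarrow> sat_at M e (\<lambda>_. undefined) \<phi>"

section \<open>Formulas with parameters and types\<close>

definition params :: "('f, 'r, 'x + 'm) fm \<Rightarrow> 'm set" where
  "params \<theta> = {m. Inr m \<in> free_fm \<theta>}"

definition forms :: "('f, 'r) lang \<Rightarrow> 'm set \<Rightarrow> ('f, 'r, 'x + 'm) fm set" where
  "forms L B = {\<theta>. is_formula L \<theta> \<and> params \<theta> \<subseteq> B}"

definition holds :: "('f, 'r, 'm) fo_struct \<Rightarrow> ('x \<Rightarrow> 'm) \<Rightarrow> ('f, 'r, 'x + 'm) fm \<Rightarrow> bool" where
  "holds M a \<theta> \<longleftrightarrow> sat M (case_sum a id) \<theta>"

definition realizes ::
  "('f, 'r, 'm) fo_struct \<Rightarrow> ('x \<Rightarrow> 'm) \<Rightarrow> ('f, 'r, 'x + 'm) fm set \<Rightarrow> bool" where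
  "realizes M a \<pi> \<longleftrightarrow> (\<forall>\<theta>\<in>\<pi>. holds M a \<theta>)"

text \<open>Consistency with the elementary diagram of \<open>M\<close> is finite satisfiability in \<open>M\<close>.\<close>

definition consistent :: "('f, 'r, 'm) fo_struct \<Rightarrow> ('f, 'r, 'x + 'm) fm set \<Rightarrow> bool" where
  "consistent M \<pi> \<longleftrightarrow> (\<forall>\<pi>0. finite \<pi>0 \<and> \<pi>0 \<subseteq> \<pi> \<longrightarrow> (\<exists>a. realizes M a \<pi>0))"

text \<open>\<open>types L M B\<close> is the set \<open>S(B)\<close> of complete types over \<open>B\<close> in the variables indexed by \<open>'x\<close>.\<close>

definition types ::
  "('f, 'r) lang \<Rightarrow> ('f, 'r, 'm) fo_struct \<Rightarrow> 'm set \<Rightarrow> ('f, 'r, 'x + 'm) fm set set" where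
  "types L M B =
     {p. p \<subseteq> forms L B \<and> consistent M p \<and> (\<forall>\<theta>\<in>forms L B. \<theta> \<in> p \<or> Neg \<theta> \<in> p)}"

definition tp ::
  "('f, 'r) lang \<Rightarrow> ('f, 'r, 'm) fo_struct \<Rightarrow> ('x \<Rightarrow> 'm) \<Rightarrow> 'm set \<Rightarrow> ('f, 'r, 'x + 'm) fm set" where
  "tp L M a A = {\<theta> \<in> forms L A. holds M a \<theta>}"

definition restr ::
  "('f, 'r) lang \<Rightarrow> ('f, 'r, 'x + 'm) fm set \<Rightarrow> 'm set \<Rightarrow> ('f, 'r, 'x + 'm) fm set" where
  "restr L p A = p \<inter> forms L A"

section \<open>Complete theories and monster models\<close>

text \<open>Theories are deductively closed. Consistency of \<open>T\<close> is not part of the following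
  definition; it is supplied by the existence of a model.\<close>

definition sentences :: "('f, 'r) lang \<Rightarrow> ('f, 'r, nat) fm set" where
  "sentences L = {\<phi>. is_formula L \<phi> \<and> free_fm \<phi> = {}}"

definition complete_theory :: "('f, 'r) lang \<Rightarrow> ('f, 'r, nat) fm set \<Rightarrow> bool" where
  "complete_theory L T \<longleftrightarrow> T \<subseteq> sentences L \<and> (\<forall>\<phi>\<in>sentences L. \<phi> \<in> T \<or> Neg \<phi> \<in> T)"

definition is_model :: "('f, 'r, 'm) fo_struct \<Rightarrow> ('f, 'r, nat) fm set \<Rightarrow> bool" where
  "is_model M T \<longleftrightarrow> (\<forall>\<phi>\<in>T. \<forall>e. sat M e \<phi>)"

definition saturated :: "('f, 'r) lang \<Rightarrow> 'k rel \<Rightarrow> ('f, 'r, 'm) fo_struct \<Rightarrow> bool" where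
  "saturated L \<kappa> M \<longleftrightarrow>
     (\<forall>A :: 'm set. |A| <o \<kappa> \<longrightarrow>
       (\<forall>p \<in> types L M A. \<exists>a :: unit \<Rightarrow> 'm. realizes M a p))"

definition automorphism ::
  "('f, 'r) lang \<Rightarrow> ('f, 'r, 'm) fo_struct \<Rightarrow> ('m \<Rightarrow> 'm) \<Rightarrow> bool" where
  "automorphism L M \<sigma> \<longleftrightarrow> bij \<sigma> \<and>
     (\<forall>f\<in>Funs L. \<forall>ms. length ms = fun_arity L f \<longrightarrow>
        \<sigma> (fun_interp M f ms) = fun_interp M f (map \<sigma> ms)) \<and>
     (\<forall>r\<in>Rels L. \<forall>ms. length ms = rel_arity L r \<longrightarrow>
        rel_interp M r (map \<sigma> ms) = rel_interp M r ms)"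

definition elementary_map ::
  "('f, 'r) lang \<Rightarrow> ('f, 'r, 'm) fo_struct \<Rightarrow> 'm set \<Rightarrow> ('m \<Rightarrow> 'm) \<Rightarrow> bool" where
  "elementary_map L M A h \<longleftrightarrow>
     (\<forall>\<phi> :: ('f, 'r, 'm) fm. is_formula L \<phi> \<and> free_fm \<phi> \<subseteq> A \<longrightarrow> sat M h \<phi> = sat M id \<phi>)"

definition strongly_homogeneous ::
  "('f, 'r) lang \<Rightarrow> 'k rel \<Rightarrow> ('f, 'r, 'm) fo_struct \<Rightarrow> bool" where
  "strongly_homogeneous L \<kappa> M \<longleftrightarrow>
     (\<forall>A h. |A| <o \<kappa> \<and> elementary_map L M A h \<longrightarrow>
       (\<exists>\<sigma>. automorphism L M \<sigma> \<and> (\<forall>m\<in>A. \<sigma> m = h m)))"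

text \<open>The cardinal \<open>\<kappa>\<close> (a cardinal order) measures smallness: a set \<open>A\<close> is small if \<open>|A| <o \<kappa>\<close>.
  The language is required to be small and \<open>\<kappa>\<close> to be uncountable.\<close>

definition monster_model ::
  "('f, 'r) lang \<Rightarrow> ('f, 'r, nat) fm set \<Rightarrow> 'k rel \<Rightarrow> ('f, 'r, 'm) fo_struct \<Rightarrow> bool" where
  "monster_model L T \<kappa> M \<longleftrightarrow>
     Card_order \<kappa> \<and> natLeq <o \<kappa> \<and> |Funs L| <o \<kappa> \<and> |Rels L| <o \<kappa> \<and>
     is_model M T \<and> saturated L \<kappa> M \<and> strongly_homogeneous L \<kappa> M"

section \<open>NIP types\<close>

definition signed :: "bool \<Rightarrow> ('f, 'r, 'c) fm \<Rightarrow> ('f, 'r, 'c) fm" where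
  "signed t \<phi> = (if t then \<phi> else Neg \<phi>)"

text \<open>For \<open>\<phi>(x,y)\<close>, \<open>inst_left a \<phi>\<close> is \<open>\<phi>(a,y)\<close> and \<open>inst_right b \<phi>\<close> is \<open>\<phi>(x,b)\<close>. The tuple \<open>y\<close> is
  indexed by \<^typ>\<open>nat\<close>, but only finitely many of its entries occur in a given formula.\<close>

definition inst_left :: "('x \<Rightarrow> 'm) \<Rightarrow> ('f, 'r, 'x + nat) fm \<Rightarrow> ('f, 'r, nat + 'm) fm" where
  "inst_left a = relabel_fm (case_sum (\<lambda>v. Inr (a v)) Inl)"

definition inst_right :: "(nat \<Rightarrow> 'm) \<Rightarrow> ('f, 'r, 'x + nat) fm \<Rightarrow> ('f, 'r, 'x + 'm) fm" where
  "inst_right b = relabel_fm (case_sum Inl (\<lambda>n. Inr (b n)))"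

text \<open>Realizations are taken in \<open>M\<close>, so this is the right notion for types over small sets.\<close>

definition has_IP ::
  "('f, 'r) lang \<Rightarrow> ('f, 'r, 'm) fo_struct \<Rightarrow> ('f, 'r, 'x + 'm) fm set \<Rightarrow> bool" where
  "has_IP L M \<pi> \<longleftrightarrow>
     (\<exists>(\<phi> :: ('f, 'r, 'x + nat) fm) (a :: nat \<Rightarrow> 'x \<Rightarrow> 'm).
        is_formula L \<phi> \<and> (\<forall>i. realizes M (a i) \<pi>) \<and>
        (\<forall>s :: nat set. consistent M {signed (i \<in> s) (inst_left (a i) \<phi>) | i. True}))"

definition NIP ::
  "('f, 'r) lang \<Rightarrow> ('f, 'r, 'm) fo_struct \<Rightarrow> ('f, 'r, 'x + 'm) fm set \<Rightarrow> bool" where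
  "NIP L M \<pi> \<longleftrightarrow> \<not> has_IP L M \<pi>"

section \<open>Forking\<close>

text \<open>Inconsistency is required for every \<open>k\<close> indices, repetitions among the \<open>b\<^sub>i\<close> being allowed.\<close>

definition divides ::
  "('f, 'r) lang \<Rightarrow> ('f, 'r, 'm) fo_struct \<Rightarrow> 'm set \<Rightarrow> ('f, 'r, 'x + 'm) fm \<Rightarrow> bool" where
  "divides L M A \<theta> \<longleftrightarrow>
     (\<exists>(\<phi> :: ('f, 'r, 'x + nat) fm) (b :: nat \<Rightarrow> 'm) (bs :: nat \<Rightarrow> nat \<Rightarrow> 'm) (k :: nat).
        is_formula L \<phi> \<and> \<theta> = inst_right b \<phi> \<and>
        (\<forall>i. tp L M (bs i) A = tp L M b A) \<and>
        (\<forall>S. finite S \<and> card S = k \<longrightarrow> \<not> consistent M {inst_right (bs i) \<phi> | i. i \<in> S}))"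

text \<open>A set of formulas forks over \<open>A\<close> if it implies a finite disjunction of formulas with parameters
  in \<open>M\<close>, each of which divides over \<open>A\<close>.\<close>

definition forks ::
  "('f, 'r) lang \<Rightarrow> ('f, 'r, 'm) fo_struct \<Rightarrow> 'm set \<Rightarrow> ('f, 'r, 'x + 'm) fm set \<Rightarrow> bool" where
  "forks L M A \<pi> \<longleftrightarrow>
     (\<exists>\<pi>0 D. finite \<pi>0 \<and> \<pi>0 \<subseteq> \<pi> \<and> finite D \<and> (\<forall>\<delta>\<in>D. divides L M A \<delta>) \<and>
        (\<forall>a. realizes M a \<pi>0 \<longrightarrow> (\<exists>\<delta>\<in>D. holds M a \<delta>)))"

section \<open>Morley sequences\<close>

text \<open>The set of all entries of the tuples \<open>a\<^sub>i\<close>, \<open>i \<in> X\<close>.\<close>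

definition entries :: "('i \<Rightarrow> 'x \<Rightarrow> 'm) \<Rightarrow> 'i set \<Rightarrow> 'm set" where
  "entries a X = (\<Union>i\<in>X. range (a i))"

definition before :: "'i::linorder set \<Rightarrow> 'i \<Rightarrow> 'i set" where
  "before X i = {j \<in> X. j < i}"

text \<open>The variable \<open>(k,v)\<close> stands for entry \<open>v\<close> of the \<open>k\<close>-th tuple; increasing \<open>n\<close>-tuples of indices
  are given by \<open>g\<close> and \<open>h\<close> on \<open>{..<n}\<close>.\<close>

definition indiscernible ::
  "('f, 'r) lang \<Rightarrow> ('f, 'r, 'm) fo_struct \<Rightarrow> 'm set \<Rightarrow> 'i::linorder set \<Rightarrow> ('i \<Rightarrow> 'x \<Rightarrow> 'm) \<Rightarrow> bool" where
  "indiscernible L M A X a \<longleftrightarrow>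
     (\<forall>n g h. strict_mono_on {..<n} g \<and> g ` {..<n} \<subseteq> X \<and>
              strict_mono_on {..<n} h \<and> h ` {..<n} \<subseteq> X \<longrightarrow>
       (\<forall>\<theta> :: ('f, 'r, (nat \<times> 'x) + 'm) fm.
          \<theta> \<in> forms L A \<and> (\<forall>k v. Inl (k, v) \<in> free_fm \<theta> \<longrightarrow> k < n) \<longrightarrow>
          holds M (\<lambda>(k, v). a (g k) v) \<theta> = holds M (\<lambda>(k, v). a (h k) v) \<theta>))"

text \<open>Only meaningful for \<open>p\<close> over a set containing \<open>A\<close> and all \<open>a\<^sub>j\<close> with \<open>j < i\<close> for some \<open>i \<in> X\<close>.\<close>

definition generated ::
  "('f, 'r) lang \<Rightarrow> ('f, 'r, 'm) fo_struct \<Rightarrow> ('f, 'r, 'x + 'm) fm set \<Rightarrow> 'm set \<Rightarrow>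
   'i::linorder set \<Rightarrow> ('i \<Rightarrow> 'x \<Rightarrow> 'm) \<Rightarrow> bool" where
  "generated L M p A X a \<longleftrightarrow>
     (\<forall>i\<in>X. realizes M (a i) (restr L p (A \<union> entries a (before X i))))"

definition morley ::
  "('f, 'r) lang \<Rightarrow> ('f, 'r, 'm) fo_struct \<Rightarrow> 'm set \<Rightarrow> 'i::linorder set \<Rightarrow> ('i \<Rightarrow> 'x \<Rightarrow> 'm) \<Rightarrow> bool" where
  "morley L M A X a \<longleftrightarrow>
     indiscernible L M A X a \<and>
     (\<forall>i\<in>X. \<not> forks L M A (tp L M (a i) (A \<union> entries a (before X i))))"

definition morley_generated ::
  "('f, 'r) lang \<Rightarrow> ('f, 'r, 'm) fo_struct \<Rightarrow> ('f, 'r, 'x + 'm) fm set \<Rightarrow> 'm set \<Rightarrow>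
   'i::linorder set \<Rightarrow> ('i \<Rightarrow> 'x \<Rightarrow> 'm) \<Rightarrow> bool" where
  "morley_generated L M p A X a \<longleftrightarrow> generated L M p A X a \<and> morley L M A X a"

end

theory Submission
  imports Defs "HOL-Library.Ramsey"
begin

text \<open>Extend \<open>p\<close> to a global type \<open>q\<close> that does not fork over \<open>A\<close>. The crucial point is that \<open>q\<close> is
  insensitive to \<open>A\<close>-indiscernible sequences: if \<open>k\<^sub>0, k\<^sub>1, \<dots>\<close> is \<open>A\<close>-indiscernible and \<open>P\<close> is over \<open>A\<close>,
  then \<open>P(x,k\<^sub>0) \<in> q\<close> iff \<open>P(x,k\<^sub>1) \<in> q\<close> (lemma \<open>generically_const\<close>). Because \<open>p\<close> is NIP, some
  \<open>\<theta> \<in> p\<close> bounds the size of the sets of realizations of \<open>\<theta>\<close> that \<open>P\<close> shatters. By Ramsey's theorem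
  one may assume that the tail of the sequence is homogeneous for the patterns which \<open>P(x,\<cdot>)\<close> can cut out
  with some \<open>x\<close> satisfying \<open>\<theta>\<close>. If \<open>P(x,k\<^sub>0) \<and> \<not> P(x,k\<^sub>1)\<close> were in \<open>q\<close>, then, as it does not divide over
  \<open>A\<close> even in conjunction with \<open>\<theta>\<close>, its conjugates under the shifts \<open>k\<^sub>j \<mapsto> k\<^bsub>j+2i\<^esub>\<close> would have a common
  solution for many \<open>i\<close> at once. That solution alternates along the sequence, homogeneity then
  produces every pattern, and passing to the dual family contradicts the bound.

  It follows that a tuple consisting of an increasing part of \<open>I\<close> continued by any \<open>d\<^sub>0, d\<^sub>1, \<dots>\<close> with
  \<open>d\<^sub>i \<Turnstile> q \<restriction> AId\<^bsub><i\<^esub>\<close> has the same type over \<open>A\<close> as an increasing tuple of \<open>I\<close> of the same length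
  (lemma \<open>generic_seq_EM\<close>; the last element of \<open>I\<close>, if there is one, has to be left out).

  Now suppose that \<open>p \<restriction> AI\<close> has IP, witnessed by \<open>\<phi>\<close>. Choose \<open>\<rho> \<in> p\<close> on which \<open>\<phi>\<close> shatters no large set.
  Since \<open>q \<restriction> AId\<^bsub><i\<^esub>\<close> looks like \<open>q \<restriction> AI\<close>, every one of its formulas has arbitrarily large finite
  sets of solutions that \<open>\<phi>\<close> shatters, and these cannot lie inside \<open>\<rho>\<close>; hence
  \<open>q \<restriction> AId\<^bsub><i\<^esub>\<close> has realizations outside \<open>\<rho>\<close> (lemma \<open>ex_avoiding\<close>), besides those inside \<open>\<rho>\<close>.
  So for every \<open>s\<close> there is a sequence \<open>d\<close> as above with \<open>d\<^sub>i\<close> in \<open>\<rho>\<close> exactly when \<open>i \<in> s\<close>. All these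
  sequences have the same type over \<open>A\<close>. In particular they have the type of such a sequence \<open>e\<close> whose
  entries satisfy any prescribed formula of \<open>p\<close>, and so the formula \<open>\<rho>(x,y)\<close>, with its parameters replaced
  by variables, shatters \<open>e\<close>. This contradicts that \<open>p\<close> is NIP.

  Throughout, formulas with parameters are handled through the predicates on assignments that they
  define, so that manipulating formulas becomes manipulating predicates.\<close>

section \<open>Formulas under relabelling, quantification and automorphisms\<close>

lemma eval_cong:
  "\<lbrakk>\<And>c. c \<in> free_tm t \<Longrightarrow> e c = e' c; \<And>n. n \<in> loose_tm t \<Longrightarrow> s n = s' n\<rbrakk>
    \<Longrightarrow> eval M e s t = eval M e' s' t"
proof (induction t)
  case (App f ts)
  have "map (eval M e s) ts = map (eval M e' s') ts"
    using App.prems by (intro map_cong refl App.IH) (auto 4 4)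
  then show ?case by (simp del: map_eq_conv)
qed auto

lemma sat_at_cong:
  "\<lbrakk>\<And>c. c \<in> free_fm \<phi> \<Longrightarrow> e c = e' c; \<And>n. n \<in> loose_fm \<phi> \<Longrightarrow> s n = s' n\<rbrakk>
    \<Longrightarrow> sat_at M e s \<phi> = sat_at M e' s' \<phi>"
proof (induction \<phi> arbitrary: s s')
  case (Equal t u)
  have "eval M e s t = eval M e' s' t" "eval M e s u = eval M e' s' u"
    using Equal by (auto intro!: eval_cong)
  then show ?case by simp
next
  case (Rel r ts)
  have "map (eval M e s) ts = map (eval M e' s') ts"
    using Rel by (intro map_cong refl eval_cong) auto
  then show ?case by (simp del: map_eq_conv)
next
  case (Conj \<phi> \<psi>)
  have "sat_at M e s \<phi> = sat_at M e' s' \<phi>" "sat_at M e s \<psi> = sat_at M e' s' \<psi>"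
    using Conj.prems by (auto intro!: Conj.IH)
  then show ?case by simp
next
  case (Ex n \<phi>)
  have "sat_at M e (s(n := d)) \<phi> = sat_at M e' (s'(n := d)) \<phi>" for d
    using Ex.prems by (intro Ex.IH) auto
  then show ?case by simp
next
  case (Neg \<phi>)
  then show ?case by (metis fm.set(3) loose_fm.simps(3) sat_at.simps(3))
qed

lemma sat_at_formula: "is_formula L \<phi> \<Longrightarrow> sat_at M e s \<phi> = sat M e \<phi>"
  unfolding sat_def is_formula_def by (intro sat_at_cong) auto

lemma sat_cong: "(\<And>c. c \<in> free_fm \<phi> \<Longrightarrow> e c = e' c) \<Longrightarrow> sat M e \<phi> = sat M e' \<phi>"
  unfolding sat_def by (intro sat_at_cong) auto

lemma eval_relabel: "eval M e s (relabel_tm f t) = eval M (e \<circ> f) s t"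
proof (induction t)
  case (App g ts)
  have "map (eval M e s) (map (relabel_tm f) ts) = map (eval M (e \<circ> f) s) ts"
    using App by (simp add: comp_def)
  then show ?case by (simp only: eval.simps tm.map)
qed auto

lemma sat_at_relabel: "sat_at M e s (relabel_fm f \<phi>) = sat_at M (e \<circ> f) s \<phi>"
proof (induction \<phi> arbitrary: s)
  case (Rel r ts)
  have "map (eval M e s) (map (relabel_tm f) ts) = map (eval M (e \<circ> f) s) ts"
    by (simp add: eval_relabel)
  then show ?case by (simp only: sat_at.simps fm.map)
qed (auto simp: eval_relabel)

lemma sat_relabel: "sat M e (relabel_fm f \<phi>) = sat M (e \<circ> f) \<phi>"
  by (simp add: sat_def sat_at_relabel)

lemma wf_relabel_tm [simp]: "wf_tm L (relabel_tm f t) = wf_tm L t"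
  by (induction t) (auto simp: list_all_iff)

lemma loose_relabel_tm [simp]: "loose_tm (relabel_tm f t) = loose_tm t"
  by (induction t) auto

lemma wf_relabel [simp]: "wf_fm L (relabel_fm f \<phi>) = wf_fm L \<phi>"
  by (induction \<phi>) (auto simp: list_all_iff)

lemma loose_relabel [simp]: "loose_fm (relabel_fm f \<phi>) = loose_fm \<phi>"
  by (induction \<phi>) auto

lemma is_formula_relabel [simp]: "is_formula L (relabel_fm f \<phi>) = is_formula L \<phi>"
  by (simp add: is_formula_def)

lemma is_formula_Neg [simp]: "is_formula L (Neg \<phi>) = is_formula L \<phi>"
  and is_formula_Conj [simp]: "is_formula L (Conj \<phi> \<psi>) \<longleftrightarrow> is_formula L \<phi> \<and> is_formula L \<psi>"
  by (auto simp: is_formula_def)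

lemma finite_free_tm: "finite (free_tm t)"
  by (induction t) auto

lemma finite_free_fm: "finite (free_fm \<phi>)"
  by (induction \<phi>) (auto simp: finite_free_tm)

text \<open>Existential quantification binds natural numbers only, so quantifying over a slot requires
  replacing it by a bound variable. Taking a number that occurs nowhere in the formula, not even
  in a quantifier, avoids capture.\<close>

primrec bind_tm :: "'c \<Rightarrow> nat \<Rightarrow> ('f, 'c) tm \<Rightarrow> ('f, 'c) tm" where
  "bind_tm c n (Free d) = (if d = c then Bnd n else Free d)"
| "bind_tm c n (Bnd k) = Bnd k"
| "bind_tm c n (App f ts) = App f (map (bind_tm c n) ts)"

primrec bind_fm :: "'c \<Rightarrow> nat \<Rightarrow> ('f, 'r, 'c) fm \<Rightarrow> ('f, 'r, 'c) fm" where
  "bind_fm c n (Equal s t) = Equal (bind_tm c n s) (bind_tm c n t)"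
| "bind_fm c n (Rel r ts) = Rel r (map (bind_tm c n) ts)"
| "bind_fm c n (Neg \<phi>) = Neg (bind_fm c n \<phi>)"
| "bind_fm c n (Conj \<phi> \<psi>) = Conj (bind_fm c n \<phi>) (bind_fm c n \<psi>)"
| "bind_fm c n (Ex k \<phi>) = Ex k (bind_fm c n \<phi>)"

primrec bnds_fm :: "('f, 'r, 'c) fm \<Rightarrow> nat set" where
  "bnds_fm (Equal s t) = loose_tm s \<union> loose_tm t"
| "bnds_fm (Rel r ts) = (\<Union>t\<in>set ts. loose_tm t)"
| "bnds_fm (Neg \<phi>) = bnds_fm \<phi>"
| "bnds_fm (Conj \<phi> \<psi>) = bnds_fm \<phi> \<union> bnds_fm \<psi>"
| "bnds_fm (Ex n \<phi>) = insert n (bnds_fm \<phi>)"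

lemma finite_loose_tm: "finite (loose_tm t)"
  by (induction t) auto

lemma finite_bnds_fm: "finite (bnds_fm \<phi>)"
  by (induction \<phi>) (auto simp: finite_loose_tm)

lemma eval_bind:
  "n \<notin> loose_tm t \<Longrightarrow> eval M e (s(n := d)) (bind_tm c n t) = eval M (e(c := d)) s t"
proof (induction t)
  case (App g ts)
  have "map (eval M e (s(n := d))) (map (bind_tm c n) ts) = map (eval M (e(c := d)) s) ts"
    using App by (simp add: fun_upd_def)
  then show ?case by (simp only: eval.simps bind_tm.simps)
qed auto

lemma sat_at_bind:
  "n \<notin> bnds_fm \<phi> \<Longrightarrow> sat_at M e (s(n := d)) (bind_fm c n \<phi>) = sat_at M (e(c := d)) s \<phi>"
proof (induction \<phi> arbitrary: s)
  case (Rel r ts)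
  have "map (eval M e (s(n := d))) (map (bind_tm c n) ts) = map (eval M (e(c := d)) s) ts"
    using Rel by (simp add: eval_bind)
  then show ?case by (simp only: sat_at.simps bind_fm.simps)
next
  case (Ex k \<phi>)
  have "sat_at M e (s(n := d, k := x)) (bind_fm c n \<phi>) = sat_at M (e(c := d)) (s(k := x)) \<phi>" for x
  proof -
    have "s(n := d, k := x) = s(k := x, n := d)" using Ex.prems by (simp add: fun_upd_twist)
    moreover have "n \<notin> bnds_fm \<phi>" using Ex.prems by simp
    ultimately show ?thesis using Ex.IH [of "s(k := x)"] by metis
  qed
  then show ?case unfolding bind_fm.simps sat_at.simps by metis
qed (auto simp: eval_bind)

lemma wf_bind_tm: "wf_tm L t \<Longrightarrow> wf_tm L (bind_tm c n t)"
  by (induction t) (auto simp: list_all_iff)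

lemma wf_bind: "wf_fm L \<phi> \<Longrightarrow> wf_fm L (bind_fm c n \<phi>)"
  by (induction \<phi>) (auto simp: list_all_iff wf_bind_tm)

lemma loose_bind_tm: "loose_tm (bind_tm c n t) \<subseteq> insert n (loose_tm t)"
  by (induction t) auto

lemma loose_bind: "loose_fm (bind_fm c n \<phi>) \<subseteq> insert n (loose_fm \<phi>)"
  using loose_bind_tm by (induction \<phi>) fastforce+

lemma free_bind_tm: "free_tm (bind_tm c n t) = free_tm t - {c}"
  by (induction t) auto

lemma free_bind: "free_fm (bind_fm c n \<phi>) = free_fm \<phi> - {c}"
  by (induction \<phi>) (auto simp: free_bind_tm)

lemma bind_exists:
  fixes M :: "('f, 'r, 'm) fo_struct"
  assumes "is_formula L \<phi>"
  obtains \<psi> where "is_formula L \<psi>" "free_fm \<psi> = free_fm \<phi> - {c}"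
    "\<And>e. sat M e \<psi> \<longleftrightarrow> (\<exists>d. sat M (e(c := d)) \<phi>)"
proof -
  obtain n where n: "n \<notin> bnds_fm \<phi>"
    using finite_bnds_fm ex_new_if_finite [of "bnds_fm \<phi>"] by auto
  show thesis
  proof (rule that [of "Ex n (bind_fm c n \<phi>)"])
    show "is_formula L (Ex n (bind_fm c n \<phi>))"
      using assms loose_bind [of c n \<phi>] by (auto simp: is_formula_def wf_bind)
    show "free_fm (Ex n (bind_fm c n \<phi>)) = free_fm \<phi> - {c}"
      by (simp add: free_bind)
    show "sat M e (Ex n (bind_fm c n \<phi>)) \<longleftrightarrow> (\<exists>d. sat M (e(c := d)) \<phi>)" for e
      by (simp add: sat_def sat_at_bind n)
  qed
qed

lemma eval_automorphism:
  assumes "automorphism L M \<sigma>"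
  shows "wf_tm L t \<Longrightarrow> eval M (\<sigma> \<circ> e) (\<sigma> \<circ> s) t = \<sigma> (eval M e s t)"
proof (induction t)
  case (App g ts)
  then have *: "map (eval M (\<sigma> \<circ> e) (\<sigma> \<circ> s)) ts = map \<sigma> (map (eval M e s) ts)"
    by (simp add: list_all_iff comp_def)
  show ?case
    unfolding eval.simps * using App.prems assms by (simp add: automorphism_def)
qed auto

lemma sat_at_automorphism:
  assumes "automorphism L M \<sigma>"
  shows "wf_fm L \<phi> \<Longrightarrow> sat_at M (\<sigma> \<circ> e) (\<sigma> \<circ> s) \<phi> = sat_at M e s \<phi>"
proof (induction \<phi> arbitrary: s)
  case (Equal t u)
  then have *: "eval M (\<sigma> \<circ> e) (\<sigma> \<circ> s) t = \<sigma> (eval M e s t)"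
    "eval M (\<sigma> \<circ> e) (\<sigma> \<circ> s) u = \<sigma> (eval M e s u)"
    by (auto intro: eval_automorphism [OF assms])
  have "inj \<sigma>" using assms by (simp add: automorphism_def bij_def)
  then show ?case unfolding sat_at.simps * by (simp add: inj_eq)
next
  case (Rel r ts)
  then have *: "map (eval M (\<sigma> \<circ> e) (\<sigma> \<circ> s)) ts = map \<sigma> (map (eval M e s) ts)"
    by (auto simp: list_all_iff eval_automorphism [OF assms])
  show ?case
    unfolding sat_at.simps * using Rel.prems assms by (simp add: automorphism_def del: map_map)
next
  case (Ex n \<phi>)
  have "sat_at M (\<sigma> \<circ> e) ((\<sigma> \<circ> s)(n := \<sigma> d)) \<phi> = sat_at M e (s(n := d)) \<phi>" for d
    using Ex.IH [of "s(n := d)"] Ex.prems unfolding fun_upd_comp wf_fm.simps by metis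
  moreover have "surj \<sigma>" using assms by (simp add: automorphism_def bij_def)
  ultimately show ?case by (metis sat_at.simps(5) surjD)
qed auto

lemma sat_automorphism:
  assumes "automorphism L M \<sigma>" "is_formula L \<phi>"
  shows "sat M (\<sigma> \<circ> e) \<phi> = sat M e \<phi>"
  using sat_at_automorphism [OF assms(1)] assms(2) sat_at_formula [OF assms(2)]
  by (metis is_formula_def)

section \<open>Definable predicates\<close>

definition definable ::
  "('f, 'r) lang \<Rightarrow> ('f, 'r, 'm) fo_struct \<Rightarrow> 'm set \<Rightarrow> (('c \<Rightarrow> 'm) \<Rightarrow> bool) \<Rightarrow> bool" where
  "definable L M A P \<longleftrightarrow> (\<exists>\<theta>\<in>forms L A. \<forall>e. holds M e \<theta> \<longleftrightarrow> P e)"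

lemma definable_holds: "\<theta> \<in> forms L A \<Longrightarrow> definable L M A (\<lambda>e. holds M e \<theta>)"
  by (auto simp: definable_def)

lemma definable_sat:
  assumes "is_formula L \<phi>"
  shows "definable L M A (\<lambda>e. sat M e \<phi>)"
proof -
  have "relabel_fm Inl \<phi> \<in> forms L A" using assms by (auto simp: forms_def params_def fm.set_map)
  moreover have "holds M e (relabel_fm Inl \<phi>) = sat M e \<phi>" for e
    unfolding holds_def sat_relabel by (simp add: comp_def)
  ultimately show ?thesis unfolding definable_def by blast
qed

lemma definable_mono: "definable L M A P \<Longrightarrow> A \<subseteq> B \<Longrightarrow> definable L M B P"
  by (auto simp: definable_def forms_def)

lemma holds_Neg [simp]: "holds M e (Neg \<theta>) \<longleftrightarrow> \<not> holds M e \<theta>"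
  and holds_Conj [simp]: "holds M e (Conj \<theta> \<psi>) \<longleftrightarrow> holds M e \<theta> \<and> holds M e \<psi>"
  by (auto simp: holds_def sat_def)

lemma Neg_forms: "\<theta> \<in> forms L A \<Longrightarrow> Neg \<theta> \<in> forms L A"
  by (auto simp: forms_def params_def)

lemma Conj_forms: "\<theta> \<in> forms L A \<Longrightarrow> \<psi> \<in> forms L A \<Longrightarrow> Conj \<theta> \<psi> \<in> forms L A"
  by (auto simp: forms_def params_def)

lemma finite_params: "finite (params \<theta>)"
  unfolding params_def using finite_vimageI [OF finite_free_fm, of Inr] by (simp add: vimage_def)

lemma forms_mono: "A \<subseteq> B \<Longrightarrow> forms L A \<subseteq> forms L B"
  by (auto simp: forms_def)

lemma definable_not: "definable L M A P \<Longrightarrow> definable L M A (\<lambda>e. \<not> P e)"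
  unfolding definable_def by (metis Neg_forms holds_Neg)

lemma definable_conj:
  "definable L M A P \<Longrightarrow> definable L M A Q \<Longrightarrow> definable L M A (\<lambda>e. P e \<and> Q e)"
  unfolding definable_def by (metis Conj_forms holds_Conj)

lemma definable_True: "definable L M A (\<lambda>e. True)"
proof -
  let ?\<theta> = "Ex 0 (Equal (Bnd 0) (Bnd 0))"
  have "?\<theta> \<in> forms L A" by (auto simp: forms_def params_def is_formula_def)
  moreover have "holds M e ?\<theta>" for e by (simp add: holds_def sat_def)
  ultimately show ?thesis unfolding definable_def by blast
qed

lemma definable_iff_const: "definable L M A P \<Longrightarrow> definable L M A (\<lambda>e. P e \<longleftrightarrow> b)"
  by (cases b) (auto intro: definable_not)

lemma definable_ball:
  assumes "finite S" "\<And>s. s \<in> S \<Longrightarrow> definable L M A (P s)"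
  shows "definable L M A (\<lambda>e. \<forall>s\<in>S. P s e)"
  using assms
proof (induction S)
  case empty
  then show ?case by (simp add: definable_True)
next
  case (insert s S)
  then show ?case by (auto intro: definable_conj)
qed

lemma definable_all_less:
  fixes n :: nat
  assumes "\<And>i. i < n \<Longrightarrow> definable L M A (P i)"
  shows "definable L M A (\<lambda>e. \<forall>i<n. P i e)"
proof -
  have "definable L M A (\<lambda>e. \<forall>i\<in>{..<n}. P i e)"
    by (rule definable_ball) (use assms in auto)
  then show ?thesis by (simp add: Ball_def)
qed

text \<open>Each slot may be replaced by another slot or by a parameter; relabelling slots and plugging in
  a tuple are the two instances needed most.\<close>

lemma definable_subst:
  assumes "definable L M A P" "\<And>c m. h c = Inr m \<Longrightarrow> m \<in> A"
  shows "definable L M A (\<lambda>e. P (case_sum e id \<circ> h))"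
proof -
  obtain \<theta> where \<theta>: "\<theta> \<in> forms L A" "\<And>e. holds M e \<theta> = P e"
    using assms(1) by (auto simp: definable_def)
  let ?\<theta> = "relabel_fm (case_sum h Inr) \<theta>"
  have "?\<theta> \<in> forms L A"
    using \<theta>(1) assms(2) by (fastforce simp: forms_def params_def fm.set_map split: sum.splits)
  moreover have "holds M e ?\<theta> = P (case_sum e id \<circ> h)" for e
  proof -
    have "case_sum e id \<circ> case_sum h Inr = case_sum (case_sum e id \<circ> h) id"
      by (auto simp: fun_eq_iff split: sum.splits)
    then show ?thesis using \<theta>(2) [of "case_sum e id \<circ> h"] by (simp only: holds_def sat_relabel)
  qed
  ultimately show ?thesis by (auto simp: definable_def)
qed

lemma definable_relabel:
  assumes "definable L M A P"
  shows "definable L M A (\<lambda>e. P (\<lambda>c. e (f c)))"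
  using definable_subst [OF assms, of "\<lambda>c. Inl (f c)"] by (simp add: comp_def)

lemma definable_inst:
  fixes P :: "('x + 'c \<Rightarrow> 'm) \<Rightarrow> bool"
  assumes "definable L M A P" "range k \<subseteq> A"
  shows "definable L M A (\<lambda>x. P (case_sum x k))"
proof -
  have "k c \<in> A" for c using assms(2) by blast
  then have *: "definable L M A (\<lambda>x. P (case_sum x id \<circ> case_sum Inl (\<lambda>c. Inr (k c))))"
    by (intro definable_subst assms(1)) (auto split: sum.splits)
  have "case_sum x id \<circ> case_sum Inl (\<lambda>c. Inr (k c)) = case_sum x k" for x :: "'x \<Rightarrow> 'm"
    by (auto simp: fun_eq_iff split: sum.splits)
  with * show ?thesis by (simp only:)
qed

lemma definable_finite_support:
  fixes P :: "('c \<Rightarrow> 'm) \<Rightarrow> bool"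
  assumes "definable L M A P"
  obtains F where "finite F" "\<And>e e'. (\<And>c. c \<in> F \<Longrightarrow> e c = e' c) \<Longrightarrow> P e = P e'"
proof -
  obtain \<theta> where \<theta>: "\<theta> \<in> forms L A" "\<And>e. holds M e \<theta> = P e"
    using assms by (auto simp: definable_def)
  have fin: "finite {c. Inl c \<in> free_fm \<theta>}"
    using finite_vimageI [OF finite_free_fm, of Inl] by (simp add: vimage_def)
  show thesis
  proof (rule that [OF fin])
    fix e e' :: "'c \<Rightarrow> 'm" assume "\<And>c. c \<in> {c. Inl c \<in> free_fm \<theta>} \<Longrightarrow> e c = e' c"
    then have "holds M e \<theta> = holds M e' \<theta>"
      unfolding holds_def by (intro sat_cong) (auto split: sum.splits)
    then show "P e = P e'" by (simp add: \<theta>)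
  qed
qed

lemma definable_eq: "definable L M A (\<lambda>e. e c = e d)"
proof -
  have "Equal (Free (Inl c)) (Free (Inl d)) \<in> forms L A"
    by (auto simp: forms_def params_def is_formula_def)
  moreover have "holds M e (Equal (Free (Inl c)) (Free (Inl d))) \<longleftrightarrow> e c = e d" for e
    by (simp add: holds_def sat_def)
  ultimately show ?thesis unfolding definable_def by blast
qed

lemma definable_eq_param:
  assumes "m \<in> A"
  shows "definable L M A (\<lambda>e. e c = m)"
proof -
  have "Equal (Free (Inl c)) (Free (Inr m)) \<in> forms L A"
    using assms by (auto simp: forms_def params_def is_formula_def)
  moreover have "holds M e (Equal (Free (Inl c)) (Free (Inr m))) \<longleftrightarrow> e c = m" for e
    by (simp add: holds_def sat_def)
  ultimately show ?thesis unfolding definable_def by blast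
qed

text \<open>The parameters of a formula are themselves slots. Evaluating these slots by another map than
  the identity is what moves the parameters; a map that fixes \<open>A\<close> pointwise moves none of them.\<close>

lemma definable_params:
  assumes "definable L M A P"
  obtains \<phi> where "is_formula L \<phi>"
    "\<And>e. P e \<longleftrightarrow> sat M (case_sum e id) \<phi>"
    "\<And>e g. (\<And>m. m \<in> A \<Longrightarrow> g m = m) \<Longrightarrow> sat M (case_sum e g) \<phi> \<longleftrightarrow> P e"
proof -
  obtain \<theta> where \<theta>: "\<theta> \<in> forms L A" "\<And>e. holds M e \<theta> = P e"
    using assms by (auto simp: definable_def)
  show thesis
  proof (rule that [of \<theta>])
    show "is_formula L \<theta>" using \<theta>(1) by (simp add: forms_def)
    show *: "P e \<longleftrightarrow> sat M (case_sum e id) \<theta>" for e using \<theta>(2) by (simp add: holds_def)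
    show "sat M (case_sum e g) \<theta> \<longleftrightarrow> P e" if "\<And>m. m \<in> A \<Longrightarrow> g m = m" for e g
      unfolding * using that \<theta>(1)
      by (intro sat_cong) (auto simp: forms_def params_def split: sum.splits)
  qed
qed

lemma definable_ex_upd:
  fixes P :: "('c \<Rightarrow> 'm) \<Rightarrow> bool"
  assumes "definable L M A P"
  shows "definable L M A (\<lambda>e. \<exists>d. P (e(c := d)))"
proof -
  obtain \<theta> where \<theta>: "\<theta> \<in> forms L A" "\<And>e. holds M e \<theta> = P e"
    using assms by (auto simp: definable_def)
  obtain \<psi> where \<psi>: "is_formula L \<psi>" "free_fm \<psi> = free_fm \<theta> - {Inl c}"
    "\<And>e. sat M e \<psi> \<longleftrightarrow> (\<exists>d. sat M (e(Inl c := d)) \<theta>)"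
    using bind_exists [of L \<theta> "Inl c" M] \<theta>(1) unfolding forms_def mem_Collect_eq by metis
  have "(case_sum e id)(Inl c := d) = case_sum (e(c := d)) id" for e :: "'c \<Rightarrow> 'm" and d
    by (auto simp: fun_eq_iff split: sum.splits)
  then have "holds M e \<psi> \<longleftrightarrow> (\<exists>d. P (e(c := d)))" for e
    unfolding holds_def \<psi>(3) \<theta>(2) [symmetric] by simp
  moreover have "\<psi> \<in> forms L A" using \<psi> \<theta>(1) by (auto simp: forms_def params_def)
  ultimately show ?thesis by (auto simp: definable_def)
qed

text \<open>Quantifying over arbitrarily many slots at once is harmless, because only finitely many of them
  occur in the formula.\<close>

lemma definable_ex_on:
  assumes "definable L M A P"
  shows "definable L M A (\<lambda>e. \<exists>e'. (\<forall>c. c \<notin> V \<longrightarrow> e' c = e c) \<and> P e')"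
proof -
  have fin: "definable L M A (\<lambda>e. \<exists>e'. (\<forall>c. c \<notin> W \<longrightarrow> e' c = e c) \<and> P e')" if "finite W" for W
    using that
  proof (induction W)
    case empty
    have "(\<exists>e'. (\<forall>c. c \<notin> {} \<longrightarrow> e' c = e c) \<and> P e') = P e" for e
      by (metis empty_iff ext)
    then show ?case using assms by simp
  next
    case (insert w W)
    have "(\<exists>d e'. (\<forall>c. c \<notin> W \<longrightarrow> e' c = (e(w := d)) c) \<and> P e')
        \<longleftrightarrow> (\<exists>e'. (\<forall>c. c \<notin> insert w W \<longrightarrow> e' c = e c) \<and> P e')" for e
    proof (intro iffI; elim exE conjE)
      fix d e' assume "\<forall>c. c \<notin> W \<longrightarrow> e' c = (e(w := d)) c" "P e'"
      then show "\<exists>e'. (\<forall>c. c \<notin> insert w W \<longrightarrow> e' c = e c) \<and> P e'"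
        by (intro exI [of _ e']) auto
    next
      fix e' assume "\<forall>c. c \<notin> insert w W \<longrightarrow> e' c = e c" "P e'"
      then show "\<exists>d e'. (\<forall>c. c \<notin> W \<longrightarrow> e' c = (e(w := d)) c) \<and> P e'"
        by (intro exI [of _ "e' w"] exI [of _ e']) auto
    qed
    then show ?case using definable_ex_upd [OF insert.IH, of w] by simp
  qed
  obtain F where F: "finite F" "\<And>e e'. (\<And>c. c \<in> F \<Longrightarrow> e c = e' c) \<Longrightarrow> P e = P e'"
    using definable_finite_support [OF assms] by metis
  have "(\<exists>e'. (\<forall>c. c \<notin> V \<longrightarrow> e' c = e c) \<and> P e')
      \<longleftrightarrow> (\<exists>e'. (\<forall>c. c \<notin> V \<inter> F \<longrightarrow> e' c = e c) \<and> P e')" for e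
  proof (intro iffI; elim exE conjE)
    fix e' assume "\<forall>c. c \<notin> V \<longrightarrow> e' c = e c" "P e'"
    then show "\<exists>e'. (\<forall>c. c \<notin> V \<inter> F \<longrightarrow> e' c = e c) \<and> P e'"
      using F(2) [of e' "\<lambda>c. if c \<in> V \<inter> F then e' c else e c"]
      by (intro exI [of _ "\<lambda>c. if c \<in> V \<inter> F then e' c else e c"]) auto
  qed auto
  then show ?thesis using fin [of "V \<inter> F"] F(1) by simp
qed

lemma definable_ex_left:
  fixes P :: "('x + 'c \<Rightarrow> 'm) \<Rightarrow> bool"
  assumes "definable L M A P"
  shows "definable L M A (\<lambda>e. \<exists>x. P (case_sum x e))"
proof -
  \<comment> \<open>The predicate no longer depends on the quantified slots, so any slot may be put in their place.\<close>
  let ?Q = "\<lambda>e. \<exists>e'. (\<forall>c. c \<notin> range Inl \<longrightarrow> e' c = e c) \<and> P e'"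
  have "definable L M A (\<lambda>e. ?Q (\<lambda>c. e (case_sum (\<lambda>_. undefined) id c)))"
    by (rule definable_relabel [OF definable_ex_on [OF assms]])
  moreover have "?Q (\<lambda>c. e (case_sum (\<lambda>_. undefined) id c)) \<longleftrightarrow> (\<exists>x. P (case_sum x e))" for e
  proof
    assume "?Q (\<lambda>c. e (case_sum (\<lambda>_. undefined) id c))"
    then obtain e' where e': "\<forall>c. c \<notin> range Inl \<longrightarrow> e' c = e (case_sum (\<lambda>_. undefined) id c)" "P e'"
      by blast
    have "e' = case_sum (e' \<circ> Inl) e"
      using e'(1) by (auto simp: fun_eq_iff split: sum.splits)
    then show "\<exists>x. P (case_sum x e)" using e'(2) by metis
  next
    assume "\<exists>x. P (case_sum x e)"
    then obtain x where "P (case_sum x e)" ..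
    then show "?Q (\<lambda>c. e (case_sum (\<lambda>_. undefined) id c))"
      by (intro exI [of _ "case_sum x e"]) (auto split: sum.splits)
  qed
  ultimately show ?thesis by simp
qed

lemma definable_ex_right:
  fixes P :: "('c + 'y \<Rightarrow> 'm) \<Rightarrow> bool"
  assumes "definable L M A P"
  shows "definable L M A (\<lambda>e. \<exists>y. P (case_sum e y))"
proof -
  have "definable L M A (\<lambda>e. P (\<lambda>c. e (case_sum Inr Inl c)))"
    by (rule definable_relabel [OF assms])
  from definable_ex_left [OF this]
  show ?thesis
  proof (rule back_subst [of "definable L M A"])
    have "(\<lambda>c. case_sum y e (case_sum Inr Inl c)) = case_sum e y" for e :: "'c \<Rightarrow> 'm" and y :: "'y \<Rightarrow> 'm"
      by (auto simp: fun_eq_iff split: sum.splits)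
    then show "(\<lambda>e. \<exists>y. P (\<lambda>c. case_sum y e (case_sum Inr Inl c))) = (\<lambda>e. \<exists>y. P (case_sum e y))"
      by simp
  qed
qed

lemma tp_eq_iff:
  fixes e e' :: "'c \<Rightarrow> 'm"
  shows "tp L M e A = tp L M e' A \<longleftrightarrow> (\<forall>P. definable L M A P \<longrightarrow> P e = P e')"
proof
  assume *: "tp L M e A = tp L M e' A"
  show "\<forall>P. definable L M A P \<longrightarrow> P e = P e'"
  proof (intro allI impI)
    fix P :: "('c \<Rightarrow> 'm) \<Rightarrow> bool" assume "definable L M A P"
    then obtain \<theta> where "\<theta> \<in> forms L A" "\<And>e. holds M e \<theta> = P e" by (auto simp: definable_def)
    then show "P e = P e'" using * by (auto simp: tp_def set_eq_iff)
  qed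
next
  assume *: "\<forall>P. definable L M A P \<longrightarrow> P e = P e'"
  have "holds M e \<theta> = holds M e' \<theta>" if "\<theta> \<in> forms L A" for \<theta>
    using * definable_holds [OF that] by blast
  then show "tp L M e A = tp L M e' A"
    unfolding tp_def by auto
qed

lemma definable_automorphism:
  assumes "definable L M A P" "automorphism L M \<sigma>" "\<forall>m\<in>A. \<sigma> m = m"
  shows "P (\<sigma> \<circ> e) = P e"
proof -
  obtain \<phi> where \<phi>: "is_formula L \<phi>"
    "\<And>e. P e \<longleftrightarrow> sat M (case_sum e id) \<phi>"
    "\<And>e g. (\<And>m. m \<in> A \<Longrightarrow> g m = m) \<Longrightarrow> sat M (case_sum e g) \<phi> \<longleftrightarrow> P e"
    using definable_params [OF assms(1)] by metis
  have "case_sum (\<sigma> \<circ> e) \<sigma> = \<sigma> \<circ> case_sum e id"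
    by (auto simp: fun_eq_iff split: sum.splits)
  then have "sat M (case_sum (\<sigma> \<circ> e) \<sigma>) \<phi> = P e"
    using sat_automorphism [OF assms(2) \<phi>(1)] \<phi>(2) by metis
  moreover have "sat M (case_sum (\<sigma> \<circ> e) \<sigma>) \<phi> = P (\<sigma> \<circ> e)"
    using assms(3) by (intro \<phi>(3)) simp
  ultimately show ?thesis by simp
qed

text \<open>Forking and IP are formulated for formulas whose second tuple is indexed by natural numbers.
  As only finitely many slots occur in a formula, this covers arbitrary index types.\<close>

lemma number_slots:
  fixes \<zeta> :: "('f, 'r, 'x + 'c) fm" and M :: "('f, 'r, 'm) fo_struct"
  assumes "is_formula L \<zeta>"
  obtains \<phi> :: "('f, 'r, 'x + nat) fm" and g :: "nat \<Rightarrow> 'c" where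
    "is_formula L \<phi>"
    "\<forall>x y. sat M (case_sum x (y \<circ> g)) \<phi> = sat M (case_sum x y) \<zeta>"
    "\<forall>y :: 'c \<Rightarrow> 'm. inst_right (y \<circ> g) \<phi> = relabel_fm (case_sum Inl (\<lambda>c. Inr (y c))) \<zeta>"
proof -
  define F where "F = {c. Inr c \<in> free_fm \<zeta>}"
  have "finite F"
    unfolding F_def using finite_vimageI [OF finite_free_fm, of Inr] by (simp add: vimage_def)
  then obtain f :: "'c \<Rightarrow> nat" where f: "inj_on f F"
    using finite_imp_inj_to_nat_seg by metis
  define g where "g = inv_into F f"
  have gf: "g (f c) = c" if "Inr c \<in> free_fm \<zeta>" for c
    using that f unfolding g_def F_def by simp
  define \<phi> where "\<phi> = relabel_fm (map_sum id f) \<zeta>"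
  have sum: "case_sum x z \<circ> map_sum id f = case_sum x (z \<circ> f)" for x :: "'x \<Rightarrow> 'm" and z
    by (auto simp: fun_eq_iff split: sum.splits)
  show thesis
  proof (rule that [of \<phi> g])
    show "is_formula L \<phi>" using assms by (simp add: \<phi>_def)
    have "sat M (case_sum x (y \<circ> g)) \<phi> = sat M (case_sum x y) \<zeta>" for x y
      unfolding \<phi>_def sat_relabel sum by (intro sat_cong) (auto simp: gf split: sum.splits)
    then show "\<forall>x y. sat M (case_sum x (y \<circ> g)) \<phi> = sat M (case_sum x y) \<zeta>" by blast
    have "inst_right (y \<circ> g) \<phi> = relabel_fm (case_sum Inl (\<lambda>c. Inr (y c))) \<zeta>" for y :: "'c \<Rightarrow> 'm"
      unfolding inst_right_def \<phi>_def fm.map_comp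
      by (intro fm.map_cong refl) (auto simp: gf split: sum.splits)
    then show "\<forall>y :: 'c \<Rightarrow> 'm. inst_right (y \<circ> g) \<phi> = relabel_fm (case_sum Inl (\<lambda>c. Inr (y c))) \<zeta>"
      by blast
  qed
qed

section \<open>Completing types, saturation and homogeneity\<close>

text \<open>Common generalization of consistency (\<open>D = {}\<close>) and of not forking (\<open>D\<close> the dividing formulas), which
  share the argument for the existence of complete extensions.\<close>

definition avoids ::
  "('f, 'r, 'm) fo_struct \<Rightarrow> ('f, 'r, 'x + 'm) fm set \<Rightarrow> ('f, 'r, 'x + 'm) fm set \<Rightarrow> bool" where
  "avoids M D \<pi> \<longleftrightarrow> (\<forall>\<pi>0 D0. finite \<pi>0 \<and> \<pi>0 \<subseteq> \<pi> \<and> finite D0 \<and> D0 \<subseteq> D \<longrightarrow>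
     (\<exists>a. realizes M a \<pi>0 \<and> (\<forall>\<delta>\<in>D0. \<not> holds M a \<delta>)))"

lemma avoids_consistent: "avoids M D \<pi> \<Longrightarrow> consistent M \<pi>"
  unfolding avoids_def consistent_def by (metis empty_subsetI finite.emptyI)

lemma consistent_avoids: "consistent M \<pi> \<Longrightarrow> avoids M {} \<pi>"
  unfolding avoids_def consistent_def by auto

lemma consistentD: "consistent M \<pi> \<Longrightarrow> finite \<pi>0 \<Longrightarrow> \<pi>0 \<subseteq> \<pi> \<Longrightarrow> \<exists>x. realizes M x \<pi>0"
  by (simp add: consistent_def)

lemma not_forks_iff_avoids:
  fixes \<pi> :: "('f, 'r, 'x + 'm) fm set"
  shows "\<not> forks L M A \<pi> \<longleftrightarrow> avoids M {\<delta>. divides L M A \<delta>} \<pi>"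
proof
  assume nf: "\<not> forks L M A \<pi>"
  show "avoids M {\<delta>. divides L M A \<delta>} \<pi>"
    unfolding avoids_def
  proof (intro allI impI; elim conjE)
    fix \<pi>0 D0 :: "('f, 'r, 'x + 'm) fm set"
    assume *: "finite \<pi>0" "\<pi>0 \<subseteq> \<pi>" "finite D0" "D0 \<subseteq> {\<delta>. divides L M A \<delta>}"
    show "\<exists>a. realizes M a \<pi>0 \<and> (\<forall>\<delta>\<in>D0. \<not> holds M a \<delta>)"
    proof (rule ccontr)
      assume "\<not> ?thesis"
      then have "forks L M A \<pi>"
        unfolding forks_def using * by (intro exI [of _ \<pi>0] exI [of _ D0]) blast
      then show False using nf by blast
    qed
  qed
next
  assume av: "avoids M {\<delta>. divides L M A \<delta>} \<pi>"
  show "\<not> forks L M A \<pi>"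
  proof
    assume "forks L M A \<pi>"
    then obtain \<pi>0 D where *: "finite \<pi>0" "\<pi>0 \<subseteq> \<pi>" "finite D" "D \<subseteq> {\<delta>. divides L M A \<delta>}"
      "\<And>a. realizes M a \<pi>0 \<Longrightarrow> \<exists>\<delta>\<in>D. holds M a \<delta>"
      unfolding forks_def by blast
    then show False using av [unfolded avoids_def, rule_format, of \<pi>0 D] by blast
  qed
qed

lemma not_avoidsE:
  assumes "\<not> avoids M D \<pi>"
  obtains \<pi>0 D0 where "finite \<pi>0" "\<pi>0 \<subseteq> \<pi>" "finite D0" "D0 \<subseteq> D"
    "\<forall>a. realizes M a \<pi>0 \<longrightarrow> (\<exists>\<delta>\<in>D0. holds M a \<delta>)"
proof -
  from assms obtain \<pi>0 D0 where "finite \<pi>0 \<and> \<pi>0 \<subseteq> \<pi> \<and> finite D0 \<and> D0 \<subseteq> D"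
    and *: "\<not> (\<exists>a. realizes M a \<pi>0 \<and> (\<forall>\<delta>\<in>D0. \<not> holds M a \<delta>))"
    unfolding avoids_def not_all not_imp by (elim exE conjE) (rule that; simp)
  moreover have "\<exists>\<delta>\<in>D0. holds M a \<delta>" if "realizes M a \<pi>0" for a
    using * that by blast
  ultimately show thesis using that by blast
qed

text \<open>If neither \<open>\<theta>\<close> nor its negation could be added to a maximal set, then two finite disjunctions of
  members of \<open>D\<close> would together cover a finite part of the set.\<close>

lemma complete_extension:
  assumes "\<pi> \<subseteq> forms L C" "avoids M D \<pi>"
  obtains q where "\<pi> \<subseteq> q" "q \<subseteq> forms L C" "avoids M D q"
    "\<forall>\<theta>\<in>forms L C. \<theta> \<in> q \<or> Neg \<theta> \<in> q"
proof -
  define Z where "Z = {q. \<pi> \<subseteq> q \<and> q \<subseteq> forms L C \<and> avoids M D q}"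
  have "\<exists>q\<in>Z. \<forall>r\<in>Z. q \<subseteq> r \<longrightarrow> r = q"
  proof (rule subset_Zorn_nonempty)
    show "Z \<noteq> {}" using assms by (auto simp: Z_def)
    fix \<C> assume \<C>: "\<C> \<noteq> {}" "subset.chain Z \<C>"
    have "avoids M D (\<Union>\<C>)"
      unfolding avoids_def
    proof (intro allI impI)
      fix \<pi>0 D0 assume *: "finite \<pi>0 \<and> \<pi>0 \<subseteq> \<Union>\<C> \<and> finite D0 \<and> D0 \<subseteq> D"
      then obtain r where "r \<in> \<C>" "\<pi>0 \<subseteq> r"
        using finite_subset_Union_chain \<C> by metis
      moreover have "avoids M D r" using \<C>(2) \<open>r \<in> \<C>\<close> by (auto simp: Z_def subset.chain_def)
      ultimately show "\<exists>a. realizes M a \<pi>0 \<and> (\<forall>\<delta>\<in>D0. \<not> holds M a \<delta>)"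
        using * unfolding avoids_def by blast
    qed
    then show "\<Union>\<C> \<in> Z" using \<C> unfolding Z_def subset.chain_def by blast
  qed
  then obtain q where q: "q \<in> Z" "\<And>r. r \<in> Z \<Longrightarrow> q \<subseteq> r \<Longrightarrow> r = q" by blast
  have bad: "\<exists>\<pi>0 D0. finite \<pi>0 \<and> \<pi>0 \<subseteq> q \<and> finite D0 \<and> D0 \<subseteq> D \<and>
      (\<forall>a. realizes M a \<pi>0 \<and> holds M a \<theta> \<longrightarrow> (\<exists>\<delta>\<in>D0. holds M a \<delta>))"
    if \<theta>: "\<theta> \<in> forms L C" "\<theta> \<notin> q" for \<theta>
  proof -
    have "insert \<theta> q \<notin> Z" using q(2) [of "insert \<theta> q"] \<theta>(2) by blast
    then have "\<not> avoids M D (insert \<theta> q)" using q(1) \<theta>(1) unfolding Z_def by blast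
    then obtain \<pi>0 D0 where *: "finite \<pi>0" "\<pi>0 \<subseteq> insert \<theta> q" "finite D0" "D0 \<subseteq> D"
      "\<forall>a. realizes M a \<pi>0 \<longrightarrow> (\<exists>\<delta>\<in>D0. holds M a \<delta>)"
      by (rule not_avoidsE)
    show ?thesis
      by (rule exI [of _ "\<pi>0 - {\<theta>}"], rule exI [of _ D0])
        (use * in \<open>auto simp: realizes_def\<close>)
  qed
  have "\<theta> \<in> q \<or> Neg \<theta> \<in> q" if \<theta>: "\<theta> \<in> forms L C" for \<theta>
  proof (rule ccontr)
    assume "\<not> (\<theta> \<in> q \<or> Neg \<theta> \<in> q)"
    then obtain \<pi>1 D1 \<pi>2 D2 where 1: "finite \<pi>1" "\<pi>1 \<subseteq> q" "finite D1" "D1 \<subseteq> D"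
      "\<And>a. realizes M a \<pi>1 \<Longrightarrow> holds M a \<theta> \<Longrightarrow> \<exists>\<delta>\<in>D1. holds M a \<delta>"
      and 2: "finite \<pi>2" "\<pi>2 \<subseteq> q" "finite D2" "D2 \<subseteq> D"
      "\<And>a. realizes M a \<pi>2 \<Longrightarrow> \<not> holds M a \<theta> \<Longrightarrow> \<exists>\<delta>\<in>D2. holds M a \<delta>"
      using bad [OF \<theta>] bad [OF Neg_forms [OF \<theta>]] unfolding holds_Neg by metis
    have "avoids M D q" using q(1) by (simp add: Z_def)
    then obtain a where "realizes M a (\<pi>1 \<union> \<pi>2)" "\<forall>\<delta>\<in>D1 \<union> D2. \<not> holds M a \<delta>"
      unfolding avoids_def using 1(1-4) 2(1-4)
      by (metis Un_least finite_UnI)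
    then show False using 1(5) [of a] 2(5) [of a] unfolding realizes_def by blast
  qed
  then show thesis using that q(1) by (auto simp: Z_def)
qed

lemma realize_one:
  assumes sat: "saturated L \<kappa> M" and C: "|C| <o \<kappa>"
    and def: "\<And>P. P \<in> \<Gamma> \<Longrightarrow> definable L M C (\<lambda>e :: unit \<Rightarrow> 'm. P (e ()))"
    and fin: "\<And>\<Gamma>0. finite \<Gamma>0 \<Longrightarrow> \<Gamma>0 \<subseteq> \<Gamma> \<Longrightarrow> \<exists>m. \<forall>P\<in>\<Gamma>0. P m"
  shows "\<exists>m :: 'm. \<forall>P\<in>\<Gamma>. P m"
proof -
  define \<pi> :: "('a, 'b, unit + 'm) fm set" where
    "\<pi> = {\<theta> \<in> forms L C. \<exists>P\<in>\<Gamma>. \<forall>e. holds M e \<theta> \<longleftrightarrow> P (e ())}"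
  have "consistent M \<pi>"
    unfolding consistent_def
  proof (intro allI impI; elim conjE)
    fix \<pi>0 assume \<pi>0: "finite \<pi>0" "\<pi>0 \<subseteq> \<pi>"
    have "\<forall>\<theta>\<in>\<pi>0. \<exists>P\<in>\<Gamma>. \<forall>e. holds M e \<theta> \<longleftrightarrow> P (e ())" using \<pi>0(2) by (auto simp: \<pi>_def)
    then obtain p where p: "\<And>\<theta>. \<theta> \<in> \<pi>0 \<Longrightarrow> p \<theta> \<in> \<Gamma> \<and> (\<forall>e. holds M e \<theta> \<longleftrightarrow> p \<theta> (e ()))"
      by metis
    then obtain m where "\<forall>P\<in>p ` \<pi>0. P m"
      using fin [of "p ` \<pi>0"] \<pi>0(1) by blast
    then have "realizes M (\<lambda>_. m) \<pi>0" using p by (auto simp: realizes_def)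
    then show "\<exists>a. realizes M a \<pi>0" by blast
  qed
  then obtain q where q: "\<pi> \<subseteq> q" "q \<subseteq> forms L C" "avoids M {} q"
    "\<forall>\<theta>\<in>forms L C. \<theta> \<in> q \<or> Neg \<theta> \<in> q"
    using complete_extension [of \<pi> L C M "{}"] consistent_avoids unfolding \<pi>_def by blast
  then have "q \<in> types L M C" using avoids_consistent by (auto simp: types_def)
  then obtain a :: "unit \<Rightarrow> 'm" where a: "realizes M a q"
    using sat C unfolding saturated_def by blast
  have "P (a ())" if "P \<in> \<Gamma>" for P
  proof -
    obtain \<theta> where "\<theta> \<in> forms L C" "\<And>e. holds M e \<theta> \<longleftrightarrow> P (e ())"
      using def [OF \<open>P \<in> \<Gamma>\<close>] unfolding definable_def by blast
    then show ?thesis using a q(1) \<open>P \<in> \<Gamma>\<close> unfolding realizes_def \<pi>_def by blast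
  qed
  then show ?thesis by blast
qed

lemma small_Un:
  assumes "Card_order \<kappa>" "natLeq <o \<kappa>" "|A| <o \<kappa>" "|B| <o \<kappa>"
  shows "|A \<union> B| <o \<kappa>"
proof -
  have "\<not> finite (Field \<kappa>)"
    using cinfinite_mono [OF ordLess_imp_ordLeq [OF assms(2)] natLeq_cinfinite]
    by (simp add: cinfinite_def)
  then show ?thesis using assms card_of_Un_ordLess_infinite_Field by blast
qed

lemma small_Times:
  assumes "Card_order \<kappa>" "natLeq <o \<kappa>" "|A| <o \<kappa>" "|B| <o \<kappa>"
  shows "|A \<times> B| <o \<kappa>"
proof (cases "finite A \<and> finite B")
  case True
  then have "|A \<times> B| <o natLeq" using finite_iff_ordLess_natLeq by blast
  then show ?thesis using assms(2) ordLess_transitive by blast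
next
  case False
  have *: "|X \<times> Y| <o \<kappa>" "|Y \<times> X| <o \<kappa>"
    if "infinite X" "|Y| \<le>o |X|" "|X| <o \<kappa>" for X :: "'u set" and Y :: "'w set"
  proof -
    have "|X \<times> Y| \<le>o |X|"
      by (rule card_of_Times_ordLeq_infinite_Field)
        (use that in \<open>simp_all add: Field_card_of card_of_card_order_on ordLeq_refl [OF card_of_Card_order]\<close>)
    then show "|X \<times> Y| <o \<kappa>" using that(3) ordLeq_ordLess_trans by blast
    then show "|Y \<times> X| <o \<kappa>"
      using card_of_Times_commute ordIso_ordLess_trans by blast
  qed
  show ?thesis
  proof (cases "|A| \<le>o |B|")
    case True
    then have "infinite B" using False card_of_ordLeq_infinite by blast
    then show ?thesis using *(2) True assms(4) by blast
  next
    case le: False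
    then have "|B| \<le>o |A|" using ordLeq_total [OF card_of_Well_order card_of_Well_order, of A B] by simp
    moreover from this have "infinite A" using False card_of_ordLeq_infinite by blast
    ultimately show ?thesis using *(1) assms(3) by blast
  qed
qed

text \<open>Saturation speaks about one variable only. A maximal finitely satisfiable partial assignment is
  total, since one more variable can be treated as a type over the values used so far; these are
  few because there are few variables.\<close>

lemma realize:
  fixes \<Gamma> :: "(('c \<Rightarrow> 'm) \<Rightarrow> bool) set"
  assumes \<kappa>: "Card_order \<kappa>" "natLeq <o \<kappa>" and sat: "saturated L \<kappa> M"
    and C: "|C| <o \<kappa>" and small: "|UNIV :: 'c set| <o \<kappa>"
    and def: "\<And>P. P \<in> \<Gamma> \<Longrightarrow> definable L M C P"
    and fin: "\<And>\<Gamma>0. finite \<Gamma>0 \<Longrightarrow> \<Gamma>0 \<subseteq> \<Gamma> \<Longrightarrow> \<exists>e. \<forall>P\<in>\<Gamma>0. P e"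
  shows "\<exists>e. \<forall>P\<in>\<Gamma>. P e"
proof -
  define ok where "ok G0 \<Gamma>0 e \<longleftrightarrow> (\<forall>g\<in>G0. e (fst g) = snd g) \<and> (\<forall>P\<in>\<Gamma>0. P e)"
    for G0 :: "('c \<times> 'm) set" and \<Gamma>0 e
  define Z where "Z = {G. \<forall>G0 \<Gamma>0. finite G0 \<and> G0 \<subseteq> G \<and> finite \<Gamma>0 \<and> \<Gamma>0 \<subseteq> \<Gamma> \<longrightarrow> (\<exists>e. ok G0 \<Gamma>0 e)}"
  have "\<exists>G\<in>Z. \<forall>H\<in>Z. G \<subseteq> H \<longrightarrow> H = G"
  proof (rule subset_Zorn_nonempty)
    have "{} \<in> Z" using fin by (auto simp: Z_def ok_def)
    then show "Z \<noteq> {}" by blast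
    fix \<C> assume \<C>: "\<C> \<noteq> {}" "subset.chain Z \<C>"
    show "\<Union>\<C> \<in> Z"
      unfolding Z_def mem_Collect_eq
    proof (intro allI impI)
      fix G0 \<Gamma>0 assume *: "finite G0 \<and> G0 \<subseteq> \<Union>\<C> \<and> finite \<Gamma>0 \<and> \<Gamma>0 \<subseteq> \<Gamma>"
      then obtain G where "G \<in> \<C>" "G0 \<subseteq> G"
        using finite_subset_Union_chain \<C> by metis
      moreover have "G \<in> Z" using \<C>(2) \<open>G \<in> \<C>\<close> by (auto simp: subset.chain_def)
      ultimately show "\<exists>e. ok G0 \<Gamma>0 e"
        using * unfolding Z_def by blast
    qed
  qed
  then obtain G where G: "G \<in> Z" "\<And>H. H \<in> Z \<Longrightarrow> G \<subseteq> H \<Longrightarrow> H = G" by blast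
  have okG: "\<exists>e. ok G0 \<Gamma>0 e" if "finite G0" "G0 \<subseteq> G" "finite \<Gamma>0" "\<Gamma>0 \<subseteq> \<Gamma>" for G0 \<Gamma>0
    using G(1) that unfolding Z_def by blast
  have functional: "m = m'" if "(c, m) \<in> G" "(c, m') \<in> G" for c m m'
    using okG [of "{(c, m), (c, m')}" "{}"] that by (auto simp: ok_def)
  have "inj_on fst G" using functional by (auto simp: inj_on_def)
  then have "|G| \<le>o |UNIV :: 'c set|" using card_of_ordLeq [of G "UNIV :: 'c set"] by blast
  then have "|snd ` G| <o \<kappa>"
    using small card_of_image [of snd G] ordLeq_transitive ordLeq_ordLess_trans by blast
  then have CG: "|C \<union> snd ` G| <o \<kappa>" using small_Un \<kappa> C by blast
  have total: "c \<in> fst ` G" for c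
  proof (rule ccontr)
    assume c: "c \<notin> fst ` G"
    let ?\<Omega> = "{\<lambda>m. \<exists>e. e c = m \<and> ok G0 \<Gamma>0 e | G0 \<Gamma>0. finite G0 \<and> G0 \<subseteq> G \<and> finite \<Gamma>0 \<and> \<Gamma>0 \<subseteq> \<Gamma>}"
    let ?I = "{(G0, \<Gamma>0). finite G0 \<and> G0 \<subseteq> G \<and> finite \<Gamma>0 \<and> \<Gamma>0 \<subseteq> \<Gamma>}"
    have "\<exists>m. \<forall>P\<in>?\<Omega>. P m"
    proof (rule realize_one [OF sat CG])
      fix P assume "P \<in> ?\<Omega>"
      then obtain G0 \<Gamma>0 where P: "P = (\<lambda>m. \<exists>e. e c = m \<and> ok G0 \<Gamma>0 e)"
        and 0: "finite G0" "G0 \<subseteq> G" "finite \<Gamma>0" "\<Gamma>0 \<subseteq> \<Gamma>" by blast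
      let ?R = "\<lambda>e. e (Inr c) = e (Inl ()) \<and> (\<forall>g\<in>G0. e (Inr (fst g)) = snd g) \<and>
        (\<forall>P\<in>\<Gamma>0. P (\<lambda>c. e (Inr c)))"
      have "definable L M (C \<union> snd ` G) ?R"
      proof (intro definable_conj definable_eq definable_ball 0(1,3))
        show "definable L M (C \<union> snd ` G) (\<lambda>e. e (Inr (fst g)) = snd g)" if "g \<in> G0" for g
          using that 0(2) by (intro definable_eq_param) auto
        show "definable L M (C \<union> snd ` G) (\<lambda>e. Q (\<lambda>c. e (Inr c)))" if "Q \<in> \<Gamma>0" for Q
          by (rule definable_relabel [OF definable_mono [OF def]]) (use that 0(4) in auto)
      qed
      from definable_ex_right [OF this]
      show "definable L M (C \<union> snd ` G) (\<lambda>e :: unit \<Rightarrow> 'm. P (e ()))"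
        unfolding P ok_def by simp
    next
      fix \<Omega>0 assume "finite \<Omega>0" "\<Omega>0 \<subseteq> ?\<Omega>"
      moreover have "?\<Omega> = (\<lambda>(G0, \<Gamma>0) m. \<exists>e. e c = m \<and> ok G0 \<Gamma>0 e) ` ?I"
        by (auto simp: image_def)
      ultimately obtain J where J: "finite J" "J \<subseteq> ?I" "\<Omega>0 = (\<lambda>(G0, \<Gamma>0) m. \<exists>e. e c = m \<and> ok G0 \<Gamma>0 e) ` J"
        using finite_subset_image by (metis (no_types, lifting))
      have J': "finite (fst j)" "fst j \<subseteq> G" "finite (snd j)" "snd j \<subseteq> \<Gamma>" if "j \<in> J" for j
        using subsetD [OF J(2) that] by (simp_all add: case_prod_beta)
      have "finite (\<Union> (fst ` J))" "finite (\<Union> (snd ` J))"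
        using J(1) J'(1,3) by (auto intro: finite_Union)
      moreover have "\<Union> (fst ` J) \<subseteq> G" "\<Union> (snd ` J) \<subseteq> \<Gamma>"
        using J'(2,4) by (simp_all add: UN_least)
      ultimately obtain e where e: "ok (\<Union> (fst ` J)) (\<Union> (snd ` J)) e" using okG by metis
      have "P (e c)" if "P \<in> \<Omega>0" for P
      proof -
        obtain j where j: "j \<in> J" "P = (\<lambda>(G0, \<Gamma>0) m. \<exists>e. e c = m \<and> ok G0 \<Gamma>0 e) j"
          using \<open>P \<in> \<Omega>0\<close> unfolding J(3) by (rule imageE)
        have "ok (fst j) (snd j) e" using e j(1) unfolding ok_def by blast
        then show ?thesis unfolding j(2) case_prod_beta by blast
      qed
      then show "\<exists>m. \<forall>P\<in>\<Omega>0. P m" by blast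
    qed
    then obtain m where m0: "\<forall>P\<in>?\<Omega>. P m" by (rule exE)
    have m: "\<exists>e. e c = m \<and> ok G0 \<Gamma>0 e"
      if "finite G0" "G0 \<subseteq> G" "finite \<Gamma>0" "\<Gamma>0 \<subseteq> \<Gamma>" for G0 \<Gamma>0
      by (rule bspec [OF m0]) (use that in auto)
    have "insert (c, m) G \<in> Z"
      unfolding Z_def mem_Collect_eq
    proof (intro allI impI)
      fix G0 \<Gamma>0 assume *: "finite G0 \<and> G0 \<subseteq> insert (c, m) G \<and> finite \<Gamma>0 \<and> \<Gamma>0 \<subseteq> \<Gamma>"
      then obtain e where "e c = m" "ok (G0 - {(c, m)}) \<Gamma>0 e" using m [of "G0 - {(c, m)}" \<Gamma>0] by blast
      then show "\<exists>e. ok G0 \<Gamma>0 e" by (intro exI [of _ e]) (auto simp: ok_def)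
    qed
    then have "(c, m) \<in> G" using G(2) by blast
    then show False using c by force
  qed
  define e where "e c = (THE m. (c, m) \<in> G)" for c
  have e: "(c, e c) \<in> G" for c
  proof -
    obtain m where "(c, m) \<in> G" using total [of c] by auto
    then show ?thesis unfolding e_def using functional by (metis theI)
  qed
  have "P e" if P: "P \<in> \<Gamma>" for P
  proof -
    obtain F where F: "finite F" "\<And>e e'. (\<And>c. c \<in> F \<Longrightarrow> e c = e' c) \<Longrightarrow> P e = P e'"
      using definable_finite_support [OF def [OF P]] by metis
    obtain e' where "ok ((\<lambda>c. (c, e c)) ` F) {P} e'"
      using okG [of "(\<lambda>c. (c, e c)) ` F" "{P}"] F(1) e P by blast
    then show ?thesis using F(2) [of e' e] by (auto simp: ok_def)
  qed
  then show ?thesis by blast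
qed

text \<open>Strong homogeneity for tuples: equality of types makes \<open>e v \<mapsto> e' v\<close> a well-defined elementary map.\<close>

lemma automorphism_extending:
  fixes e e' :: "'v \<Rightarrow> 'm"
  assumes hom: "strongly_homogeneous L \<kappa> M" and small: "|V| <o \<kappa>"
    and eq: "\<And>\<phi> :: ('f, 'r, 'v) fm. is_formula L \<phi> \<Longrightarrow> free_fm \<phi> \<subseteq> V \<Longrightarrow> sat M e \<phi> = sat M e' \<phi>"
  obtains \<sigma> where "automorphism L M \<sigma>" "\<And>v. v \<in> V \<Longrightarrow> \<sigma> (e v) = e' v"
proof -
  define g where "g = inv_into V e"
  have g: "g m \<in> V" "e (g m) = m" if "m \<in> e ` V" for m
    using that by (simp_all add: g_def inv_into_into f_inv_into_f)
  have "elementary_map L M (e ` V) (e' \<circ> g)"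
    unfolding elementary_map_def
  proof (intro allI impI; elim conjE)
    fix \<phi> :: "('f, 'r, 'm) fm" assume \<phi>: "is_formula L \<phi>" "free_fm \<phi> \<subseteq> e ` V"
    have "sat M (e' \<circ> g) \<phi> = sat M e' (relabel_fm g \<phi>)" by (simp only: sat_relabel)
    also have "\<dots> = sat M e (relabel_fm g \<phi>)"
      using \<phi> g(1) by (intro eq [symmetric]) (auto simp: fm.set_map)
    also have "\<dots> = sat M (e \<circ> g) \<phi>" by (simp only: sat_relabel)
    also have "\<dots> = sat M id \<phi>"
      using \<phi>(2) g(2) by (intro sat_cong) auto
    finally show "sat M (e' \<circ> g) \<phi> = sat M id \<phi>" .
  qed
  moreover have "|e ` V| <o \<kappa>" using small card_of_image ordLeq_ordLess_trans by blast
  ultimately obtain \<sigma> where \<sigma>: "automorphism L M \<sigma>" "\<And>m. m \<in> e ` V \<Longrightarrow> \<sigma> m = e' (g m)"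
    using hom unfolding strongly_homogeneous_def comp_def by meson
  have "e' (g (e v)) = e' v" if "v \<in> V" for v
  proof -
    let ?\<phi> = "Equal (Free (g (e v))) (Free v) :: ('f, 'r, 'v) fm"
    have "sat M e ?\<phi> = sat M e' ?\<phi>"
      using that g(1) by (intro eq) (auto simp: is_formula_def)
    then show ?thesis using g(2) that by (simp add: sat_def)
  qed
  then show thesis using that [OF \<sigma>(1)] \<sigma>(2) by simp
qed

lemma automorphism_over:
  fixes e e' :: "'c \<Rightarrow> 'm"
  assumes \<kappa>: "Card_order \<kappa>" "natLeq <o \<kappa>" and hom: "strongly_homogeneous L \<kappa> M"
    and A: "|A| <o \<kappa>" and small: "|UNIV :: 'c set| <o \<kappa>"
    and eq: "\<And>P. definable L M A P \<Longrightarrow> P e = P e'"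
  obtains \<sigma> where "automorphism L M \<sigma>" "\<forall>m\<in>A. \<sigma> m = m" "\<sigma> \<circ> e = e'"
proof -
  let ?V = "range Inl \<union> Inr ` A :: ('c + 'm) set"
  have "|range Inl :: ('c + 'm) set| <o \<kappa>" "|Inr ` A :: ('c + 'm) set| <o \<kappa>"
    using small A card_of_image ordLeq_ordLess_trans by blast+
  then have V: "|?V| <o \<kappa>" using small_Un \<kappa> by blast
  have "sat M (case_sum e id) \<phi> = sat M (case_sum e' id) \<phi>"
    if "is_formula L \<phi>" "free_fm \<phi> \<subseteq> ?V" for \<phi>
  proof -
    have "\<phi> \<in> forms L A" using that by (auto simp: forms_def params_def)
    then show ?thesis using eq [OF definable_holds] by (simp add: holds_def)
  qed
  from automorphism_extending [OF hom V this] obtain \<sigma> where \<sigma>: "automorphism L M \<sigma>"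
    "\<And>v. v \<in> ?V \<Longrightarrow> \<sigma> (case_sum e id v) = case_sum e' id v" by metis
  have "\<sigma> (e c) = e' c" for c using \<sigma>(2) [of "Inl c"] by simp
  moreover have "\<sigma> m = m" if "m \<in> A" for m using \<sigma>(2) [of "Inr m"] that by simp
  ultimately show thesis using that [OF \<sigma>(1)] by (simp add: fun_eq_iff)
qed

section \<open>Shattering and NIP types\<close>

definition shattered :: "(('x \<Rightarrow> 'm) \<Rightarrow> ('y \<Rightarrow> 'm) \<Rightarrow> bool) \<Rightarrow> nat \<Rightarrow> (nat \<Rightarrow> 'x \<Rightarrow> 'm) \<Rightarrow> bool" where
  "shattered R n a \<longleftrightarrow> (\<forall>s. \<exists>y. \<forall>i<n. R (a i) y \<longleftrightarrow> i \<in> s)"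

lemma shattered_mono: "shattered R n a \<Longrightarrow> m \<le> n \<Longrightarrow> shattered R m a"
  unfolding shattered_def by (meson less_le_trans)

lemma definable_shattered:
  fixes P :: "('x + 'y \<Rightarrow> 'm) \<Rightarrow> bool" and h :: "nat \<Rightarrow> 'x \<Rightarrow> 'c"
  assumes "definable L M A P"
  shows "definable L M A (\<lambda>e. shattered (\<lambda>x y. P (case_sum x y)) n (\<lambda>i v. e (h i v)))"
proof -
  have "definable L M A (\<lambda>e. \<forall>s\<in>Pow {..<n}. \<exists>y. \<forall>i<n. P (case_sum (\<lambda>v. e (h i v)) y) \<longleftrightarrow> i \<in> s)"
  proof (rule definable_ball)
    fix s :: "nat set"
    have "definable L M A (\<lambda>e. \<forall>i<n. P (\<lambda>c. e (case_sum (\<lambda>v. Inl (h i v)) Inr c)) \<longleftrightarrow> i \<in> s)"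
      by (intro definable_all_less definable_iff_const) (rule definable_relabel [OF assms])
    from definable_ex_right [OF this]
    show "definable L M A (\<lambda>e. \<exists>y. \<forall>i<n. P (case_sum (\<lambda>v. e (h i v)) y) \<longleftrightarrow> i \<in> s)"
    proof (rule back_subst [of "definable L M A"])
      have "(\<lambda>c. case_sum e y (case_sum (\<lambda>v. Inl (h i v)) Inr c)) = case_sum (\<lambda>v. e (h i v)) y"
        for e and y :: "'y \<Rightarrow> 'm" and i
        by (auto simp: fun_eq_iff split: sum.splits)
      then show "(\<lambda>e. \<exists>y. \<forall>i<n. P (\<lambda>c. case_sum e y (case_sum (\<lambda>v. Inl (h i v)) Inr c)) \<longleftrightarrow> i \<in> s)
          = (\<lambda>e. \<exists>y. \<forall>i<n. P (case_sum (\<lambda>v. e (h i v)) y) \<longleftrightarrow> i \<in> s)" by simp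
    qed
  qed simp
  moreover have "shattered (\<lambda>x y. P (case_sum x y)) n a \<longleftrightarrow>
      (\<forall>s\<in>Pow {..<n}. \<exists>y. \<forall>i<n. P (case_sum (a i) y) \<longleftrightarrow> i \<in> s)" for a
  proof
    assume *: "\<forall>s\<in>Pow {..<n}. \<exists>y. \<forall>i<n. P (case_sum (a i) y) \<longleftrightarrow> i \<in> s"
    show "shattered (\<lambda>x y. P (case_sum x y)) n a"
      unfolding shattered_def
    proof
      fix s
      show "\<exists>y. \<forall>i<n. P (case_sum (a i) y) \<longleftrightarrow> i \<in> s"
        using bspec [OF *, of "s \<inter> {..<n}"] by auto
    qed
  qed (auto simp: shattered_def)
  ultimately show ?thesis by simp
qed

lemma holds_inst_left: "holds M z (inst_left x \<phi>) \<longleftrightarrow> sat M (case_sum x z) \<phi>"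
proof -
  have "case_sum z id \<circ> case_sum (\<lambda>v. Inr (x v)) Inl = case_sum x z"
    by (auto simp: fun_eq_iff split: sum.splits)
  then show ?thesis by (simp only: holds_def inst_left_def sat_relabel)
qed

lemma holds_signed: "holds M x (signed t \<phi>) \<longleftrightarrow> (holds M x \<phi> \<longleftrightarrow> t)"
  by (cases t) (auto simp: signed_def)

text \<open>The infinitary condition in the definition of IP is finitary, because consistency is.\<close>

lemma independent_iff_shattered:
  "(\<forall>s :: nat set. consistent M {signed (i \<in> s) (inst_left (a i) \<phi>) | i. True})
    \<longleftrightarrow> (\<forall>n. shattered (\<lambda>x y. sat M (case_sum x y) \<phi>) n a)"
proof (intro iffI allI)
  fix n
  assume *: "\<forall>s :: nat set. consistent M {signed (i \<in> s) (inst_left (a i) \<phi>) | i. True}"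
  show "shattered (\<lambda>x y. sat M (case_sum x y) \<phi>) n a"
    unfolding shattered_def
  proof
    fix s :: "nat set"
    have "(\<lambda>i. signed (i \<in> s) (inst_left (a i) \<phi>)) ` {..<n}
        \<subseteq> {signed (i \<in> s) (inst_left (a i) \<phi>) | i. True}" by auto
    from consistentD [OF spec [OF *] finite_imageI [OF finite_lessThan] this]
    obtain y where "realizes M y ((\<lambda>i. signed (i \<in> s) (inst_left (a i) \<phi>)) ` {..<n})" ..
    then show "\<exists>y. \<forall>i<n. sat M (case_sum (a i) y) \<phi> \<longleftrightarrow> i \<in> s"
      by (auto simp: realizes_def holds_signed holds_inst_left)
  qed
next
  fix s :: "nat set"
  assume *: "\<forall>n. shattered (\<lambda>x y. sat M (case_sum x y) \<phi>) n a"
  show "consistent M {signed (i \<in> s) (inst_left (a i) \<phi>) | i. True}"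
    unfolding consistent_def
  proof (intro allI impI; elim conjE)
    let ?f = "\<lambda>i. signed (i \<in> s) (inst_left (a i) \<phi>)"
    fix \<pi>0 assume "finite \<pi>0" "\<pi>0 \<subseteq> {signed (i \<in> s) (inst_left (a i) \<phi>) | i. True}"
    then have "finite \<pi>0" "\<pi>0 \<subseteq> range ?f" by auto
    from finite_subset_image [OF this] obtain I where "I \<subseteq> UNIV \<and> finite I \<and> \<pi>0 = ?f ` I" ..
    then have I: "finite I" "\<pi>0 = ?f ` I" by simp_all
    from I(1) obtain n where n: "\<forall>i\<in>I. i < n" unfolding finite_nat_set_iff_bounded ..
    from spec [OF spec [OF *, of n, unfolded shattered_def], of s]
    obtain y where "\<forall>i<n. sat M (case_sum (a i) y) \<phi> \<longleftrightarrow> i \<in> s" ..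
    then have "realizes M y \<pi>0"
      using n by (auto simp: I(2) realizes_def holds_signed holds_inst_left)
    then show "\<exists>y. realizes M y \<pi>0" by blast
  qed
qed

lemma types_consistent: "p \<in> types L M B \<Longrightarrow> finite \<pi>0 \<Longrightarrow> \<pi>0 \<subseteq> p \<Longrightarrow> \<exists>x. realizes M x \<pi>0"
  by (auto simp: types_def consistent_def)

lemma types_closed:
  assumes p: "p \<in> types L M B" and "finite \<pi>0" "\<pi>0 \<subseteq> p" "\<theta> \<in> forms L B"
    and "\<And>x. realizes M x \<pi>0 \<Longrightarrow> holds M x \<theta>"
  shows "\<theta> \<in> p"
proof (rule ccontr)
  assume "\<theta> \<notin> p"
  then have "Neg \<theta> \<in> p" using assms by (auto simp: types_def)
  then obtain x where "realizes M x (insert (Neg \<theta>) \<pi>0)"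
    using types_consistent [OF p, of "insert (Neg \<theta>) \<pi>0"] assms by auto
  then show False using assms(5) by (auto simp: realizes_def)
qed

lemma types_finite_conj:
  assumes p: "p \<in> types L M B" and "finite \<pi>0" "\<pi>0 \<subseteq> p"
  obtains \<theta> where "\<theta> \<in> p" "\<And>x. holds M x \<theta> \<longleftrightarrow> realizes M x \<pi>0"
proof -
  have "definable L M B (\<lambda>x. \<forall>\<theta>\<in>\<pi>0. holds M x \<theta>)"
    using assms by (intro definable_ball definable_holds) (auto simp: types_def)
  then obtain \<theta> where \<theta>: "\<theta> \<in> forms L B" "\<And>x. holds M x \<theta> \<longleftrightarrow> realizes M x \<pi>0"
    by (auto simp: definable_def realizes_def)
  moreover have "\<theta> \<in> p" using types_closed [OF p assms(2,3) \<theta>(1)] \<theta>(2) by simp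
  ultimately show thesis using that by blast
qed

text \<open>Otherwise every formula of \<open>p\<close> contains arbitrarily large finite shattered families, and
  compactness yields an infinite family of realizations of \<open>p\<close> all of whose finite parts are shattered.
  The parameters of \<open>P\<close> do no harm, as they may be counted among the variables \<open>y\<close>.\<close>

lemma NIP_bound:
  fixes P :: "('x + 'y \<Rightarrow> 'm) \<Rightarrow> bool"
  assumes \<kappa>: "Card_order \<kappa>" "natLeq <o \<kappa>" and sat: "saturated L \<kappa> M"
    and B: "|B| <o \<kappa>" and small: "|UNIV :: 'x set| <o \<kappa>"
    and p: "p \<in> types L M B" "NIP L M p" and P: "definable L M UNIV P"
  obtains \<theta> n where "\<theta> \<in> p"
    "\<And>a. (\<And>i. i < n \<Longrightarrow> holds M (a i) \<theta>) \<Longrightarrow> \<not> shattered (\<lambda>x y. P (case_sum x y)) n a"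
proof (rule ccontr)
  note conclude = that
  assume contr: "\<not> thesis"
  obtain \<phi>0 where \<phi>0: "is_formula L \<phi>0" "\<And>e. P e \<longleftrightarrow> sat M (case_sum e id) \<phi>0"
    using definable_params [OF P] by metis
  let ?assoc = "case_sum (case_sum Inl (\<lambda>y. Inr (Inl y))) (\<lambda>m. Inr (Inr m))"
  have "is_formula L (relabel_fm ?assoc \<phi>0)" using \<phi>0 by simp
  then obtain \<phi> and g :: "nat \<Rightarrow> 'y + 'm" where \<phi>: "is_formula L \<phi>"
    and \<phi>2: "\<forall>x y. sat M (case_sum x (y \<circ> g)) \<phi> = sat M (case_sum x y) (relabel_fm ?assoc \<phi>0)"
    by (rule number_slots)
  let ?R = "\<lambda>x y. sat M (case_sum x y) \<phi>"
  have R: "P (case_sum x y) = ?R x (case_sum y id \<circ> g)" for x y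
  proof -
    have "case_sum x (case_sum y id) \<circ> ?assoc = case_sum (case_sum x y) id"
      by (auto simp: fun_eq_iff split: sum.splits)
    then show ?thesis unfolding \<phi>2 [rule_format] sat_relabel \<phi>0(2) by simp
  qed
  have contr': "\<exists>a. (\<forall>i<n. holds M (a i) \<theta>) \<and> shattered ?R n a" if "\<theta> \<in> p" for \<theta> n
  proof (rule ccontr)
    assume none: "\<nexists>a. (\<forall>i<n. holds M (a i) \<theta>) \<and> shattered ?R n a"
    have thesis
    proof (rule conclude [OF \<open>\<theta> \<in> p\<close>, of n])
      fix a assume a: "\<And>i. i < n \<Longrightarrow> holds M (a i) \<theta>"
      have "shattered ?R n a" if sh: "shattered (\<lambda>x y. P (case_sum x y)) n a"
        unfolding shattered_def
      proof
        fix s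
        from spec [OF sh [unfolded shattered_def], of s]
        obtain y where "\<forall>i<n. P (case_sum (a i) y) \<longleftrightarrow> i \<in> s" ..
        then show "\<exists>y. \<forall>i<n. ?R (a i) y \<longleftrightarrow> i \<in> s"
          unfolding R by (rule exI [of _ "case_sum y id \<circ> g"])
      qed
      then show "\<not> shattered (\<lambda>x y. P (case_sum x y)) n a" using a none by blast
    qed
    then show False using contr by contradiction
  qed
  let ?E = "\<lambda>(n, \<theta>) e. (\<forall>i<n. holds M (\<lambda>v. e (i, v)) \<theta>) \<and> shattered ?R n (\<lambda>i v. e (i, v))"
  have "\<exists>e. \<forall>Q \<in> ?E ` (UNIV \<times> p). Q e"
  proof (rule realize [OF \<kappa> sat B])
    have "|(UNIV :: nat set) \<times> (UNIV :: 'x set)| <o \<kappa>"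
      using small_Times [OF \<kappa>] \<kappa>(2) card_of_nat ordIso_ordLess_trans small by blast
    then show "|UNIV :: (nat \<times> 'x) set| <o \<kappa>" by (simp add: UNIV_Times_UNIV)
    fix Q assume "Q \<in> ?E ` (UNIV \<times> p)"
    then obtain n \<theta> where Q: "Q = ?E (n, \<theta>)" "\<theta> \<in> p" by auto
    have \<theta>: "\<theta> \<in> forms L B" using p(1) Q(2) by (auto simp: types_def)
    have "definable L M B (\<lambda>e. sat M e \<phi>)" by (rule definable_sat [OF \<phi>])
    then show "definable L M B Q"
      unfolding Q prod.case
      by (intro definable_conj definable_all_less definable_shattered)
        (rule definable_relabel [OF definable_holds [OF \<theta>]])
  next
    fix \<Gamma>0 assume "finite \<Gamma>0" "\<Gamma>0 \<subseteq> ?E ` (UNIV \<times> p)"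
    from finite_subset_image [OF this]
    obtain J where "J \<subseteq> UNIV \<times> p \<and> finite J \<and> \<Gamma>0 = ?E ` J" ..
    then have J: "finite J" "J \<subseteq> UNIV \<times> p" "\<Gamma>0 = ?E ` J" by simp_all
    have sndJ: "finite (snd ` J)" "snd ` J \<subseteq> p" using J by auto
    obtain \<theta> where \<theta>: "\<theta> \<in> p" "\<And>x. holds M x \<theta> \<longleftrightarrow> realizes M x (snd ` J)"
      using types_finite_conj [OF p(1) sndJ] by metis
    have "finite (fst ` J)" using J(1) by simp
    then obtain n where n: "\<forall>i\<in>fst ` J. i < n" unfolding finite_nat_set_iff_bounded ..
    obtain a where a: "\<forall>i<n. holds M (a i) \<theta>" "shattered ?R n a" using contr' \<theta>(1) by blast
    have "?E j (\<lambda>(i, v). a i v)" if "j \<in> J" for j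
    proof -
      have "fst j < n" using n that by blast
      moreover have "holds M x (snd j)" if "holds M x \<theta>" for x
        using that \<theta>(2) \<open>j \<in> J\<close> by (auto simp: realizes_def)
      ultimately show ?thesis
        using a shattered_mono [OF a(2), of "fst j"] by (auto simp: case_prod_beta)
    qed
    then show "\<exists>e. \<forall>Q\<in>\<Gamma>0. Q e"
      unfolding J(3) by (intro exI [of _ "\<lambda>(i, v). a i v"] ballI) (elim imageE, simp only:)
  qed
  then obtain e where e0: "\<forall>Q \<in> ?E ` (UNIV \<times> p). Q e" ..
  have e: "(\<forall>i<n. holds M (\<lambda>v. e (i, v)) \<theta>) \<and> shattered ?R n (\<lambda>i v. e (i, v))"
    if "\<theta> \<in> p" for n \<theta>
  proof -
    have "?E (n, \<theta>) \<in> ?E ` (UNIV \<times> p)" by (rule imageI) (use that in simp)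
    from bspec [OF e0 this] show ?thesis by simp
  qed
  obtain \<theta>0 where "\<theta>0 \<in> p" using types_finite_conj [OF p(1), of "{}"] by auto
  then have "\<forall>n. shattered ?R n (\<lambda>i v. e (i, v))" using e by blast
  then have "\<forall>s :: nat set. consistent M {signed (i \<in> s) (inst_left (\<lambda>v. e (i, v)) \<phi>) | i. True}"
    by (rule iffD2 [OF independent_iff_shattered])
  moreover have "\<forall>i. realizes M (\<lambda>v. e (i, v)) p"
    unfolding realizes_def using e lessI by metis
  ultimately have "has_IP L M p"
    unfolding has_IP_def using \<phi> by (intro exI [of _ \<phi>] exI [of _ "\<lambda>i v. e (i, v)"] conjI)
  then show False using p(2) by (simp add: NIP_def)
qed

section \<open>Generic truth in a nonforking global extension\<close>

locale nip_nonforking =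
  fixes L :: "('f, 'r) lang" and \<kappa> :: "'k rel" and M :: "('f, 'r, 'm) fo_struct"
    and A B :: "'m set" and p q :: "('f, 'r, 'x + 'm) fm set"
  assumes card: "Card_order \<kappa>" "natLeq <o \<kappa>"
    and sat: "saturated L \<kappa> M" and hom: "strongly_homogeneous L \<kappa> M"
    and small: "|UNIV :: 'x set| <o \<kappa>" and AB: "A \<subseteq> B" and B: "|B| <o \<kappa>"
    and p: "p \<in> types L M B" and NIP: "NIP L M p"
    and q: "q \<in> types L M UNIV" "p \<subseteq> q" and nonforking: "\<not> forks L M A q"
begin

definition generically :: "(('x \<Rightarrow> 'm) \<Rightarrow> bool) \<Rightarrow> bool" where
  "generically P \<longleftrightarrow> (\<exists>\<theta>\<in>q. \<forall>x. holds M x \<theta> \<longleftrightarrow> P x)"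

lemma small_A: "|A| <o \<kappa>"
  using AB B card_of_mono1 ordLeq_ordLess_trans by blast

lemma small_nat: "|UNIV :: nat set| <o \<kappa>"
  using card(2) card_of_nat ordIso_ordLess_trans by blast

lemma small_nat_Times: "|UNIV :: 'c set| <o \<kappa> \<Longrightarrow> |UNIV :: (nat \<times> 'c) set| <o \<kappa>"
  using small_Times [OF card small_nat, of "UNIV :: 'c set"] by (simp add: UNIV_Times_UNIV)

lemma generically_definable: "generically P \<Longrightarrow> definable L M UNIV P"
  using q(1) unfolding generically_def definable_def types_def by blast

lemma generically_ex:
  assumes "finite \<Gamma>0" "\<And>P. P \<in> \<Gamma>0 \<Longrightarrow> generically P"
  shows "\<exists>x. \<forall>P\<in>\<Gamma>0. P x"
proof -
  obtain t where t: "\<And>P. P \<in> \<Gamma>0 \<Longrightarrow> t P \<in> q \<and> (\<forall>x. holds M x (t P) \<longleftrightarrow> P x)"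
    using assms(2) unfolding generically_def by metis
  then obtain x where "realizes M x (t ` \<Gamma>0)"
    using types_consistent [OF q(1), of "t ` \<Gamma>0"] assms(1) by blast
  then have "\<forall>P\<in>\<Gamma>0. P x" using t unfolding realizes_def by blast
  then show ?thesis by blast
qed

lemma generically_cases:
  assumes "definable L M UNIV P"
  shows "generically P \<or> generically (\<lambda>x. \<not> P x)"
proof -
  obtain \<theta> where \<theta>: "\<theta> \<in> forms L UNIV" "\<forall>x. holds M x \<theta> \<longleftrightarrow> P x"
    using assms unfolding definable_def by blast
  then have "\<theta> \<in> q \<or> Neg \<theta> \<in> q" using q(1) by (auto simp: types_def)
  moreover have "\<forall>x. holds M x (Neg \<theta>) \<longleftrightarrow> \<not> P x" using \<theta>(2) by simp
  ultimately show ?thesis unfolding generically_def using \<theta>(2) by blast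
qed

lemma generically_mono:
  assumes "finite \<Gamma>0" "\<And>P. P \<in> \<Gamma>0 \<Longrightarrow> generically P" "definable L M UNIV R"
    and "\<And>x. \<forall>P\<in>\<Gamma>0. P x \<Longrightarrow> R x"
  shows "generically R"
proof (rule ccontr)
  assume "\<not> generically R"
  then have "generically (\<lambda>x. \<not> R x)" using generically_cases assms(3) by blast
  then have "\<exists>x. \<forall>P \<in> insert (\<lambda>x. \<not> R x) \<Gamma>0. P x"
    using assms(1,2) by (intro generically_ex) auto
  then show False using assms(4) by auto
qed

lemma generically_conj:
  assumes "generically P" "generically R" shows "generically (\<lambda>x. P x \<and> R x)"
  by (rule generically_mono [of "{P, R}"])
    (use assms in \<open>auto intro: definable_conj generically_definable\<close>)

lemma generically_not:
  assumes "definable L M UNIV P"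
  shows "generically (\<lambda>x. \<not> P x) \<longleftrightarrow> \<not> generically P"
  using generically_cases [OF assms] generically_ex [of "{P, \<lambda>x. \<not> P x}"] by auto

lemma generically_p: "\<theta> \<in> p \<Longrightarrow> generically (\<lambda>x. holds M x \<theta>)"
  using q(2) unfolding generically_def by blast

lemma generically_realize:
  assumes C: "|C| <o \<kappa>" and R: "definable L M UNIV R"
    and cons: "\<And>P. definable L M C P \<Longrightarrow> generically P \<Longrightarrow> \<exists>x. P x \<and> R x"
  obtains x where "R x" "\<forall>P. definable L M C P \<and> generically P \<longrightarrow> P x"
proof -
  obtain F where F: "finite F" "definable L M F R"
  proof -
    obtain \<theta> where \<theta>: "\<theta> \<in> forms L UNIV" "\<forall>x. holds M x \<theta> \<longleftrightarrow> R x"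
      using R unfolding definable_def by blast
    then have "\<theta> \<in> forms L (params \<theta>)" by (auto simp: forms_def)
    then have "definable L M (params \<theta>) R" using \<theta>(2) unfolding definable_def by blast
    then show thesis using that finite_params by blast
  qed
  have "|F| <o natLeq" using F(1) finite_iff_ordLess_natLeq by blast
  then have "|F| <o \<kappa>" using card(2) ordLess_transitive by blast
  then have CF: "|C \<union> F| <o \<kappa>" using small_Un card C by blast
  let ?\<Gamma> = "insert R {P. definable L M C P \<and> generically P}"
  have "\<exists>x. \<forall>P\<in>?\<Gamma>. P x"
  proof (rule realize [OF card sat CF small])
    show "definable L M (C \<union> F) P" if "P \<in> ?\<Gamma>" for P
      using that F(2) definable_mono by blast
    fix \<Gamma>0 assume fin: "finite \<Gamma>0" and sub: "\<Gamma>0 \<subseteq> ?\<Gamma>"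
    let ?P = "\<lambda>x. \<forall>P\<in>\<Gamma>0 - {R}. P x"
    have C_P: "definable L M C ?P"
      using fin sub by (intro definable_ball) auto
    have "generically ?P"
    proof (rule generically_mono [of "\<Gamma>0 - {R}"])
      show "definable L M UNIV ?P" by (rule definable_mono [OF C_P]) simp
    qed (use fin sub in auto)
    from cons [OF C_P this] obtain x where x: "?P x \<and> R x" ..
    have "P x" if "P \<in> \<Gamma>0" for P
    proof (cases "P = R")
      case False
      then have "P \<in> \<Gamma>0 - {R}" using that by simp
      with conjunct1 [OF x] show ?thesis by (rule bspec)
    qed (use x in simp)
    then show "\<exists>x. \<forall>P\<in>\<Gamma>0. P x" by (intro exI [of _ x] ballI)
  qed
  then obtain x where "\<forall>P\<in>?\<Gamma>. P x" ..
  then show thesis by (intro that [of x]) blast+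
qed

text \<open>This is where nonforking enters: no formula of \<open>q\<close> divides over \<open>A\<close>, hence among infinitely many
  \<open>A\<close>-conjugates of it any number \<open>n\<close> can be found that have a common solution. Acting on \<open>x\<close> by
  the inverse automorphism amounts to moving the parameters of \<open>P\<close>.\<close>

lemma generically_conjugates:
  assumes P: "generically P"
    and \<sigma>: "\<And>i :: nat. automorphism L M (\<sigma> i)" "\<And>i. \<forall>m\<in>A. \<sigma> i m = m"
  shows "\<exists>S x. finite S \<and> card S = n \<and> (\<forall>i\<in>S. P (inv (\<sigma> i) \<circ> x))"
proof -
  obtain \<theta> where \<theta>: "\<theta> \<in> q" "\<forall>x. holds M x \<theta> \<longleftrightarrow> P x"
    using P unfolding generically_def by blast
  have \<theta>form: "is_formula L \<theta>" using \<theta>(1) q(1) by (auto simp: types_def forms_def)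
  then obtain \<phi> and g :: "nat \<Rightarrow> 'm" where \<phi>: "is_formula L \<phi>"
    and "\<forall>x y. sat M (case_sum x (y \<circ> g)) \<phi> = sat M (case_sum x y) \<theta>"
    and inst: "\<forall>y :: 'm \<Rightarrow> 'm. inst_right (y \<circ> g) \<phi> = relabel_fm (case_sum Inl (\<lambda>c. Inr (y c))) \<theta>"
    by (rule number_slots)
  have "case_sum Inl (\<lambda>c. Inr (id c)) = (id :: 'x + 'm \<Rightarrow> 'x + 'm)"
    by (auto simp: fun_eq_iff split: sum.splits)
  then have eq: "\<theta> = inst_right g \<phi>" using inst [rule_format, of id] by (simp add: fm.map_id)
  have not_div: "\<not> divides L M A \<theta>"
  proof
    assume div: "divides L M A \<theta>"
    have "forks L M A q"
      unfolding forks_def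
    proof (intro exI conjI)
      show "finite {\<theta>}" "{\<theta>} \<subseteq> q" "finite {\<theta>}" "\<forall>\<delta>\<in>{\<theta>}. divides L M A \<delta>"
        using \<theta>(1) div by simp_all
      show "\<forall>a. realizes M a {\<theta>} \<longrightarrow> (\<exists>\<delta>\<in>{\<theta>}. holds M a \<delta>)" by (simp add: realizes_def)
    qed
    then show False using nonforking by contradiction
  qed
  have tp: "tp L M (\<sigma> i \<circ> g) A = tp L M g A" for i
    unfolding tp_eq_iff using definable_automorphism [OF _ \<sigma>] by blast
  have "\<exists>S. finite S \<and> card S = n \<and> consistent M {inst_right (\<sigma> i \<circ> g) \<phi> | i. i \<in> S}"
  proof (rule ccontr)
    assume "\<not> ?thesis"
    then have none: "\<forall>S. finite S \<and> card S = n \<longrightarrow>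
        \<not> consistent M {inst_right (\<sigma> i \<circ> g) \<phi> | i. i \<in> S}" by blast
    have "divides L M A \<theta>"
      unfolding divides_def
    proof (intro exI conjI)
      show "is_formula L \<phi>" "\<theta> = inst_right g \<phi>" by (fact \<phi> eq)+
      show "\<forall>i. tp L M (\<sigma> i \<circ> g) A = tp L M g A" using tp by simp
      show "\<forall>S. finite S \<and> card S = n \<longrightarrow>
        \<not> consistent M {inst_right (\<sigma> i \<circ> g) \<phi> | i. i \<in> S}" by (fact none)
    qed
    then show False using not_div by contradiction
  qed
  then obtain S where S: "finite S" "card S = n"
    "consistent M {inst_right (\<sigma> i \<circ> g) \<phi> | i. i \<in> S}" by (elim exE conjE)
  have "finite {inst_right (\<sigma> i \<circ> g) \<phi> | i. i \<in> S}" using S(1) by simp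
  from consistentD [OF S(3) this subset_refl]
  obtain x where x: "realizes M x {inst_right (\<sigma> i \<circ> g) \<phi> | i. i \<in> S}" ..
  have "P (inv (\<sigma> i) \<circ> x)" if "i \<in> S" for i
  proof -
    have bij: "bij (\<sigma> i)" using \<sigma>(1) by (simp add: automorphism_def)
    have "holds M x (inst_right (\<sigma> i \<circ> g) \<phi>)" using x that by (auto simp: realizes_def)
    moreover have "case_sum x id \<circ> case_sum Inl (\<lambda>c. Inr (\<sigma> i c)) = \<sigma> i \<circ> case_sum (inv (\<sigma> i) \<circ> x) id"
      using bij by (auto simp: fun_eq_iff bij_is_surj surj_f_inv_f split: sum.splits)
    ultimately have "sat M (\<sigma> i \<circ> case_sum (inv (\<sigma> i) \<circ> x) id) \<theta>"
      unfolding inst [rule_format] holds_def sat_relabel by simp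
    then have "holds M (inv (\<sigma> i) \<circ> x) \<theta>"
      unfolding holds_def using sat_automorphism [OF \<sigma>(1) \<theta>form] by blast
    then show ?thesis using \<theta>(2) by blast
  qed
  then show ?thesis using S by blast
qed

section \<open>Generic truth along indiscernible sequences\<close>

text \<open>For sequences of order type \<open>\<omega>\<close>, comparing infinite subsequences is equivalent to comparing increasing
  finite tuples, because a formula uses finitely many slots; it dispenses with lengths of tuples.\<close>

definition seq_indiscernible :: "(nat \<Rightarrow> 'c \<Rightarrow> 'm) \<Rightarrow> bool" where
  "seq_indiscernible k \<longleftrightarrow> (\<forall>g P. strict_mono g \<and> definable L M A P \<longrightarrow>
     P (\<lambda>(j, c). k (g j) c) = P (\<lambda>(j, c). k j c))"

lemma seq_indiscernible_subseq:
  fixes k :: "nat \<Rightarrow> 'c \<Rightarrow> 'm"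
  assumes "seq_indiscernible k" "strict_mono h"
  shows "seq_indiscernible (\<lambda>j. k (h j))"
  unfolding seq_indiscernible_def
proof (intro allI impI; elim conjE)
  fix g :: "nat \<Rightarrow> nat" and P :: "(nat \<times> 'c \<Rightarrow> 'm) \<Rightarrow> bool"
  assume "strict_mono g" and P: "definable L M A P"
  then have "strict_mono (\<lambda>j. h (g j))" using assms(2) by (simp add: strict_mono_def)
  then show "P (\<lambda>(j, c). k (h (g j)) c) = P (\<lambda>(j, c). k (h j) c)"
    using assms P unfolding seq_indiscernible_def by blast
qed

definition pattern :: "('f, 'r, 'x + 'm) fm \<Rightarrow> (('x + 'c \<Rightarrow> 'm) \<Rightarrow> bool) \<Rightarrow> nat \<Rightarrow> (nat \<Rightarrow> 'c \<Rightarrow> 'm)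
    \<Rightarrow> nat set \<Rightarrow> bool" where
  "pattern \<theta> P N k s \<longleftrightarrow> (\<exists>x. holds M x \<theta> \<and> (\<forall>t<N. P (case_sum x (k t)) \<longleftrightarrow> t \<in> s))"

text \<open>The passage to the dual family: index \<open>2\<^sup>n\<close> members of the sequence by the subsets of \<open>{..<n}\<close>, and let
  the \<open>i\<close>-th point cut out those members whose index set contains \<open>i\<close>.\<close>

lemma all_patterns_shattered:
  assumes "\<And>s. pattern \<theta> P (2 ^ n) k s"
  obtains a where "\<forall>i<n. holds M (a i) \<theta>" "shattered (\<lambda>x y. P (case_sum x y)) n a"
proof -
  let ?N = "2 ^ n :: nat"
  have "card (Pow {..<n}) = ?N" by (simp add: card_Pow)
  then obtain \<beta> where \<beta>: "bij_betw \<beta> {0..<?N} (Pow {..<n})"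
    using ex_bij_betw_nat_finite [of "Pow {..<n}"] by auto
  have "\<exists>x. holds M x \<theta> \<and> (\<forall>t<?N. P (case_sum x (k t)) \<longleftrightarrow> i \<in> \<beta> t)" for i
    using assms [of "{t. i \<in> \<beta> t}"] unfolding pattern_def by simp
  then obtain a where a: "\<And>i. holds M (a i) \<theta>"
    "\<And>i t. t < ?N \<Longrightarrow> P (case_sum (a i) (k t)) \<longleftrightarrow> i \<in> \<beta> t" by metis
  have "shattered (\<lambda>x y. P (case_sum x y)) n a"
    unfolding shattered_def
  proof
    fix s
    have "s \<inter> {..<n} \<in> \<beta> ` {0..<?N}" using \<beta> by (auto simp: bij_betw_def)
    then obtain t where "t < ?N" "s \<inter> {..<n} = \<beta> t" by auto
    then have "\<forall>i<n. P (case_sum (a i) (k t)) \<longleftrightarrow> i \<in> s" using a(2) by auto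
    then show "\<exists>y. \<forall>i<n. P (case_sum (a i) y) \<longleftrightarrow> i \<in> s" by (intro exI [of _ "k t"])
  qed
  then show thesis using that a(1) by blast
qed

text \<open>Homogeneity is demanded of the tail \<open>k\<^sub>1, k\<^sub>2, \<dots>\<close> only. The element \<open>k\<^sub>0\<close> must stay outside, since
  \<open>\<theta>\<close> may have parameters outside \<open>A\<close> that distinguish \<open>k\<^sub>0\<close> from the other members.\<close>

lemma generically_const_homogeneous:
  fixes k :: "nat \<Rightarrow> 'c \<Rightarrow> 'm" and P :: "('x + 'c \<Rightarrow> 'm) \<Rightarrow> bool"
  assumes smallc: "|UNIV :: 'c set| <o \<kappa>" and ind: "seq_indiscernible k"
    and P: "definable L M A P"
    and \<theta>: "\<theta> \<in> p"
    and bound: "\<And>a. (\<And>i. i < n \<Longrightarrow> holds M (a i) \<theta>) \<Longrightarrow> \<not> shattered (\<lambda>x y. P (case_sum x y)) n a"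
    and homog: "\<And>s j j'. strict_mono_on {..<2 ^ n} j \<Longrightarrow> strict_mono_on {..<2 ^ n} j' \<Longrightarrow>
      pattern \<theta> P (2 ^ n) (\<lambda>t. k (Suc (j t))) s = pattern \<theta> P (2 ^ n) (\<lambda>t. k (Suc (j' t))) s"
  shows "generically (\<lambda>x. P (case_sum x (k 0))) = generically (\<lambda>x. P (case_sum x (k 1)))"
proof (rule ccontr)
  let ?N = "2 ^ n :: nat"
  have defP: "definable L M UNIV (\<lambda>x. P (case_sum x (k i)))" for i
    by (rule definable_inst [OF definable_mono [OF P]]) simp_all
  assume ne: "generically (\<lambda>x. P (case_sum x (k 0))) \<noteq> generically (\<lambda>x. P (case_sum x (k 1)))"
  obtain \<tau> where \<tau>: "generically (\<lambda>x. P (case_sum x (k 0)) = \<tau> \<and> P (case_sum x (k 1)) = (\<not> \<tau>))"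
  proof (cases "generically (\<lambda>x. P (case_sum x (k 0)))")
    case True
    then have "generically (\<lambda>x. \<not> P (case_sum x (k 1)))" using ne generically_not [OF defP] by blast
    from generically_conj [OF True this] show thesis using that [of True] by simp
  next
    case False
    then have "generically (\<lambda>x. \<not> P (case_sum x (k 0)))" "generically (\<lambda>x. P (case_sum x (k 1)))"
      using ne generically_not [OF defP] by blast+
    from generically_conj [OF this] show thesis using that [of False] by simp
  qed
  \<comment> \<open>Shifts by even numbers keep the pairs \<open>(k\<^bsub>2i\<^esub>, k\<^bsub>2i+1\<^esub>)\<close> apart.\<close>
  have "\<exists>\<sigma>. automorphism L M \<sigma> \<and> (\<forall>m\<in>A. \<sigma> m = m) \<and> (\<forall>j. \<sigma> \<circ> k j = k (j + 2 * i))" for i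
  proof -
    let ?e = "\<lambda>(j, c). k j c" and ?e' = "\<lambda>(j, c). k (j + 2 * i) c"
    have "strict_mono (\<lambda>j :: nat. j + 2 * i)" by (simp add: strict_mono_def)
    then have "Q ?e = Q ?e'" if "definable L M A Q" for Q
      using ind that unfolding seq_indiscernible_def by blast
    from automorphism_over [where e = ?e and e' = ?e', OF card hom small_A small_nat_Times [OF smallc] this]
    obtain \<sigma> where "automorphism L M \<sigma>" "\<forall>m\<in>A. \<sigma> m = m" "\<sigma> \<circ> ?e = ?e'" by blast
    moreover from this(3) have "\<sigma> (k j c) = k (j + 2 * i) c" for j c
      by (auto simp: fun_eq_iff)
    ultimately show ?thesis by (intro exI [of _ \<sigma>]) (auto simp: fun_eq_iff)
  qed
  then obtain \<sigma> where \<sigma>: "\<And>i. automorphism L M (\<sigma> i)" "\<And>i. \<forall>m\<in>A. \<sigma> i m = m"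
    "\<And>i j. \<sigma> i \<circ> k j = k (j + 2 * i)" by metis
  let ?R = "\<lambda>x. holds M x \<theta> \<and> P (case_sum x (k 0)) = \<tau> \<and> P (case_sum x (k 1)) = (\<not> \<tau>)"
  have "generically ?R" using generically_conj [OF generically_p [OF \<theta>] \<tau>] .
  \<comment> \<open>One index is used up to move \<open>\<theta>\<close> back to its original parameters; the others give \<open>2\<^sup>n\<close> alternations.\<close>
  from generically_conjugates [where \<sigma> = \<sigma> and n = "Suc ?N", OF this \<sigma>(1,2)]
  obtain S x where S0: "finite S \<and> card S = Suc ?N \<and> (\<forall>i\<in>S. ?R (inv (\<sigma> i) \<circ> x))" by (elim exE)
  then have S: "finite S" "card S = Suc ?N" by simp_all
  have R: "?R (inv (\<sigma> i) \<circ> x)" if "i \<in> S" for i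
    using S0 that by (elim conjE) (rule bspec)
  have move: "P (case_sum (inv (\<sigma> i) \<circ> x) (k j)) = P (case_sum x (k (j + 2 * i)))" for i j
  proof -
    have "bij (\<sigma> i)" using \<sigma>(1) by (simp add: automorphism_def)
    then have "\<sigma> i \<circ> case_sum (inv (\<sigma> i) \<circ> x) (k j) = case_sum x (\<sigma> i \<circ> k j)"
      by (auto simp: fun_eq_iff bij_is_surj surj_f_inv_f split: sum.splits)
    then show ?thesis using definable_automorphism [OF P \<sigma>(1,2)] \<sigma>(3) by metis
  qed
  define i0 where "i0 = Min S"
  have "S \<noteq> {}" using S(2) by auto
  then have i0: "i0 \<in> S" "\<And>i. i \<in> S \<Longrightarrow> i0 \<le> i" using S(1) by (auto simp: i0_def)
  \<comment> \<open>With the smallest index \<open>i\<^sub>0\<close> shifted back to \<open>0\<close>, the point satisfies \<open>\<theta>\<close> itself and the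
    remaining alternations happen in the homogeneous tail.\<close>
  have alt: "P (case_sum (inv (\<sigma> i0) \<circ> x) (k (2 * (i - i0)))) = \<tau>"
    "P (case_sum (inv (\<sigma> i0) \<circ> x) (k (Suc (2 * (i - i0))))) = (\<not> \<tau>)" if "i \<in> S" for i
  proof -
    have "2 * (i - i0) + 2 * i0 = 0 + 2 * i" "Suc (2 * (i - i0)) + 2 * i0 = 1 + 2 * i"
      using i0(2) [OF that] by auto
    then show "P (case_sum (inv (\<sigma> i0) \<circ> x) (k (2 * (i - i0)))) = \<tau>"
      "P (case_sum (inv (\<sigma> i0) \<circ> x) (k (Suc (2 * (i - i0))))) = (\<not> \<tau>)"
      using R [OF that] unfolding move by simp_all
  qed
  have "card (S - {i0}) = ?N" using S i0(1) by simp
  then obtain en where en: "bij_betw en {..<?N} (S - {i0})" "strict_mono_on {..<?N} en"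
    using ex_bij_betw_strict_mono_card [of "S - {i0}"] S(1) by (metis finite_Diff)
  have en_S: "en t \<in> S" "i0 < en t" if "t < ?N" for t
  proof -
    have "en t \<in> S - {i0}" using en(1) that by (auto simp: bij_betw_def)
    then show "en t \<in> S" "i0 < en t" using i0(2) [of "en t"] by auto
  qed
  have "pattern \<theta> P ?N (\<lambda>t. k (Suc t)) s" for s
  proof -
    \<comment> \<open>From each alternating pair take the member on which \<open>P\<close> has the prescribed truth value;
      \<open>j\<close> is shifted by one because the tail begins at index \<open>1\<close>.\<close>
    define j where "j t = 2 * (en t - i0) - (if (t \<in> s) = \<tau> then 1 else 0)" for t
    have Sucj: "Suc (j t) = (if (t \<in> s) = \<tau> then 2 * (en t - i0) else Suc (2 * (en t - i0)))"
      if "t < ?N" for t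
      using en_S(2) [OF that] by (auto simp: j_def)
    have "P (case_sum (inv (\<sigma> i0) \<circ> x) (k (Suc (j t)))) \<longleftrightarrow> t \<in> s" if "t < ?N" for t
      unfolding Sucj [OF that] using alt [OF en_S(1) [OF that]] by auto
    moreover have "holds M (inv (\<sigma> i0) \<circ> x) \<theta>" using R [OF i0(1)] by (rule conjunct1)
    ultimately have "pattern \<theta> P ?N (\<lambda>t. k (Suc (j t))) s"
      unfolding pattern_def by blast
    moreover have "strict_mono_on {..<?N} j"
    proof (rule strict_mono_onI)
      fix t u assume "t \<in> {..<?N}" "u \<in> {..<?N}" "t < u"
      then have "en t < en u" "i0 < en t" using en(2) en_S(2) by (auto simp: strict_mono_on_def)
      then show "j t < j u" by (auto simp: j_def)
    qed
    moreover have "strict_mono_on {..<?N} (\<lambda>t. t)" by (simp add: strict_mono_on_def)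
    ultimately show ?thesis using homog [of j "\<lambda>t. t" s] by simp
  qed
  from all_patterns_shattered [OF this]
  obtain a where "\<forall>i<n. holds M (a i) \<theta>" "shattered (\<lambda>x y. P (case_sum x y)) n a" .
  then show False using bound by blast
qed

text \<open>Ramsey's theorem, the colour of an \<open>N\<close>-element set of indices being the set of its patterns. The
  indices \<open>0\<close> and \<open>1\<close> are left out of the subsequence so that either can be put in front of it.\<close>

lemma homogeneous_subsequence:
  fixes k :: "nat \<Rightarrow> 'c \<Rightarrow> 'm"
  obtains h :: "nat \<Rightarrow> nat" where "strict_mono h" "\<forall>i. 2 \<le> h i"
    "\<forall>s (j :: nat \<Rightarrow> nat) (j' :: nat \<Rightarrow> nat). strict_mono_on {..<N} j \<and> strict_mono_on {..<N} j' \<longrightarrow>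
      pattern \<theta> P N (\<lambda>t. k (h (j t))) s = pattern \<theta> P N (\<lambda>t. k (h (j' t))) s"
proof -
  define col where "col J = {s \<in> Pow {..<N}. pattern \<theta> P N (\<lambda>t. k (sorted_list_of_set J ! t)) s}" for J
  obtain code m where code: "code ` Pow (Pow {..<N}) = {i. i < (m :: nat)}" "inj_on code (Pow (Pow {..<N}))"
    using finite_imp_inj_to_nat_seg [of "Pow (Pow {..<N})"] by auto
  have col: "col J \<in> Pow (Pow {..<N})" for J by (auto simp: col_def)
  have "\<forall>J. J \<subseteq> {2..} \<and> finite J \<and> card J = N \<longrightarrow> code (col J) < m"
    using code(1) col by blast
  from Ramsey [OF infinite_Ici this]
  obtain H c where "H \<subseteq> {2..} \<and> infinite H \<and> c < m \<and>
    (\<forall>J. J \<subseteq> H \<and> finite J \<and> card J = N \<longrightarrow> code (col J) = c)" by (elim exE)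
  then have H: "H \<subseteq> {2..}" "infinite H"
    "\<And>J. J \<subseteq> H \<Longrightarrow> finite J \<Longrightarrow> card J = N \<Longrightarrow> code (col J) = c" by simp_all
  define h where "h = enumerate H"
  have h: "strict_mono h" "h i \<in> H" for i
    using H(2) by (auto simp: h_def strict_mono_def enumerate_in_set)
  have pat: "pattern \<theta> P N (\<lambda>t. k (h (j t))) s \<longleftrightarrow> s \<inter> {..<N} \<in> col ((\<lambda>t. h (j t)) ` {..<N})"
    if "strict_mono_on {..<N} j" for j :: "nat \<Rightarrow> nat" and s
  proof -
    let ?l = "map (\<lambda>t. h (j t)) [0..<N]"
    have "sorted_wrt (<) ?l"
      using that h(1) by (auto simp: sorted_wrt_iff_nth_less strict_mono_def strict_mono_on_def)
    then have "sorted_list_of_set (set ?l) = ?l"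
      unfolding strict_sorted_iff by (intro sorted_list_of_set.idem_if_sorted_distinct) simp_all
    then have l: "sorted_list_of_set ((\<lambda>t. h (j t)) ` {..<N}) = ?l"
      by (simp add: atLeast0LessThan)
    show ?thesis
      unfolding col_def l by (auto simp: pattern_def)
  qed
  have const: "code (col ((\<lambda>t. h (j t)) ` {..<N})) = c" if "strict_mono_on {..<N} j" for j :: "nat \<Rightarrow> nat"
  proof (rule H(3))
    have "inj_on (\<lambda>t. h (j t)) {..<N}"
      using strict_mono_on_imp_inj_on [OF that] strict_mono_eq [OF h(1)] by (auto simp: inj_on_def)
    then show "card ((\<lambda>t. h (j t)) ` {..<N}) = N" by (simp add: card_image)
  qed (use h(2) in auto)
  show thesis
  proof (rule that [OF h(1)])
    show "\<forall>i. 2 \<le> h i" using h(2) H(1) by auto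
    show "\<forall>s (j :: nat \<Rightarrow> nat) (j' :: nat \<Rightarrow> nat). strict_mono_on {..<N} j \<and> strict_mono_on {..<N} j' \<longrightarrow>
      pattern \<theta> P N (\<lambda>t. k (h (j t))) s = pattern \<theta> P N (\<lambda>t. k (h (j' t))) s"
    proof (intro allI impI; elim conjE)
      fix s and j j' :: "nat \<Rightarrow> nat" assume j: "strict_mono_on {..<N} j" "strict_mono_on {..<N} j'"
      have "col ((\<lambda>t. h (j t)) ` {..<N}) = col ((\<lambda>t. h (j' t)) ` {..<N})"
        using const [OF j(1)] const [OF j(2)] col inj_onD [OF code(2)] by metis
      then show "pattern \<theta> P N (\<lambda>t. k (h (j t))) s = pattern \<theta> P N (\<lambda>t. k (h (j' t))) s"
        unfolding pat [OF j(1)] pat [OF j(2)] by simp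
    qed
  qed
qed

text \<open>Neither \<open>k\<^sub>0\<close> nor \<open>k\<^sub>1\<close> need be part of a homogeneous tail, but each can be compared with the first member
  of a homogeneous subsequence that lies beyond both.\<close>

lemma generically_const:
  fixes k :: "nat \<Rightarrow> 'c \<Rightarrow> 'm" and P :: "('x + 'c \<Rightarrow> 'm) \<Rightarrow> bool"
  assumes smallc: "|UNIV :: 'c set| <o \<kappa>" and ind: "seq_indiscernible k"
    and P: "definable L M A P"
  shows "generically (\<lambda>x. P (case_sum x (k 0))) = generically (\<lambda>x. P (case_sum x (k 1)))"
proof -
  have "definable L M UNIV P" by (rule definable_mono [OF P]) simp
  from NIP_bound [OF card sat B small p NIP this]
  obtain \<theta> n where \<theta>: "\<theta> \<in> p" and
    bound: "\<And>a. (\<And>i. i < n \<Longrightarrow> holds M (a i) \<theta>) \<Longrightarrow> \<not> shattered (\<lambda>x y. P (case_sum x y)) n a"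
    by metis
  obtain h :: "nat \<Rightarrow> nat" where h: "strict_mono h" "\<forall>i. 2 \<le> h i"
    "\<forall>s (j :: nat \<Rightarrow> nat) (j' :: nat \<Rightarrow> nat). strict_mono_on {..<2 ^ n} j \<and> strict_mono_on {..<2 ^ n} j' \<longrightarrow>
      pattern \<theta> P (2 ^ n) (\<lambda>t. k (h (j t))) s = pattern \<theta> P (2 ^ n) (\<lambda>t. k (h (j' t))) s"
    by (rule homogeneous_subsequence [of "2 ^ n" \<theta> P k])
  have "generically (\<lambda>x. P (case_sum x (k l))) = generically (\<lambda>x. P (case_sum x (k (h 0))))"
    if "l < 2" for l
  proof -
    define g where "g i = (case i of 0 \<Rightarrow> l | Suc i \<Rightarrow> h i)" for i
    have "g i < g (Suc i)" for i
      using h(1,2) that by (auto simp: g_def strict_mono_def less_le_trans split: nat.splits)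
    then have "strict_mono g" by (simp add: strict_mono_Suc_iff)
    then have ind_g: "seq_indiscernible (\<lambda>i. k (g i))" using seq_indiscernible_subseq ind by blast
    have "generically (\<lambda>x. P (case_sum x (k (g 0)))) = generically (\<lambda>x. P (case_sum x (k (g 1))))"
    proof (rule generically_const_homogeneous [OF smallc ind_g P \<theta>])
      show "\<not> shattered (\<lambda>x y. P (case_sum x y)) n a" if "\<And>i. i < n \<Longrightarrow> holds M (a i) \<theta>" for a
        using bound that by simp
      fix s and j j' :: "nat \<Rightarrow> nat"
      assume "strict_mono_on {..<2 ^ n} j" "strict_mono_on {..<2 ^ n} j'"
      then show "pattern \<theta> P (2 ^ n) (\<lambda>t. k (g (Suc (j t)))) s = pattern \<theta> P (2 ^ n) (\<lambda>t. k (g (Suc (j' t)))) s"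
        unfolding g_def nat.case by (intro h(3) [rule_format] conjI)
    qed
    then show ?thesis by (simp add: g_def)
  qed
  from this [of 0] this [of 1] show ?thesis by simp
qed

end

section \<open>Sequences with the type of the Morley sequence\<close>

definition depends_below :: "nat \<Rightarrow> ((nat \<times> 'x \<Rightarrow> 'm) \<Rightarrow> bool) \<Rightarrow> bool" where
  "depends_below n P \<longleftrightarrow> (\<forall>e e'. (\<forall>k<n. \<forall>v. e (k, v) = e' (k, v)) \<longrightarrow> P e = P e')"

lemma depends_belowD:
  "depends_below n P \<Longrightarrow> (\<And>k v. k < n \<Longrightarrow> e (k, v) = e' (k, v)) \<Longrightarrow> P e = P e'"
  unfolding depends_below_def by blast

lemma definable_depends_below:
  fixes P :: "(nat \<times> 'x \<Rightarrow> 'm) \<Rightarrow> bool"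
  assumes "definable L M A P"
  obtains n where "depends_below n P"
proof -
  obtain F where F: "finite F" "\<And>e e'. (\<And>c. c \<in> F \<Longrightarrow> e c = e' c) \<Longrightarrow> P e = P e'"
    using definable_finite_support [OF assms] by metis
  have "finite (fst ` F)" using F(1) by simp
  then obtain n where n: "\<forall>k\<in>fst ` F. k < n" unfolding finite_nat_set_iff_bounded ..
  have "depends_below n P"
    unfolding depends_below_def
  proof (intro allI impI)
    fix e e' :: "nat \<times> 'x \<Rightarrow> 'm" assume eq: "\<forall>k<n. \<forall>v. e (k, v) = e' (k, v)"
    show "P e = P e'"
    proof (rule F(2))
      fix c assume "c \<in> F"
      then have "fst c < n" using n by blast
      then show "e c = e' c" using eq by (cases c) simp
    qed
  qed
  then show thesis by (rule that)
qed

lemma finite_linorder_enumeration: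
  assumes "finite (W :: 'i::linorder set)"
  obtains h where "strict_mono_on {..<card W} h" "h ` {..<card W} = W"
proof (rule that [of "\<lambda>i. sorted_list_of_set W ! i"])
  show "strict_mono_on {..<card W} (\<lambda>i. sorted_list_of_set W ! i)"
    using strict_sorted_list_of_set [of W] assms
    by (auto simp: strict_mono_on_def sorted_wrt_iff_nth_less)
  have "set (sorted_list_of_set W) = W" using assms by simp
  then show "(\<lambda>i. sorted_list_of_set W ! i) ` {..<card W} = W"
    using assms by (auto simp: set_conv_nth image_def)
qed

definition append_seq :: "nat \<Rightarrow> (nat \<Rightarrow> 'a) \<Rightarrow> (nat \<Rightarrow> 'a) \<Rightarrow> nat \<Rightarrow> 'a" where
  "append_seq m s d k = (if k < m then s k else d (k - m))"

locale morley_setting = nip_nonforking L \<kappa> M A B p q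
  for L :: "('f, 'r) lang" and \<kappa> :: "'k rel" and M :: "('f, 'r, 'm) fo_struct"
    and A B :: "'m set" and p q :: "('f, 'r, 'x + 'm) fm set" +
  fixes X :: "'i::linorder set" and a :: "'i \<Rightarrow> 'x \<Rightarrow> 'm"
  assumes infX: "infinite X" and XB: "entries a X \<subseteq> B"
    and gen: "generated L M p A X a" and ind: "indiscernible L M A X a"
begin

definition increasing :: "nat \<Rightarrow> (nat \<Rightarrow> 'i) \<Rightarrow> bool" where
  "increasing n g \<longleftrightarrow> strict_mono_on {..<n} g \<and> g ` {..<n} \<subseteq> X"

text \<open>The Ehrenfeucht-Mostowski type over \<open>A\<close> of the indiscernible sequence \<open>a\<close>, in \<open>n\<close> variables.\<close>

definition EM :: "(nat \<Rightarrow> 'x \<Rightarrow> 'm) \<Rightarrow> nat \<Rightarrow> bool" where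
  "EM s n \<longleftrightarrow> (\<forall>g P. increasing n g \<and> definable L M A P \<and> depends_below n P \<longrightarrow>
     P (case_prod s) = P (case_prod (\<lambda>k. a (g k))))"

lemma increasing_same_type:
  fixes P :: "(nat \<times> 'x \<Rightarrow> 'm) \<Rightarrow> bool"
  assumes g: "increasing n g" "increasing n h" and P: "definable L M A P" "depends_below n P"
  shows "P (case_prod (\<lambda>k. a (g k))) = P (case_prod (\<lambda>k. a (h k)))"
proof (cases "n = 0")
  case True
  then show ?thesis by (intro depends_belowD [OF P(2)]) simp
next
  case False
  obtain \<theta> where \<theta>: "\<theta> \<in> forms L A" "\<forall>e. holds M e \<theta> \<longleftrightarrow> P e"
    using P(1) unfolding definable_def by blast
  \<comment> \<open>Indiscernibility refers to the slots that occur in a formula, \<open>depends_below\<close> to truth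
    values; slots with index at least \<open>n\<close> are redirected to make the two agree.\<close>
  let ?f = "\<lambda>(k, v). (if k < n then k else 0, v) :: nat \<times> 'x"
  let ?\<theta> = "relabel_fm (map_sum ?f id) \<theta>"
  have form: "?\<theta> \<in> forms L A"
    using \<theta>(1) by (fastforce simp: forms_def params_def fm.set_map map_sum_def split: sum.splits)
  have below: "\<forall>k v. Inl (k, v) \<in> free_fm ?\<theta> \<longrightarrow> k < n"
    using False by (auto simp: fm.set_map map_sum_def split: sum.splits if_splits)
  have "strict_mono_on {..<n} g \<and> g ` {..<n} \<subseteq> X \<and> strict_mono_on {..<n} h \<and> h ` {..<n} \<subseteq> X"
    using g by (simp add: increasing_def)
  from ind [unfolded indiscernible_def, rule_format, OF this conjI [OF form below]]
  have "holds M (\<lambda>(k, v). a (g k) v) ?\<theta> = holds M (\<lambda>(k, v). a (h k) v) ?\<theta>" .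
  moreover have "holds M e ?\<theta> = P e" for e
  proof -
    have "case_sum e id \<circ> map_sum ?f id = case_sum (e \<circ> ?f) id"
      by (auto simp: fun_eq_iff split: sum.splits)
    then have "holds M e ?\<theta> = P (e \<circ> ?f)"
      using \<theta>(2) by (simp only: holds_def sat_relabel)
    also have "\<dots> = P e" by (rule depends_belowD [OF P(2)]) simp
    finally show ?thesis .
  qed
  ultimately show ?thesis by simp
qed

lemma increasing_EM: "increasing n g \<Longrightarrow> EM (\<lambda>k. a (g k)) n"
  unfolding EM_def using increasing_same_type by blast

lemma EM_cong:
  assumes "EM s n" "\<And>k. k < n \<Longrightarrow> s k = s' k"
  shows "EM s' n"
  unfolding EM_def
proof (intro allI impI; elim conjE)
  fix g and P :: "(nat \<times> 'x \<Rightarrow> 'm) \<Rightarrow> bool"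
  assume *: "increasing n g" "definable L M A P" "depends_below n P"
  have "P (case_prod s') = P (case_prod s)"
    by (rule depends_belowD [OF *(3)]) (simp add: assms(2))
  also have "\<dots> = P (case_prod (\<lambda>k. a (g k)))"
    using assms(1) * unfolding EM_def by blast
  finally show "P (case_prod s') = P (case_prod (\<lambda>k. a (g k)))" .
qed

lemma ex_increasing:
  assumes "infinite Y" "Y \<subseteq> X"
  obtains g where "increasing n g" "g ` {..<n} \<subseteq> Y"
proof -
  obtain W where W: "finite W" "card W = n" "W \<subseteq> Y"
    using infinite_arbitrarily_large [OF assms(1)] by metis
  obtain h where "strict_mono_on {..<card W} h" "h ` {..<card W} = W"
    using finite_linorder_enumeration [OF W(1)] by metis
  then show thesis using that [of h] W assms(2) by (auto simp: increasing_def)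
qed

lemma increasing_le: "increasing n g \<Longrightarrow> m \<le> n \<Longrightarrow> increasing m g"
  by (auto simp: increasing_def strict_mono_on_def)

lemma EM_subseq:
  assumes s: "EM s n" and f: "strict_mono_on {..<m} f" "f ` {..<m} \<subseteq> {..<n}"
  shows "EM (\<lambda>k. s (f k)) m"
  unfolding EM_def
proof (intro allI impI; elim conjE)
  fix g' and P :: "(nat \<times> 'x \<Rightarrow> 'm) \<Rightarrow> bool"
  assume g': "increasing m g'" and P: "definable L M A P" "depends_below m P"
  obtain g where g: "increasing n g" using ex_increasing [OF infX subset_refl] by metis
  let ?P = "\<lambda>e. P (\<lambda>c. e (f (fst c), snd c))"
  have "definable L M A ?P" by (rule definable_relabel [OF P(1)])
  moreover have "depends_below n ?P"
    unfolding depends_below_def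
  proof (intro allI impI)
    fix e e' :: "nat \<times> 'x \<Rightarrow> 'm" assume "\<forall>k<n. \<forall>v. e (k, v) = e' (k, v)"
    then show "?P e = ?P e'" using f(2) by (intro depends_belowD [OF P(2)]) auto
  qed
  ultimately have "?P (case_prod s) = ?P (case_prod (\<lambda>k. a (g k)))"
    using s g unfolding EM_def by blast
  moreover have "(\<lambda>c. case_prod t (f (fst c), snd c)) = case_prod (\<lambda>k. t (f k))"
    for t :: "nat \<Rightarrow> 'x \<Rightarrow> 'm" by auto
  ultimately have "P (case_prod (\<lambda>k. s (f k))) = P (case_prod (\<lambda>k. a (g (f k))))" by (simp only:)
  also have "increasing m (\<lambda>k. g (f k))"
    using f g by (auto simp: increasing_def strict_mono_on_def image_subset_iff)
  then have "P (case_prod (\<lambda>k. a (g (f k)))) = P (case_prod (\<lambda>k. a (g' k)))"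
    using increasing_same_type g' P by blast
  finally show "P (case_prod (\<lambda>k. s (f k))) = P (case_prod (\<lambda>k. a (g' k)))" .
qed

text \<open>By compactness: the existence of a continuation satisfying finitely many conditions is itself
  expressed by a formula about the given entries, and it holds for increasing tuples of \<open>a\<close>.\<close>

lemma EM_extend:
  assumes s: "EM s l"
  obtains u where "\<And>k. k < l \<Longrightarrow> u k = s k" "\<And>n. EM u n"
proof -
  define mix where "mix e = (\<lambda>(k, v). if k < l then s k v else e (k, v))" for e :: "nat \<times> 'x \<Rightarrow> 'm"
  let ?J = "{P. definable L M A P \<and> (\<forall>n g. increasing n g \<and> depends_below n P \<longrightarrow> P (case_prod (\<lambda>k. a (g k))))}"
  let ?C = "A \<union> range (case_prod s)"
  have "|range (case_prod s)| <o \<kappa>"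
    using small_nat_Times [OF small] card_of_image ordLeq_ordLess_trans by blast
  then have C: "|?C| <o \<kappa>" using small_Un card small_A by blast
  have "\<exists>e. \<forall>R \<in> (\<lambda>P e. P (mix e)) ` ?J. R e"
  proof (rule realize [OF card sat C small_nat_Times [OF small]])
    fix R assume "R \<in> (\<lambda>P e. P (mix e)) ` ?J"
    then obtain P where P: "R = (\<lambda>e. P (mix e))" "definable L M A P" by blast
    have "definable L M ?C P" by (rule definable_mono [OF P(2)]) simp
    then have *: "definable L M ?C (\<lambda>e. P (case_sum e id \<circ> (\<lambda>c. if fst c < l then Inr (case_prod s c) else Inl c)))"
      by (rule definable_subst) (auto split: if_splits)
    have "case_sum e id \<circ> (\<lambda>c. if fst c < l then Inr (case_prod s c) else Inl c) = mix e" for e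
      by (auto simp: fun_eq_iff mix_def)
    with * show "definable L M ?C R" unfolding P(1) by (simp only:)
  next
    fix \<Gamma>0 assume "finite \<Gamma>0" "\<Gamma>0 \<subseteq> (\<lambda>P e. P (mix e)) ` ?J"
    from finite_subset_image [OF this]
    obtain J where "J \<subseteq> ?J \<and> finite J \<and> \<Gamma>0 = (\<lambda>P e. P (mix e)) ` J" ..
    then have J: "J \<subseteq> ?J" "finite J" "\<Gamma>0 = (\<lambda>P e. P (mix e)) ` J" by simp_all
    have J_def: "definable L M A P" if "P \<in> J" for P using J(1) that by blast
    have "\<exists>n. depends_below n P" if "P \<in> J" for P
      using definable_depends_below [OF J_def [OF that]] by metis
    then obtain b where b: "\<And>P. P \<in> J \<Longrightarrow> depends_below (b P) P" by metis
    have "finite (b ` J)" using J(2) by simp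
    then obtain N where N: "\<forall>n\<in>b ` J. n < N" unfolding finite_nat_set_iff_bounded ..
    let ?E = "\<lambda>e. \<exists>e'. (\<forall>c. c \<notin> {c. l \<le> fst c} \<longrightarrow> e' c = e c) \<and> (\<forall>P\<in>J. P e')"
    have "definable L M A ?E"
      by (intro definable_ex_on definable_ball J(2) J_def)
    moreover have "depends_below l ?E"
      unfolding depends_below_def
    proof (intro allI impI)
      fix e e' :: "nat \<times> 'x \<Rightarrow> 'm" assume eq: "\<forall>k<l. \<forall>v. e (k, v) = e' (k, v)"
      have "(\<forall>c. c \<notin> {c. l \<le> fst c} \<longrightarrow> e1 c = e c) \<longleftrightarrow> (\<forall>c. c \<notin> {c. l \<le> fst c} \<longrightarrow> e1 c = e' c)" for e1
        using eq by auto
      then show "?E e = ?E e'" by simp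
    qed
    moreover obtain g where g: "increasing (max l N) g"
      using ex_increasing [OF infX subset_refl] by metis
    moreover have "increasing l g" using increasing_le [OF g] by simp
    ultimately have "?E (case_prod s) = ?E (case_prod (\<lambda>k. a (g k)))"
      using s unfolding EM_def by blast
    moreover have "?E (case_prod (\<lambda>k. a (g k)))"
    proof (intro exI conjI ballI)
      fix P assume P: "P \<in> J"
      then have "b P \<le> max l N" using N by force
      then have "increasing (b P) g" using increasing_le [OF g] by blast
      then show "P (case_prod (\<lambda>k. a (g k)))" using J(1) b P by blast
    qed simp
    ultimately obtain e' where e': "\<forall>c. c \<notin> {c. l \<le> fst c} \<longrightarrow> e' c = case_prod s c" "\<forall>P\<in>J. P e'"
      by blast
    have "mix e' = e'" using e'(1) by (auto simp: mix_def fun_eq_iff)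
    then show "\<exists>e. \<forall>R\<in>\<Gamma>0. R e" using e'(2) unfolding J(3) by (intro exI [of _ e']) simp
  qed
  then obtain e where e: "\<forall>R \<in> (\<lambda>P e. P (mix e)) ` ?J. R e" ..
  have true: "P (mix e)" if P: "definable L M A P" "depends_below n P" "increasing n g"
    "P (case_prod (\<lambda>k. a (g k)))" for P n g
  proof -
    have "P (case_prod (\<lambda>k. a (g' k)))" if g': "increasing n' g'" "depends_below n' P" for n' g'
    proof -
      obtain h where h: "increasing (max n n') h"
        using ex_increasing [OF infX subset_refl] by metis
      have "increasing n h" "increasing n' h" using increasing_le [OF h] by simp_all
      then show ?thesis using increasing_same_type P g' by blast
    qed
    then have "P \<in> ?J" using P(1) by blast
    then have "(\<lambda>e. P (mix e)) \<in> (\<lambda>P e. P (mix e)) ` ?J" by (rule imageI)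
    from bspec [OF e this] show ?thesis .
  qed
  show thesis
  proof (rule that [of "\<lambda>k v. mix e (k, v)"])
    show "(\<lambda>v. mix e (k, v)) = s k" if "k < l" for k using that by (simp add: mix_def)
    show "EM (\<lambda>k v. mix e (k, v)) n" for n
      unfolding EM_def
    proof (intro allI impI; elim conjE)
      fix g and P :: "(nat \<times> 'x \<Rightarrow> 'm) \<Rightarrow> bool"
  assume *: "increasing n g" "definable L M A P" "depends_below n P"
      have "depends_below n (\<lambda>e. \<not> P e)" using *(3) unfolding depends_below_def by blast
      then have "P (mix e) = P (case_prod (\<lambda>k. a (g k)))"
        using true [OF *(2,3,1)] true [OF definable_not [OF *(2)] _ *(1)] by blast
      then show "P (case_prod (\<lambda>k v. mix e (k, v))) = P (case_prod (\<lambda>k. a (g k)))"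
        by (simp add: case_prod_beta)
    qed
  qed
qed

lemma EM_subseq_all:
  assumes "\<And>n. EM u n" "strict_mono H"
  shows "EM (\<lambda>k. u (H k)) n"
proof -
  obtain N where "\<forall>t\<in>H ` {..<n}. t < N" 
    using finite_nat_set_iff_bounded [of "H ` {..<n}"] by auto
  then show ?thesis
    using assms(2)
    by (intro EM_subseq [of u N n H, OF assms(1)]) (auto simp: strict_mono_def strict_mono_on_def)
qed

text \<open>Both subtuples of \<open>u\<close> are compared with a block further out. Continuing by consecutive blocks
  turns either of them, together with that block, into the beginning of an indiscernible sequence of
  \<open>l\<close>-tuples.\<close>

lemma generically_block:
  fixes P :: "('x + nat \<times> 'x \<Rightarrow> 'm) \<Rightarrow> bool"
  assumes u: "\<And>n. EM u n" and P: "definable L M A P"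
    and dep: "\<And>x. depends_below l (\<lambda>e. P (case_sum x e))"
    and f: "strict_mono_on {..<l} f" "strict_mono_on {..<l} f'"
  shows "generically (\<lambda>x. P (case_sum x (case_prod (\<lambda>k. u (f k))))) =
    generically (\<lambda>x. P (case_sum x (case_prod (\<lambda>k. u (f' k)))))"
proof (cases "l = 0")
  case True
  then have "P (case_sum x (case_prod (\<lambda>k. u (f k)))) = P (case_sum x (case_prod (\<lambda>k. u (f' k))))" for x
    by (intro depends_belowD [OF dep]) simp
  then show ?thesis by simp
next
  case False
  obtain N where N: "\<forall>t\<in>f ` {..<l} \<union> f' ` {..<l}. t < N"
    using finite_nat_set_iff_bounded [of "f ` {..<l} \<union> f' ` {..<l}"] by auto
  have tail: "generically (\<lambda>x. P (case_sum x (case_prod (\<lambda>k. u (r k))))) =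
      generically (\<lambda>x. P (case_sum x (\<lambda>(j, v). u (N + l + min j (l - 1)) v)))"
    if r: "strict_mono_on {..<l} r" "\<forall>t\<in>r ` {..<l}. t < N" for r
  proof -
    define F where "F i j = (if i = 0 then r j else N + l * i + j)" for i j
    \<comment> \<open>\<open>P\<close> sees the first \<open>l\<close> entries of a tuple; repeating the last of them keeps \<open>k\<^sub>i\<close> a relabelling of \<open>u\<close>.\<close>
    define k where "k i = (\<lambda>(j, v). u (F i (min j (l - 1))) v)" for i
    have F_mono: "F i j < F i' j'" if "j < l" "j' < l" "i < i' \<or> i = i' \<and> j < j'" for i j i' j'
    proof (cases "i = i'")
      case True
      then show ?thesis using that r(1) by (auto simp: F_def strict_mono_on_def)
    next
      case False
      then have i: "i < i'" using that by simp
      then have "l * Suc i \<le> l * i'" by (intro mult_le_mono2) simp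
      moreover have "r j < N" using that r(2) by auto
      ultimately show ?thesis using i that by (auto simp: F_def)
    qed
    have H: "strict_mono (\<lambda>t. F (g (t div l)) (t mod l))" if "strict_mono g" for g
    proof (rule strict_monoI)
      fix t t' :: nat assume "t < t'"
      then have "t div l < t' div l \<or> t div l = t' div l \<and> t mod l < t' mod l"
        by (metis div_le_mono div_mult_mod_eq le_neq_implies_less less_imp_le nat_add_left_cancel_less)
      then show "F (g (t div l)) (t mod l) < F (g (t' div l)) (t' mod l)"
        using that False by (intro F_mono) (auto simp: strict_mono_def)
    qed
    have "seq_indiscernible k"
      unfolding seq_indiscernible_def
    proof (intro allI impI; elim conjE)
      fix g :: "nat \<Rightarrow> nat" and Q :: "(nat \<times> nat \<times> 'x \<Rightarrow> 'm) \<Rightarrow> bool"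
      assume g: "strict_mono g" and Q: "definable L M A Q"
      let ?Q = "\<lambda>e. Q (\<lambda>c. e (fst c * l + min (fst (snd c)) (l - 1), snd (snd c)))"
      have Q': "definable L M A ?Q" by (rule definable_relabel [OF Q])
      then obtain n where n: "depends_below n ?Q" by (rule definable_depends_below)
      obtain h where h: "increasing n h" using ex_increasing [OF infX subset_refl] by metis
      have same: "?Q (case_prod (\<lambda>t. u (F (g (t div l)) (t mod l)))) = ?Q (case_prod (\<lambda>k. a (h k)))"
        if "strict_mono g" for g
        using EM_subseq_all [OF u H [OF that], of n] h Q' n unfolding EM_def by blast
      have conv: "(\<lambda>c. case_prod (\<lambda>t. u (F (g (t div l)) (t mod l)))
          (fst c * l + min (fst (snd c)) (l - 1), snd (snd c))) = (\<lambda>(i, c). k (g i) c)" for g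
      proof
        fix c :: "nat \<times> nat \<times> 'x"
        obtain i j v where c: "c = (i, j, v)" by (cases c)
        have "min j (l - 1) < l" using False by auto
        then have "(i * l + min j (l - 1)) div l = i" "(i * l + min j (l - 1)) mod l = min j (l - 1)"
          by simp_all
        then show "case_prod (\<lambda>t. u (F (g (t div l)) (t mod l)))
          (fst c * l + min (fst (snd c)) (l - 1), snd (snd c)) = (\<lambda>(i, c). k (g i) c) c"
          by (simp add: c k_def)
      qed
      have "strict_mono (\<lambda>i :: nat. i)" by (simp add: strict_mono_def)
      then show "Q (\<lambda>(i, c). k (g i) c) = Q (\<lambda>(i, c). k i c)"
        using same [OF g] same [of "\<lambda>i. i"] conv [of g] conv [of "\<lambda>i. i"] by simp
    qed
    from generically_const [OF small_nat_Times [OF small] this P]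
    have "generically (\<lambda>x. P (case_sum x (k 0))) = generically (\<lambda>x. P (case_sum x (k 1)))" .
    moreover have "P (case_sum x (k 0)) = P (case_sum x (case_prod (\<lambda>k. u (r k))))" for x
    proof (rule depends_belowD [OF dep])
      fix j v assume "j < l"
      then have "min j (l - 1) = j" by simp
      then show "k 0 (j, v) = case_prod (\<lambda>k. u (r k)) (j, v)" by (simp add: k_def F_def)
    qed
    moreover have "k 1 = (\<lambda>(j, v). u (N + l + min j (l - 1)) v)"
      by (simp add: k_def F_def)
    ultimately show ?thesis by simp
  qed
  have "\<forall>t\<in>f ` {..<l}. t < N" "\<forall>t\<in>f' ` {..<l}. t < N" using N by blast+
  then show ?thesis using tail [OF f(1)] tail [OF f(2)] by simp
qed

text \<open>Every tuple from this part of the index set is followed by a further index of the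
  sequence. A maximal index would have no successor to be compared with a realization of \<open>q\<close>.\<close>

definition nonlast :: "'i set" where "nonlast = {x \<in> X. \<exists>y\<in>X. x < y}"

lemma nonlast: "nonlast \<subseteq> X" "infinite nonlast"
proof -
  show "nonlast \<subseteq> X" by (auto simp: nonlast_def)
  have "\<exists>z. X - nonlast \<subseteq> {z}"
  proof (cases "X - nonlast = {}")
    case False
    then obtain z where z: "z \<in> X - nonlast" by blast
    have "y = z" if "y \<in> X - nonlast" for y
      using z that unfolding nonlast_def by (metis (no_types, lifting) DiffE linorder_neqE mem_Collect_eq)
    then show ?thesis by blast
  qed blast
  then have "finite (X - nonlast)" using finite_subset by blast
  then show "infinite nonlast" using infX by (metis finite_Diff2)
qed

definition increasing_nonlast :: "nat \<Rightarrow> (nat \<Rightarrow> 'i) \<Rightarrow> bool" where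
  "increasing_nonlast n g \<longleftrightarrow> increasing n g \<and> g ` {..<n} \<subseteq> nonlast"

text \<open>Such a \<open>d\<close> continues the sequence \<open>a\<close> in the way a sequence generated by \<open>q\<close> does.\<close>

definition generic_seq :: "(nat \<Rightarrow> 'x \<Rightarrow> 'm) \<Rightarrow> nat \<Rightarrow> bool" where
  "generic_seq d n \<longleftrightarrow> (\<forall>i<n. \<forall>P. definable L M (A \<union> entries a nonlast \<union> entries d {..<i}) P \<and> generically P \<longrightarrow> P (d i))"

text \<open>The two tuples need not lie in a common position inside an \<open>\<omega>\<close>-sequence. But \<open>g\<close> and \<open>t\<close> together list
  finitely many indices, the tuple of which, followed by \<open>d\<close>, has the type of \<open>a\<close> and therefore
  extends to an infinite sequence of that type containing both tuples.\<close>

lemma generically_transfer: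
  fixes P :: "('x + nat \<times> 'x \<Rightarrow> 'm) \<Rightarrow> bool"
  assumes EM: "\<And>m g. increasing_nonlast m g \<Longrightarrow> EM (append_seq m (\<lambda>k. a (g k)) d) (m + n)"
    and P: "definable L M A P" and dep: "\<And>x. depends_below (m + n) (\<lambda>e. P (case_sum x e))"
    and g: "increasing_nonlast m g" and t: "increasing_nonlast (m + n) t"
  shows "generically (\<lambda>x. P (case_sum x (case_prod (append_seq m (\<lambda>k. a (g k)) d)))) =
    generically (\<lambda>x. P (case_sum x (case_prod (\<lambda>k. a (t k)))))"
proof -
  let ?W = "g ` {..<m} \<union> t ` {..<m + n}"
  have W: "finite ?W" "?W \<subseteq> nonlast" using g t by (auto simp: increasing_nonlast_def)
  define c where "c = card ?W"
  obtain w where w: "strict_mono_on {..<c} w" "w ` {..<c} = ?W"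
    using finite_linorder_enumeration [OF W(1)] unfolding c_def by metis
  have "increasing_nonlast c w" using w W(2) nonlast(1) by (auto simp: increasing_nonlast_def increasing_def)
  from EM_extend [OF EM [OF this]]
  obtain u where u: "\<And>k. k < c + n \<Longrightarrow> u k = append_seq c (\<lambda>k. a (w k)) d k" "\<And>n. EM u n"
    by metis
  define pos where "pos x = (SOME i. i < c \<and> w i = x)" for x
  have pos: "pos x < c \<and> w (pos x) = x" if "x \<in> ?W" for x
  proof -
    have "x \<in> w ` {..<c}" using that by (simp only: w(2))
    then have "\<exists>i. i < c \<and> w i = x" by auto
    then show ?thesis unfolding pos_def by (rule someI_ex)
  qed
  have pos_mono: "pos x < pos y" if "x \<in> ?W" "y \<in> ?W" "x < y" for x y
  proof (rule ccontr)
    assume "\<not> pos x < pos y"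
    then consider "pos y = pos x" | "pos y < pos x" by linarith
    then have "w (pos y) \<le> w (pos x)"
    proof cases
      case 2
      then have "w (pos y) < w (pos x)"
        using pos [OF that(1)] pos [OF that(2)] by (intro strict_mono_onD [OF w(1)]) simp_all
      then show ?thesis by simp
    qed simp
    then show False using pos [OF that(1)] pos [OF that(2)] that(3) by simp
  qed
  let ?f = "\<lambda>k. if k < m then pos (g k) else c + (k - m)"
  let ?f' = "\<lambda>k. pos (t k)"
  have gW: "g k \<in> ?W" if "k < m" for k using that by blast
  have tW: "t k \<in> ?W" if "k < m + n" for k using that by blast
  have "strict_mono_on {..<m + n} ?f"
  proof (rule strict_mono_onI)
    fix i j assume ij: "i \<in> {..<m + n}" "j \<in> {..<m + n}" "i < j"
    have "pos (g i) < pos (g j)" if "j < m"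
      using that ij(3) g gW [of i] gW [of j]
      by (intro pos_mono) (auto simp: increasing_nonlast_def increasing_def strict_mono_on_def)
    moreover have "pos (g i) < c" if "i < m" using pos [OF gW [OF that]] by simp
    ultimately show "?f i < ?f j" using ij(3) by (auto intro: less_le_trans)
  qed
  moreover have "strict_mono_on {..<m + n} ?f'"
  proof (rule strict_mono_onI)
    fix i j assume "i \<in> {..<m + n}" "j \<in> {..<m + n}" "i < j"
    then show "?f' i < ?f' j"
      using t tW [of i] tW [of j]
      by (intro pos_mono) (auto simp: increasing_nonlast_def increasing_def strict_mono_on_def)
  qed
  ultimately have eq: "generically (\<lambda>x. P (case_sum x (case_prod (\<lambda>k. u (?f k))))) =
    generically (\<lambda>x. P (case_sum x (case_prod (\<lambda>k. u (?f' k)))))"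
    by (rule generically_block [OF u(2) P dep])
  have "u (?f k) = append_seq m (\<lambda>k. a (g k)) d k" if "k < m + n" for k
  proof (cases "k < m")
    case True
    then show ?thesis using pos [OF gW [OF True]] u(1) by (simp add: append_seq_def)
  next
    case False
    then have "c + (k - m) < c + n" using that by linarith
    then have "u (c + (k - m)) = append_seq c (\<lambda>k. a (w k)) d (c + (k - m))" by (rule u(1))
    also have "\<dots> = d (k - m)" by (simp add: append_seq_def)
    finally show ?thesis using False by (simp only: append_seq_def if_False)
  qed
  then have 1: "P (case_sum x (case_prod (\<lambda>k. u (?f k)))) =
      P (case_sum x (case_prod (append_seq m (\<lambda>k. a (g k)) d)))" for x
    by (intro depends_belowD [OF dep]) simp
  have "u (?f' k) = a (t k)" if "k < m + n" for k
    using pos [OF tW [OF that]] u(1) by (simp add: append_seq_def)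
  then have 2: "P (case_sum x (case_prod (\<lambda>k. u (?f' k)))) =
      P (case_sum x (case_prod (\<lambda>k. a (t k))))" for x
    by (intro depends_belowD [OF dep]) simp
  show ?thesis using eq unfolding 1 2 .
qed

text \<open>Only the first \<open>l\<close> entries of \<open>s\<close> become parameters. The remaining slots are identified with a slot
  of \<open>x\<close>, because \<open>C\<close> may be empty and so may offer no parameter to fill them.\<close>

lemma definable_inst_below:
  fixes P :: "('x + nat \<times> 'x \<Rightarrow> 'm) \<Rightarrow> bool"
  assumes P: "definable L M A P" and dep: "\<And>x. depends_below l (\<lambda>e. P (case_sum x e))"
    and s: "\<And>k. k < l \<Longrightarrow> range (s k) \<subseteq> C" and AC: "A \<subseteq> C"
  shows "definable L M C (\<lambda>x. P (case_sum x (case_prod s)))"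
proof -
  let ?h = "case_sum Inl (\<lambda>(k, v). if k < l then Inr (s k v) else Inl undefined)"
  have sC: "s k v \<in> C" if "k < l" for k v using s [OF that] by blast
  have *: "definable L M C (\<lambda>x. P (case_sum x id \<circ> ?h))"
    using sC by (intro definable_subst definable_mono [OF P AC]) (auto split: sum.splits if_splits)
  have "P (case_sum x id \<circ> ?h) = P (case_sum x (case_prod s))" for x :: "'x \<Rightarrow> 'm"
  proof -
    let ?s = "\<lambda>(k, v). if k < l then s k v else x undefined"
    have "case_sum x id \<circ> ?h = case_sum x ?s"
      by (auto simp: fun_eq_iff split: sum.splits)
    moreover have "P (case_sum x ?s) = P (case_sum x (case_prod s))"
      by (rule depends_belowD [OF dep]) simp
    ultimately show ?thesis by simp
  qed
  with * show ?thesis by simp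
qed

lemma generically_forms_p:
  assumes "\<theta> \<in> forms L B" "generically (\<lambda>x. holds M x \<theta>)"
  shows "\<theta> \<in> p"
proof (rule ccontr)
  assume "\<theta> \<notin> p"
  then have "Neg \<theta> \<in> p" using p assms(1) by (auto simp: types_def)
  then have "generically (\<lambda>x. \<not> holds M x \<theta>)" using generically_p [of "Neg \<theta>"] by simp
  then show False
    using assms(2) generically_not [OF generically_definable [OF assms(2)]] by blast
qed

lemma generically_iff:
  assumes P: "definable L M C P"
    and true: "\<And>R. definable L M C R \<Longrightarrow> generically R \<Longrightarrow> R x"
  shows "P x \<longleftrightarrow> generically P"
proof -
  have "definable L M UNIV P" by (rule definable_mono [OF P]) simp
  then show ?thesis
    using true [OF P] true [OF definable_not [OF P]] generically_not by blast
qed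

lemma generated_generically:
  assumes i: "i \<in> X" and R: "definable L M (A \<union> entries a (before X i)) R" "generically R"
  shows "R (a i)"
proof -
  let ?C = "A \<union> entries a (before X i)"
  obtain \<theta> where \<theta>: "\<theta> \<in> forms L ?C" "\<forall>x. holds M x \<theta> \<longleftrightarrow> R x"
    using R(1) unfolding definable_def by blast
  have "?C \<subseteq> B" using AB XB by (auto simp: entries_def before_def)
  then have "\<theta> \<in> forms L B" using \<theta>(1) forms_mono by blast
  moreover have "generically (\<lambda>x. holds M x \<theta>)" using R(2) \<theta>(2) by simp
  ultimately have "\<theta> \<in> p" by (rule generically_forms_p)
  then have "\<theta> \<in> restr L p ?C" using \<theta>(1) by (simp add: restr_def)
  then have "holds M (a i) \<theta>" using gen i unfolding generated_def realizes_def by blast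
  then show ?thesis using \<theta>(2) by blast
qed

text \<open>Induction on the number of entries of \<open>d\<close>. What the next entry \<open>d\<^sub>n\<close> satisfies over the earlier tuple is
  what holds generically over that tuple, hence, by transfer, generically over a tuple of \<open>a\<close>, and
  there it is satisfied by the following member of \<open>a\<close>, which is generated by \<open>p\<close>.\<close>

lemma generic_seq_EM:
  "generic_seq d n \<Longrightarrow> increasing_nonlast m g \<Longrightarrow> EM (append_seq m (\<lambda>k. a (g k)) d) (m + n)"
proof (induction n arbitrary: m g)
  case 0
  then have "EM (\<lambda>k. a (g k)) m" using increasing_EM by (simp add: increasing_nonlast_def)
  then have "EM (append_seq m (\<lambda>k. a (g k)) d) m" by (rule EM_cong) (simp add: append_seq_def)
  then show ?case by simp
next
  case (Suc n)
  have "generic_seq d n" using Suc.prems(1) unfolding generic_seq_def by (meson less_SucI)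
  note IH = Suc.IH [OF this]
  let ?s = "append_seq m (\<lambda>k. a (g k)) d" and ?l = "m + n"
  have "EM ?s (Suc ?l)"
    unfolding EM_def
  proof (intro allI impI; elim conjE)
    fix h and P :: "(nat \<times> 'x \<Rightarrow> 'm) \<Rightarrow> bool"
    assume h: "increasing (Suc ?l) h" and P: "definable L M A P" "depends_below (Suc ?l) P"
    obtain t0 where "increasing ?l t0" "t0 ` {..<?l} \<subseteq> nonlast"
      using ex_increasing [OF nonlast(2,1)] by metis
    then have t0: "increasing_nonlast ?l t0" by (simp add: increasing_nonlast_def)
    obtain i where i: "i \<in> X" "\<And>k. k < ?l \<Longrightarrow> t0 k < i"
    proof (cases "?l = 0")
      case True
      obtain i where "i \<in> X" using infX by (metis ex_in_conv finite.emptyI)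
      then show thesis using that True by simp
    next
      case False
      then have "t0 (?l - 1) \<in> nonlast" using t0 by (auto simp: increasing_nonlast_def)
      then obtain i where i: "i \<in> X" "t0 (?l - 1) < i" by (auto simp: nonlast_def)
      have "t0 k < i" if "k < ?l" for k
      proof (cases "k = ?l - 1")
        case False
        then have "k < ?l - 1" using that by linarith
        then have "t0 k < t0 (?l - 1)"
          using t0 that unfolding increasing_nonlast_def increasing_def
          by (intro strict_mono_onD [of "{..<?l}" t0]) auto
        then show ?thesis using i(2) by simp
      qed (use i(2) in simp)
      then show thesis using that i(1) by blast
    qed
    define t where "t k = (if k < ?l then t0 k else i)" for k
    have t: "increasing (Suc ?l) t"
      using t0 i by (auto simp: increasing_nonlast_def increasing_def strict_mono_on_def t_def)
    let ?P = "\<lambda>e. P (\<lambda>c. e (if fst c = ?l then Inl (snd c) else Inr c))"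
    have defP: "definable L M A ?P" by (rule definable_relabel [OF P(1)])
    have depP: "depends_below ?l (\<lambda>e. ?P (case_sum x e))" for x
      unfolding depends_below_def
    proof (intro allI impI)
      fix e e' :: "nat \<times> 'x \<Rightarrow> 'm" assume "\<forall>k<?l. \<forall>v. e (k, v) = e' (k, v)"
      then show "?P (case_sum x e) = ?P (case_sum x e')"
        by (intro depends_belowD [OF P(2)]) (auto simp: less_Suc_eq)
    qed
    let ?C = "A \<union> entries a nonlast \<union> entries d {..<n}"
    have s_C: "range (?s k) \<subseteq> ?C" if "k < ?l" for k
    proof (cases "k < m")
      case True
      then have "g k \<in> nonlast" using Suc.prems(2) by (auto simp: increasing_nonlast_def)
      then show ?thesis using True by (auto simp: append_seq_def entries_def)
    next
      case False
      then have "k - m < n" using that by simp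
      then show ?thesis using False by (auto simp: append_seq_def entries_def)
    qed
    have "P (case_prod ?s) = ?P (case_sum (d n) (case_prod ?s))"
      by (rule depends_belowD [OF P(2)]) (auto simp: append_seq_def)
    also have "\<dots> \<longleftrightarrow> generically (\<lambda>x. ?P (case_sum x (case_prod ?s)))"
    proof (rule generically_iff [where C = ?C])
      show "definable L M ?C (\<lambda>x. ?P (case_sum x (case_prod ?s)))"
        by (rule definable_inst_below [OF defP depP s_C]) auto
      show "R (d n)" if "definable L M ?C R" "generically R" for R
        using Suc.prems(1) that unfolding generic_seq_def by blast
    qed
    also have "\<dots> \<longleftrightarrow> generically (\<lambda>x. ?P (case_sum x (case_prod (\<lambda>k. a (t0 k)))))"
      by (rule generically_transfer [OF IH defP depP Suc.prems(2) t0])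
    also have "\<dots> \<longleftrightarrow> ?P (case_sum (a i) (case_prod (\<lambda>k. a (t0 k))))"
    proof (rule generically_iff [symmetric])
      show "definable L M (A \<union> entries a (before X i)) (\<lambda>x. ?P (case_sum x (case_prod (\<lambda>k. a (t0 k)))))"
      proof (rule definable_inst_below [OF defP depP])
        show "range (a (t0 k)) \<subseteq> A \<union> entries a (before X i)" if "k < ?l" for k
        proof -
          have "t0 k \<in> before X i"
            using that t0 i(2) by (auto simp: before_def increasing_nonlast_def increasing_def)
          then show ?thesis by (auto simp: entries_def)
        qed
      qed simp
      show "R (a i)" if "definable L M (A \<union> entries a (before X i)) R" "generically R" for R
        using generated_generically [OF i(1) that] .
    qed
    also have "\<dots> = P (case_prod (\<lambda>k. a (t k)))"
      by (rule depends_belowD [OF P(2)]) (auto simp: t_def)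
    also have "\<dots> = P (case_prod (\<lambda>k. a (h k)))"
      by (rule increasing_same_type [OF t h P])
    finally show "P (case_prod ?s) = P (case_prod (\<lambda>k. a (h k)))" .
  qed
  then show ?case by simp
qed

section \<open>The restriction to the Morley sequence is NIP\<close>

abbreviation "base d n \<equiv> A \<union> entries a nonlast \<union> entries d {..<n}"

lemma small_base:
  fixes d :: "nat \<Rightarrow> 'x \<Rightarrow> 'm"
  shows "|base d n| <o \<kappa>"
proof -
  have "entries d {..<n} \<subseteq> range (case_prod d)"
  proof
    fix \<mu> assume "\<mu> \<in> entries d {..<n}"
    then obtain k v where "\<mu> = d k v" by (auto simp: entries_def)
    then have "\<mu> = case_prod d (k, v)" by simp
    then show "\<mu> \<in> range (case_prod d)" by (rule range_eqI)
  qed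
  moreover have "entries a nonlast \<subseteq> entries a X" using nonlast(1) by (auto simp: entries_def)
  ultimately have sub: "base d n \<subseteq> B \<union> range (case_prod d)" using AB XB by blast
  have "|range (case_prod d)| <o \<kappa>"
    by (rule ordLeq_ordLess_trans [OF card_of_image small_nat_Times [OF small]])
  then have "|B \<union> range (case_prod d)| <o \<kappa>" using small_Un card B by blast
  then show ?thesis by (rule ordLeq_ordLess_trans [OF card_of_mono1 [OF sub]])
qed

lemma generic_seq_update:
  assumes d: "generic_seq d n"
    and x: "\<And>P. definable L M (base d n) P \<Longrightarrow> generically P \<Longrightarrow> P x"
  shows "generic_seq (d(n := x)) (Suc n)"
  unfolding generic_seq_def
proof (intro allI impI; elim conjE)
  fix i P assume i: "i < Suc n" and P: "definable L M (base (d(n := x)) i) P" "generically P"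
  have "entries (d(n := x)) {..<i} = entries d {..<i}" using i by (auto simp: entries_def)
  then have P': "definable L M (base d i) P" using P(1) by simp
  show "P ((d(n := x)) i)"
  proof (cases "i = n")
    case True
    then show ?thesis using x P' P(2) by simp
  next
    case False
    then have "i < n" using i by simp
    then have "P (d i)" using d P' P(2) unfolding generic_seq_def by blast
    then show ?thesis using False by simp
  qed
qed

lemma ex_generic_seq:
  assumes "\<And>d n P. generic_seq d n \<Longrightarrow> definable L M (base d n) P \<Longrightarrow> generically P \<Longrightarrow> \<exists>x. P x \<and> R n x"
    and R: "\<And>n. definable L M UNIV (R n)"
  shows "\<exists>d. generic_seq d n \<and> (\<forall>i<n. R i (d i))"
proof (induction n)
  case 0
  show ?case by (simp add: generic_seq_def)
next
  case (Suc n)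
  then obtain d where d: "generic_seq d n" "\<forall>i<n. R i (d i)" by blast
  obtain x where x: "R n x" "\<forall>P. definable L M (base d n) P \<and> generically P \<longrightarrow> P x"
    by (rule generically_realize [OF small_base [of d n] R assms(1) [OF d(1)]])
  have "generic_seq (d(n := x)) (Suc n)" using generic_seq_update [OF d(1)] x(2) by blast
  moreover have "\<forall>i<Suc n. R i ((d(n := x)) i)" using d(2) x(1) by (auto simp: less_Suc_eq)
  ultimately show ?case by blast
qed

text \<open>A predicate over \<open>base d n\<close> has finitely many parameters. Those that are entries of \<open>a\<close> come from
  finitely many indices; listing these in increasing order brings the predicate into a form to
  which \<open>generically_transfer\<close> applies.\<close>

lemma abstract_parameters:
  assumes P: "definable L M (base d n) P"
  obtains m g and P0 :: "('x + nat \<times> 'x \<Rightarrow> 'm) \<Rightarrow> bool" where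
    "increasing_nonlast m g" "definable L M A P0" "\<And>x. depends_below (m + n) (\<lambda>e. P0 (case_sum x e))"
    "\<And>x. P x \<longleftrightarrow> P0 (case_sum x (case_prod (append_seq m (\<lambda>k. a (g k)) d)))"
proof -
  obtain \<theta> where \<theta>: "\<theta> \<in> forms L (base d n)" "\<forall>e. holds M e \<theta> \<longleftrightarrow> P e"
    using P unfolding definable_def by blast
  define F where "F = params \<theta> \<inter> entries a nonlast - A"
  have "finite F" using finite_params [of \<theta>] by (simp add: F_def)
  have "\<exists>i v. i \<in> nonlast \<and> \<mu> = a i v" if "\<mu> \<in> F" for \<mu>
    using that by (auto simp: F_def entries_def)
  then obtain ix vx where ix: "\<And>\<mu>. \<mu> \<in> F \<Longrightarrow> ix \<mu> \<in> nonlast \<and> \<mu> = a (ix \<mu>) (vx \<mu>)" by metis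
  have "finite (ix ` F)" using \<open>finite F\<close> by simp
  then obtain g where g: "strict_mono_on {..<card (ix ` F)} g" "g ` {..<card (ix ` F)} = ix ` F"
    using finite_linorder_enumeration by metis
  define m where "m = card (ix ` F)"
  have inc: "increasing_nonlast m g"
    using g ix nonlast(1) unfolding increasing_nonlast_def increasing_def m_def by auto
  have "\<exists>k. k < m \<and> g k = ix \<mu>" if "\<mu> \<in> F" for \<mu>
  proof -
    have "ix \<mu> \<in> g ` {..<m}" unfolding m_def g(2) using that by (rule imageI)
    then show ?thesis by auto
  qed
  then obtain pos where pos: "\<And>\<mu>. \<mu> \<in> F \<Longrightarrow> pos \<mu> < m \<and> g (pos \<mu>) = ix \<mu>" by metis
  have "\<exists>k v. k < n \<and> \<mu> = d k v" if "\<mu> \<in> entries d {..<n}" for \<mu>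
    using that by (auto simp: entries_def)
  then obtain kx wx where kx: "\<And>\<mu>. \<mu> \<in> entries d {..<n} \<Longrightarrow> kx \<mu> < n \<and> \<mu> = d (kx \<mu>) (wx \<mu>)"
    by metis
  define slot where "slot \<mu> = (if \<mu> \<in> F then (pos \<mu>, vx \<mu>) else (m + kx \<mu>, wx \<mu>))" for \<mu>
  let ?s = "append_seq m (\<lambda>k. a (g k)) d"
  have slot: "fst (slot \<mu>) < m + n \<and> case_prod ?s (slot \<mu>) = \<mu>" if "\<mu> \<in> params \<theta>" "\<mu> \<notin> A" for \<mu>
  proof (cases "\<mu> \<in> F")
    case True
    then show ?thesis
      using pos [OF True] ix [OF True] by (simp add: slot_def append_seq_def)
  next
    case False
    then have "\<mu> \<in> entries d {..<n}"
      using that \<theta>(1) by (auto simp: forms_def F_def)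
    then show ?thesis using kx [of \<mu>] False by (simp add: slot_def append_seq_def)
  qed
  let ?h = "case_sum (\<lambda>v. Inl (Inl v)) (\<lambda>\<mu>. if \<mu> \<in> A then Inr \<mu> else Inl (Inr (slot \<mu>)))"
  let ?P0 = "\<lambda>e :: 'x + nat \<times> 'x \<Rightarrow> 'm. sat M (case_sum e id \<circ> ?h) \<theta>"
  show thesis
  proof (rule that [OF inc])
    have "is_formula L \<theta>" using \<theta>(1) by (simp add: forms_def)
    then show "definable L M A ?P0"
      by (intro definable_subst definable_sat) (auto split: sum.splits if_splits)
    show "depends_below (m + n) (\<lambda>e. ?P0 (case_sum x e))" for x
      unfolding depends_below_def
    proof (intro allI impI)
      fix e e' :: "nat \<times> 'x \<Rightarrow> 'm" assume eq: "\<forall>k<m + n. \<forall>v. e (k, v) = e' (k, v)"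
      show "?P0 (case_sum x e) = ?P0 (case_sum x e')"
      proof (rule sat_cong)
        fix c assume c: "c \<in> free_fm \<theta>"
        show "(case_sum (case_sum x e) id \<circ> ?h) c = (case_sum (case_sum x e') id \<circ> ?h) c"
        proof (cases c)
          case (Inr \<mu>)
          then have "\<mu> \<in> params \<theta>" using c by (simp add: params_def)
          then have "e (slot \<mu>) = e' (slot \<mu>)" if "\<mu> \<notin> A"
            using slot [OF _ that] eq by (metis prod.collapse)
          then show ?thesis using Inr by simp
        qed simp
      qed
    qed
    show "P x \<longleftrightarrow> ?P0 (case_sum x (case_prod ?s))" for x
    proof -
      have "P x \<longleftrightarrow> sat M (case_sum x id) \<theta>" using \<theta>(2) by (simp add: holds_def)
      also have "\<dots> \<longleftrightarrow> ?P0 (case_sum x (case_prod ?s))"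
      proof (rule sat_cong)
        fix c assume c: "c \<in> free_fm \<theta>"
        show "case_sum x id c = (case_sum (case_sum x (case_prod ?s)) id \<circ> ?h) c"
        proof (cases c)
          case (Inr \<mu>)
          then have "\<mu> \<in> params \<theta>" using c by (simp add: params_def)
          then show ?thesis using Inr slot [of \<mu>] by simp
        qed simp
      qed
      finally show ?thesis .
    qed
  qed
qed

text \<open>The predicate \<open>P\<close> is transferred to a tuple of \<open>a\<close>, where it is defined by a formula of
  \<open>p \<restriction> AI\<close> and is therefore true of the shattered points \<open>c\<close>. That a shattered family inside the
  predicate exists is a property of the tuple over \<open>A\<close>, so it also holds for the original
  parameters. Not all members of this family can satisfy \<open>\<rho>\<close>.\<close>

lemma ex_avoiding:
  assumes c: "\<And>i. realizes M (c i) (restr L p (A \<union> entries a X))"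
    and sh: "shattered (\<lambda>x y. sat M (case_sum x y) \<phi>) N c" and \<phi>: "is_formula L \<phi>"
    and bound: "\<And>b. (\<And>i. i < N \<Longrightarrow> holds M (b i) \<rho>) \<Longrightarrow> \<not> shattered (\<lambda>x y. sat M (case_sum x y) \<phi>) N b"
    and d: "generic_seq d n" and P: "definable L M (base d n) P" "generically P"
  shows "\<exists>x. P x \<and> \<not> holds M x \<rho>"
proof -
  obtain m g and P0 :: "('x + nat \<times> 'x \<Rightarrow> 'm) \<Rightarrow> bool" where
    g: "increasing_nonlast m g" and P0: "definable L M A P0"
    and dep: "\<And>x. depends_below (m + n) (\<lambda>e. P0 (case_sum x e))"
    and PP0: "\<And>x. P x \<longleftrightarrow> P0 (case_sum x (case_prod (append_seq m (\<lambda>k. a (g k)) d)))"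
    using abstract_parameters [OF P(1)] by metis
  let ?s = "append_seq m (\<lambda>k. a (g k)) d"
  obtain t where "increasing (m + n) t" "t ` {..<m + n} \<subseteq> nonlast"
    using ex_increasing [OF nonlast(2,1)] by metis
  then have t: "increasing_nonlast (m + n) t" by (simp add: increasing_nonlast_def)
  let ?Pt = "\<lambda>x. P0 (case_sum x (case_prod (\<lambda>k. a (t k))))"
  have "P = (\<lambda>x. P0 (case_sum x (case_prod ?s)))" by (rule ext) (rule PP0)
  from P(2) [unfolded this] have "generically (\<lambda>x. P0 (case_sum x (case_prod ?s)))" .
  then have gen_t: "generically ?Pt"
    using generically_transfer [OF generic_seq_EM [OF d] P0 dep g t] by simp
  have "definable L M (A \<union> entries a X) ?Pt"
  proof (rule definable_inst_below [OF P0 dep])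
    show "range (a (t k)) \<subseteq> A \<union> entries a X" if "k < m + n" for k
      using that t by (auto simp: increasing_nonlast_def increasing_def entries_def)
  qed simp
  then obtain \<theta> where \<theta>: "\<theta> \<in> forms L (A \<union> entries a X)" "\<forall>x. holds M x \<theta> \<longleftrightarrow> ?Pt x"
    unfolding definable_def by blast
  have "A \<union> entries a X \<subseteq> B" using AB XB by simp
  then have "\<theta> \<in> forms L B" using \<theta>(1) forms_mono by blast
  moreover have "generically (\<lambda>x. holds M x \<theta>)" using gen_t \<theta>(2) by simp
  ultimately have "\<theta> \<in> p" by (rule generically_forms_p)
  then have "\<theta> \<in> restr L p (A \<union> entries a X)" using \<theta>(1) by (simp add: restr_def)
  then have Pt_c: "?Pt (c i)" for i using c \<theta>(2) unfolding realizes_def by blast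
  let ?E = "\<lambda>e. \<exists>b. (\<forall>i<N. P0 (case_sum (\<lambda>v. b (i, v)) e)) \<and>
    shattered (\<lambda>x y. sat M (case_sum x y) \<phi>) N (\<lambda>i v. b (i, v))"
  have "definable L M A ?E"
  proof -
    let ?slot = "\<lambda>i. case_sum (\<lambda>v. Inl (i, v)) Inr :: 'x + nat \<times> 'x \<Rightarrow> nat \<times> 'x + nat \<times> 'x"
    have "definable L M A (\<lambda>e. (\<forall>i<N. P0 (\<lambda>c. e (?slot i c))) \<and>
        shattered (\<lambda>x y. sat M (case_sum x y) \<phi>) N (\<lambda>i v. e (Inl (i, v))))"
      by (intro definable_conj definable_all_less definable_shattered definable_sat \<phi>)
        (rule definable_relabel [OF P0])
    from definable_ex_left [OF this]
    have *: "definable L M A (\<lambda>e. \<exists>b. (\<forall>i<N. P0 (\<lambda>c. case_sum b e (?slot i c))) \<and>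
        shattered (\<lambda>x y. sat M (case_sum x y) \<phi>) N (\<lambda>i v. b (i, v)))" by simp
    have "(\<lambda>c. case_sum b e (?slot i c)) = case_sum (\<lambda>v. b (i, v)) e" for b e :: "nat \<times> 'x \<Rightarrow> 'm" and i
      by (auto simp: fun_eq_iff split: sum.splits)
    with * show ?thesis by (simp only:)
  qed
  moreover have "depends_below (m + n) ?E"
    unfolding depends_below_def
  proof (intro allI impI)
    fix e e' :: "nat \<times> 'x \<Rightarrow> 'm" assume "\<forall>k<m + n. \<forall>v. e (k, v) = e' (k, v)"
    then have "P0 (case_sum x e) = P0 (case_sum x e')" for x
      by (intro depends_belowD [OF dep]) simp
    then show "?E e = ?E e'" by simp
  qed
  moreover have "EM ?s (m + n)" by (rule generic_seq_EM [OF d g])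
  ultimately have "?E (case_prod ?s) = ?E (case_prod (\<lambda>k. a (t k)))"
    using t unfolding EM_def increasing_nonlast_def by blast
  moreover have "?E (case_prod (\<lambda>k. a (t k)))"
    using Pt_c sh by (intro exI [of _ "case_prod c"]) simp
  ultimately have "?E (case_prod ?s)" by (rule iffD2)
  then obtain b where b: "\<forall>i<N. P0 (case_sum (\<lambda>v. b (i, v)) (case_prod ?s))"
    "shattered (\<lambda>x y. sat M (case_sum x y) \<phi>) N (\<lambda>i v. b (i, v))" by (elim exE conjE)
  then obtain i where "i < N" "\<not> holds M (\<lambda>v. b (i, v)) \<rho>"
    using bound [of "\<lambda>i v. b (i, v)"] by blast
  then show ?thesis using b(1) PP0 by blast
qed

text \<open>Sequences \<open>d\<close> generated by \<open>q\<close> realize every pattern of membership in \<open>\<rho>\<close>, and all of them have the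
  same type over \<open>A\<close> as one sequence \<open>e\<close> inside \<open>\<chi>\<close>. So \<open>e\<close> is shattered by \<open>\<rho>\<close> with varying parameters,
  although \<open>\<chi>\<close> was chosen to exclude this.\<close>

lemma NIP_over_morley_sequence: "NIP L M (restr L p (A \<union> entries a X))"
  unfolding NIP_def
proof
  assume "has_IP L M (restr L p (A \<union> entries a X))"
  then obtain \<phi> :: "('f, 'r, 'x + nat) fm" and c :: "nat \<Rightarrow> 'x \<Rightarrow> 'm" where \<phi>: "is_formula L \<phi>"
    and c: "\<forall>i. realizes M (c i) (restr L p (A \<union> entries a X))"
    and indep: "\<forall>s :: nat set. consistent M {signed (i \<in> s) (inst_left (c i) \<phi>) | i. True}"
    unfolding has_IP_def by (elim exE conjE)
  have sh: "shattered (\<lambda>x y. sat M (case_sum x y) \<phi>) n c" for n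
    using iffD1 [OF independent_iff_shattered indep] by (rule spec)
  obtain \<rho> N where \<rho>: "\<rho> \<in> p"
    and \<rho>_bound: "\<And>b. (\<And>i. i < N \<Longrightarrow> holds M (b i) \<rho>) \<Longrightarrow> \<not> shattered (\<lambda>x y. sat M (case_sum x y) \<phi>) N b"
    using NIP_bound [OF card sat B small p NIP definable_sat [OF \<phi>]] by metis
  have \<rho>_form: "is_formula L \<rho>" using \<rho> p by (auto simp: types_def forms_def)
  obtain \<chi> K where \<chi>: "\<chi> \<in> p"
    and \<chi>_bound: "\<And>b. (\<And>i. i < K \<Longrightarrow> holds M (b i) \<chi>) \<Longrightarrow> \<not> shattered (\<lambda>x y. sat M (case_sum x y) \<rho>) K b"
    using NIP_bound [OF card sat B small p NIP definable_sat [OF \<rho>_form]] by metis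
  have def_p: "definable L M UNIV (\<lambda>x. holds M x \<theta>)" if "\<theta> \<in> p" for \<theta>
    using generically_definable [OF generically_p [OF that]] .
  have realizable: "\<exists>x. P x \<and> holds M x \<theta>" if "\<theta> \<in> p" "generically P" for \<theta> P
    using generically_ex [of "{P, \<lambda>x. holds M x \<theta>}"] generically_p [OF that(1)] that(2) by auto
  have same_type: "P (case_prod d) = P (case_prod d')"
    if "generic_seq d K" "generic_seq d' K" "definable L M A P" "depends_below K P" for d d' P
  proof -
    obtain g where g: "increasing K g" using ex_increasing [OF infX subset_refl] by metis
    have "EM d K" if "generic_seq d K" for d
    proof -
      have "increasing_nonlast 0 g" by (simp add: increasing_nonlast_def increasing_def strict_mono_on_def)
      from generic_seq_EM [OF that this] have "EM (append_seq 0 (\<lambda>k. a (g k)) d) K" by simp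
      then show ?thesis by (rule EM_cong) (simp add: append_seq_def)
    qed
    from this [OF that(1)] this [OF that(2)] show ?thesis
      unfolding EM_def using g that(3,4) by metis
  qed
  obtain e where e: "generic_seq e K" "\<forall>i<K. holds M (e i) \<chi>"
    using ex_generic_seq [of "\<lambda>_ x. holds M x \<chi>" K, OF realizable [OF \<chi>] def_p [OF \<chi>]] by blast
  have "shattered (\<lambda>x y. sat M (case_sum x y) \<rho>) K e"
    unfolding shattered_def
  proof
    fix s :: "nat set"
    have "\<exists>d. generic_seq d K \<and> (\<forall>i<K. holds M (d i) \<rho> \<longleftrightarrow> i \<in> s)"
    proof (rule ex_generic_seq)
      fix d n P assume d: "generic_seq d n" and P: "definable L M (base d n) P" "generically P"
      show "\<exists>x. P x \<and> (holds M x \<rho> \<longleftrightarrow> n \<in> s)"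
      proof (cases "n \<in> s")
        case True
        then show ?thesis using realizable [OF \<rho> P(2)] by simp
      next
        case False
        then show ?thesis
          using ex_avoiding [OF c [rule_format] sh \<phi> \<rho>_bound d P] by simp
      qed
    next
      show "definable L M UNIV (\<lambda>x. holds M x \<rho> \<longleftrightarrow> n \<in> s)" for n
        by (rule definable_iff_const [OF def_p [OF \<rho>]])
    qed
    then obtain d where d: "generic_seq d K" "\<forall>i<K. holds M (d i) \<rho> \<longleftrightarrow> i \<in> s" by blast
    \<comment> \<open>The actual parameters of \<open>\<rho>\<close> witness the pattern for \<open>d\<close>; for \<open>e\<close> other parameters will do.\<close>
    let ?E = "\<lambda>u. \<exists>y. \<forall>i<K. sat M (case_sum (\<lambda>v. u (i, v)) y) \<rho> \<longleftrightarrow> i \<in> s"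
    have "definable L M A ?E"
    proof -
      let ?slot = "\<lambda>i. case_sum (\<lambda>v. Inl (i, v)) Inr :: 'x + 'm \<Rightarrow> nat \<times> 'x + 'm"
      have "definable L M A (\<lambda>u. \<forall>i<K. sat M (\<lambda>c. u (?slot i c)) \<rho> \<longleftrightarrow> i \<in> s)"
        by (intro definable_all_less definable_iff_const)
          (rule definable_relabel [OF definable_sat [OF \<rho>_form]])
      from definable_ex_right [OF this]
      have *: "definable L M A (\<lambda>u. \<exists>y. \<forall>i<K. sat M (\<lambda>c. case_sum u y (?slot i c)) \<rho> \<longleftrightarrow> i \<in> s)" .
      have "(\<lambda>c. case_sum u y (?slot i c)) = case_sum (\<lambda>v. u (i, v)) y"
        for u :: "nat \<times> 'x \<Rightarrow> 'm" and y :: "'m \<Rightarrow> 'm" and i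
        by (auto simp: fun_eq_iff split: sum.splits)
      with * show ?thesis by (simp only:)
    qed
    moreover have "depends_below K ?E" by (auto simp: depends_below_def)
    ultimately have "?E (case_prod d) = ?E (case_prod e)" by (rule same_type [OF d(1) e(1)])
    moreover have "?E (case_prod d)" using d(2) by (intro exI [of _ id]) (simp add: holds_def)
    ultimately have "?E (case_prod e)" by (rule iffD1)
    then show "\<exists>y. \<forall>i<K. sat M (case_sum (e i) y) \<rho> \<longleftrightarrow> i \<in> s" by simp
  qed
  then show False using \<chi>_bound e(2) by blast
qed

end

theorem corollary3p11:
  fixes L :: "('f, 'r) lang"
    and T :: "('f, 'r, nat) fm set"
    and \<kappa> :: "'k rel"
    and M :: "('f, 'r, 'm) fo_struct"
    and A B :: "'m set"
    and p :: "('f, 'r, 'x + 'm) fm set"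
    and X :: "'i::linorder set"
    and a :: "'i \<Rightarrow> 'x \<Rightarrow> 'm"
  assumes "complete_theory L T"
    and "monster_model L T \<kappa> M"
    and "|UNIV :: 'x set| <o \<kappa>"
    and "A \<subseteq> B" and "|B| <o \<kappa>"
    and "p \<in> types L M B"
    and "NIP L M p"
    and "\<not> forks L M A p"
    and "infinite X"
    and "entries a X \<subseteq> B"
    and "morley_generated L M p A X a"
  shows "NIP L M (restr L p (A \<union> entries a X))"
proof -
  have "p \<subseteq> forms L UNIV" using assms(6) forms_mono [of B UNIV] by (auto simp: types_def)
  moreover have "avoids M {\<delta>. divides L M A \<delta>} p" using assms(8) not_forks_iff_avoids by blast
  ultimately obtain q where q: "p \<subseteq> q" "q \<subseteq> forms L UNIV" "avoids M {\<delta>. divides L M A \<delta>} q"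
    "\<forall>\<theta>\<in>forms L UNIV. \<theta> \<in> q \<or> Neg \<theta> \<in> q"
    by (rule complete_extension)
  have q_type: "q \<in> types L M UNIV" using q avoids_consistent by (auto simp: types_def)
  have q_nf: "\<not> forks L M A q" using q(3) not_forks_iff_avoids by blast
  have monster: "Card_order \<kappa>" "natLeq <o \<kappa>" "saturated L \<kappa> M" "strongly_homogeneous L \<kappa> M"
    using assms(2) unfolding monster_model_def by blast+
  have seq: "generated L M p A X a" "indiscernible L M A X a"
    using assms(11) unfolding morley_generated_def morley_def by blast+
  interpret morley_setting L \<kappa> M A B p q X a
    by unfold_locales (fact assms q(1) q_type q_nf monster seq)+
  show ?thesis by (rule NIP_over_morley_sequence)
qed

end
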